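(* Let $d\in\mathbb{N}$, $p>1$, $k\in\mathbb{N}$, $R\ge1$. The operator $\mathbf L_{d,p,k,R}$ is closable and its closure $\overline{\mathbf L_{d,p,k,R}}$ generates a strongly continuous semigroup $\mathbf S_{d,p,k,R}:[0,\infty)\to\mathfrak L(H^k(\mathbb{B}^d_R)\times H^{k-1}(\mathbb{B}^d_R))$. Moreover, for every $0<\varepsilon<\frac12$ there is $M_{d,p,k,R,\varepsilon}\ge1$ such that $$\|\mathbf S_{d,p,k,R}(\tau)\mathbf f\|_{H^k\times H^{k-1}}\le M_{d,p,k,R,\varepsilon}\,e^{\omega_{d,p,k,\varepsilon}\tau}\|\mathbf f\|_{H^k\times H^{k-1}}$$ for all $\mathbf f\in H^k(\mathbb{B}^d_R)\times H^{k-1}(\mathbb{B}^d_R)$ and all $\tau\ge0$, where $\omega_{d,p,k,\varepsilon}=-s_p+\max\{\frac d2-k,\varepsilon\}$.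
   Context: $s_p=\frac2{p-1}$. $H^k(\mathbb{B}^d_R)$ is the completion of $C^\infty(\overline{\mathbb{B}^d_R})$ (smooth functions on the open ball with all derivatives continuous up to the boundary) in the standard Sobolev norm; $H^0=L^2$. $\mathbf L_{d,p,k,R}$ is the densely defined operator on $H^k(\mathbb{B}^d_R)\times H^{k-1}(\mathbb{B}^d_R)$ with domain $C^\infty(\overline{\mathbb{B}^d_R})^2$ and action $\mathbf L_{d,p,k,R}\mathbf f(\xi)=(-s_pf_1-\xi^i\partial_if_1+f_2,\ \Delta f_1-(s_p+1)f_2-\xi^i\partial_if_2)(\xi)$ (Einstein summation). *)

theory Defs
  imports "HOL-Analysis.Analysis"
begin

type_synonym 'n rfun = "real ^ 'n \<Rightarrow> real"
type_synonym 'n rpair = "'n rfun \<times> 'n rfun"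

definition s_p :: "real \<Rightarrow> real" where
  "s_p p = 2 / (p - 1)"

definition pd :: "'n::finite \<Rightarrow> 'n rfun \<Rightarrow> 'n rfun" where
  "pd i f x = deriv (\<lambda>t. f (x + t *\<^sub>R axis i 1)) 0"

fun dpart :: "'n::finite list \<Rightarrow> 'n rfun \<Rightarrow> 'n rfun" where
  "dpart [] f = f"
| "dpart (i # al) f = pd i (dpart al f)"

definition smooth_cl :: "real \<Rightarrow> ('n::finite) rfun \<Rightarrow> bool" where
  "smooth_cl R f \<longleftrightarrow>
     (\<forall>al i. \<forall>x\<in>ball 0 R. (\<lambda>t. dpart al f (x + t *\<^sub>R axis i 1)) differentiable (at 0)) \<and>
     (\<forall>al. \<exists>g. continuous_on (cball 0 R) g \<and> (\<forall>x\<in>ball 0 R. g x = dpart al f x))"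

text \<open>Squared Sobolev norm of order k on the ball of radius R (sum over all ordered
  derivative words of length at most k; equivalent to the multi-index norm).\<close>
definition hk_sq :: "nat \<Rightarrow> real \<Rightarrow> ('n::finite) rfun \<Rightarrow> real" where
  "hk_sq k R f = (\<Sum>al\<in>{al::'n list. length al \<le> k}. integral (ball 0 R) (\<lambda>x. (dpart al f x)\<^sup>2))"

definition padd :: "'n rpair \<Rightarrow> 'n rpair \<Rightarrow> 'n rpair" where
  "padd u v = (\<lambda>x. fst u x + fst v x, \<lambda>x. snd u x + snd v x)"

definition pscale :: "real \<Rightarrow> 'n rpair \<Rightarrow> 'n rpair" where
  "pscale c u = (\<lambda>x. c * fst u x, \<lambda>x. c * snd u x)"

definition psub :: "'n rpair \<Rightarrow> 'n rpair \<Rightarrow> 'n rpair" where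
  "psub u v = padd u (pscale (-1) v)"

definition pzero :: "'n rpair" where
  "pzero = (\<lambda>x. 0, \<lambda>x. 0)"

definition Dom :: "real \<Rightarrow> ('n::finite) rpair set" where
  "Dom R = {u. smooth_cl R (fst u) \<and> smooth_cl R (snd u)}"

definition Nrm :: "nat \<Rightarrow> real \<Rightarrow> ('n::finite) rpair \<Rightarrow> real" where
  "Nrm k R u = sqrt (hk_sq k R (fst u) + hk_sq (k - 1) R (snd u))"

definition Lop :: "real \<Rightarrow> ('n::finite) rpair \<Rightarrow> 'n rpair" where
  "Lop p u =
     (\<lambda>\<xi>. - s_p p * fst u \<xi> - (\<Sum>i\<in>UNIV. \<xi> $ i * pd i (fst u) \<xi>) + snd u \<xi>,
      \<lambda>\<xi>. (\<Sum>i\<in>UNIV. pd i (pd i (fst u)) \<xi>) - (s_p p + 1) * snd u \<xi>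
            - (\<Sum>i\<in>UNIV. \<xi> $ i * pd i (snd u) \<xi>))"

text \<open>An element of the completion H^k x H^(k-1) is represented by a Cauchy sequence
  in (Dom R, Nrm k R); two representatives are identified by \<open>ceq\<close>.\<close>

definition compl :: "('n::finite) rpair set \<Rightarrow> ('n rpair \<Rightarrow> real) \<Rightarrow> (nat \<Rightarrow> 'n rpair) set" where
  "compl D N = {U. (\<forall>n. U n \<in> D) \<and>
      (\<forall>e>0. \<exists>M. \<forall>m\<ge>M. \<forall>n\<ge>M. N (psub (U m) (U n)) < e)}"

definition ceq :: "(('n::finite) rpair \<Rightarrow> real) \<Rightarrow> (nat \<Rightarrow> 'n rpair) \<Rightarrow> (nat \<Rightarrow> 'n rpair) \<Rightarrow> bool" where
  "ceq N U V \<longleftrightarrow> (\<lambda>n. N (psub (U n) (V n))) \<longlonglongrightarrow> 0"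

definition cnorm :: "(('n::finite) rpair \<Rightarrow> real) \<Rightarrow> (nat \<Rightarrow> 'n rpair) \<Rightarrow> real" where
  "cnorm N U = lim (\<lambda>n. N (U n))"

definition cadd :: "(nat \<Rightarrow> ('n::finite) rpair) \<Rightarrow> (nat \<Rightarrow> 'n rpair) \<Rightarrow> nat \<Rightarrow> 'n rpair" where
  "cadd U V = (\<lambda>n. padd (U n) (V n))"

definition cscale :: "real \<Rightarrow> (nat \<Rightarrow> ('n::finite) rpair) \<Rightarrow> nat \<Rightarrow> 'n rpair" where
  "cscale c U = (\<lambda>n. pscale c (U n))"

definition csub :: "(nat \<Rightarrow> ('n::finite) rpair) \<Rightarrow> (nat \<Rightarrow> 'n rpair) \<Rightarrow> nat \<Rightarrow> 'n rpair" where
  "csub U V = (\<lambda>n. psub (U n) (V n))"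

definition cemb :: "('n::finite) rpair \<Rightarrow> nat \<Rightarrow> 'n rpair" where
  "cemb u = (\<lambda>n. u)"

definition closable_op :: "('n::finite) rpair set \<Rightarrow> ('n rpair \<Rightarrow> real) \<Rightarrow> ('n rpair \<Rightarrow> 'n rpair) \<Rightarrow> bool" where
  "closable_op D N L \<longleftrightarrow>
     (\<forall>f G. (\<forall>j. f j \<in> D) \<and> G \<in> compl D N \<and>
        (\<lambda>j. cnorm N (cemb (f j))) \<longlonglongrightarrow> 0 \<and>
        (\<lambda>j. cnorm N (csub (cemb (L (f j))) G)) \<longlonglongrightarrow> 0
        \<longrightarrow> cnorm N G = 0)"

definition closure_rel :: "('n::finite) rpair set \<Rightarrow> ('n rpair \<Rightarrow> real) \<Rightarrow> ('n rpair \<Rightarrow> 'n rpair)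
    \<Rightarrow> (nat \<Rightarrow> 'n rpair) \<Rightarrow> (nat \<Rightarrow> 'n rpair) \<Rightarrow> bool" where
  "closure_rel D N L U V \<longleftrightarrow> U \<in> compl D N \<and> V \<in> compl D N \<and>
     (\<exists>f. (\<forall>j. f j \<in> D) \<and>
        (\<lambda>j. cnorm N (csub (cemb (f j)) U)) \<longlonglongrightarrow> 0 \<and>
        (\<lambda>j. cnorm N (csub (cemb (L (f j))) V)) \<longlonglongrightarrow> 0)"

definition C0_semigroup :: "('n::finite) rpair set \<Rightarrow> ('n rpair \<Rightarrow> real)
    \<Rightarrow> (real \<Rightarrow> (nat \<Rightarrow> 'n rpair) \<Rightarrow> (nat \<Rightarrow> 'n rpair)) \<Rightarrow> bool" where
  "C0_semigroup D N S \<longleftrightarrow>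
     (\<forall>t\<ge>0. \<forall>U\<in>compl D N. S t U \<in> compl D N) \<and>
     (\<forall>t\<ge>0. \<forall>U\<in>compl D N. \<forall>V\<in>compl D N. ceq N U V \<longrightarrow> ceq N (S t U) (S t V)) \<and>
     (\<forall>t\<ge>0. \<forall>U\<in>compl D N. \<forall>V\<in>compl D N. ceq N (S t (cadd U V)) (cadd (S t U) (S t V))) \<and>
     (\<forall>t\<ge>0. \<forall>c. \<forall>U\<in>compl D N. ceq N (S t (cscale c U)) (cscale c (S t U))) \<and>
     (\<forall>t\<ge>0. \<exists>C. \<forall>U\<in>compl D N. cnorm N (S t U) \<le> C * cnorm N U) \<and>
     (\<forall>U\<in>compl D N. ceq N (S 0 U) U) \<and>
     (\<forall>t\<ge>0. \<forall>s\<ge>0. \<forall>U\<in>compl D N. ceq N (S (t + s) U) (S t (S s U))) \<and>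
     (\<forall>U\<in>compl D N. ((\<lambda>t. cnorm N (csub (S t U) U)) \<longlongrightarrow> 0) (at_right 0))"

definition gen_rel :: "('n::finite) rpair set \<Rightarrow> ('n rpair \<Rightarrow> real)
    \<Rightarrow> (real \<Rightarrow> (nat \<Rightarrow> 'n rpair) \<Rightarrow> (nat \<Rightarrow> 'n rpair))
    \<Rightarrow> (nat \<Rightarrow> 'n rpair) \<Rightarrow> (nat \<Rightarrow> 'n rpair) \<Rightarrow> bool" where
  "gen_rel D N S U V \<longleftrightarrow> U \<in> compl D N \<and> V \<in> compl D N \<and>
     ((\<lambda>h. cnorm N (csub (cscale (1 / h) (csub (S h U) U)) V)) \<longlongrightarrow> 0) (at_right 0)"

definition generates :: "('n::finite) rpair set \<Rightarrow> ('n rpair \<Rightarrow> real) \<Rightarrow> ('n rpair \<Rightarrow> 'n rpair)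
    \<Rightarrow> (real \<Rightarrow> (nat \<Rightarrow> 'n rpair) \<Rightarrow> (nat \<Rightarrow> 'n rpair)) \<Rightarrow> bool" where
  "generates D N L S \<longleftrightarrow> C0_semigroup D N S \<and>
     (\<forall>U V. gen_rel D N S U V \<longleftrightarrow> closure_rel D N L U V)"

end

theory Submission
  imports Defs
begin

text \<open>Polynomial pairs form a dense subspace that the operator \<open>L\<close> maps to itself, and on them the
  evolution equation is solved by explicit finite sums, because up to a multiple of the identity \<open>L\<close>
  lowers the degree of homogeneous data. Hence neither resolvents nor the Lumer-Phillips theorem are
  needed: it suffices to bound the polynomial flow in \<open>H\<^sup>k \<times> H\<^sup>k\<^sup>-\<^sup>1\<close> and to extend it by density.

  Derivatives of order \<open>j\<close> of a solution solve the same equation with \<open>s\<close> replaced by \<open>s + j\<close>. The wave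
  energy of the derivatives of order \<open>k - 1\<close> grows at most at rate \<open>d/2 - k - s\<close>, the boundary terms
  having the good sign because \<open>R \<ge> 1\<close>. Lower derivatives are recovered downwards from the Poincare
  inequality: the mean over the ball of a derivative of order \<open>j\<close> satisfies a scalar equation
  \<open>a' = -(s + j) a + \<dots>\<close> with inhomogeneity controlled by higher derivatives, which costs \<open>\<epsilon>\<close> in the
  exponent when it resonates with \<open>-s\<close>.\<close>

section \<open>Partial derivatives of polynomials\<close>

text \<open>The generator has to equal the closure, not merely extend it. The closure lies in the
  generator because the flow satisfies an integrated form of the equation with uniform constants on
  polynomials, and these are dense in the graph norm: approximation is uniform with
  \<open>k + 2\<close> derivatives, two of which pay for \<open>L\<close>. The reverse inclusion,
  for which a resolvent is customary, uses time averages of polynomial solutions, which are again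
  polynomials. Closability is then a by-product: if f_j tends to 0 and L f_j to G, the pair (0, G)
  belongs to the generator of a semigroup that fixes 0, so G is 0.

  Representatives are total functions, of which \<open>Nrm\<close> sees only the values on the open
  ball. All laws of the flow are therefore stated as the vanishing of a seminorm, and uniqueness of
  solutions is read off from the growth bound for a difference.\<close>

abbreviation rp :: "(real ^ 'n::finite \<Rightarrow> real) \<Rightarrow> bool" where
  "rp \<equiv> real_polynomial_function"

text \<open>\<open>pd\<close> is total and returns an unspecified value where no derivative exists,
  so the rules of calculus are proved for this relation and carried over to \<open>pd\<close> by
  \<open>has_pd_imp\<close>.\<close>

definition has_pd :: "'n::finite \<Rightarrow> 'n rfun \<Rightarrow> real \<Rightarrow> real ^ 'n \<Rightarrow> bool" where
  "has_pd i f g x \<longleftrightarrow> ((\<lambda>t. f (x + t *\<^sub>R axis i 1)) has_real_derivative g) (at 0)"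

lemma has_pd_imp: "has_pd i f g x \<Longrightarrow> pd i f x = g"
  unfolding has_pd_def pd_def by (rule DERIV_imp_deriv)

lemma has_pd_add: "has_pd i f a x \<Longrightarrow> has_pd i g b x \<Longrightarrow> has_pd i (\<lambda>x. f x + g x) (a + b) x"
  unfolding has_pd_def by (rule DERIV_add)

lemma has_pd_mult:
  "has_pd i f a x \<Longrightarrow> has_pd i g b x \<Longrightarrow> has_pd i (\<lambda>x. f x * g x) (a * g x + f x * b) x"
  unfolding has_pd_def by (auto intro!: derivative_eq_intros)

lemma has_pd_const: "has_pd i (\<lambda>x. c) 0 x"
  unfolding has_pd_def by auto

lemma has_pd_cmult: "has_pd i f a x \<Longrightarrow> has_pd i (\<lambda>x. c * f x) (c * a) x"
  unfolding has_pd_def by (rule DERIV_cmult)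

lemma has_pd_linear:
  assumes "bounded_linear f" shows "has_pd i f (f (axis i 1)) x"
proof -
  interpret bounded_linear f by fact
  show ?thesis
    unfolding has_pd_def add scaleR by (auto intro!: derivative_eq_intros)
qed

lemma rp_coord: "rp (\<lambda>x. x $ i)"
  by (intro real_polynomial_function.intros bounded_linear_vec_nth)

lemmas rp_intros = real_polynomial_function.intros(2-4) real_polynomial_function_diff
  real_polynomial_function_sum real_polynomial_function_power rp_coord

text \<open>Existence of a polynomial derivative is the induction statement because the product case
  needs derivatives that exist and are polynomials at once. \<open>rp_has_pd\<close> and
  \<open>rp_pd\<close> are its two halves.\<close>

lemma rp_ex_pd:
  assumes "rp f" shows "\<exists>g. rp g \<and> (\<forall>x. has_pd i f (g x) x)"
  using assms
proof (induction f)
  case (linear f)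
  then show ?case by (intro exI[of _ "\<lambda>x. f (axis i 1)"]) (auto intro: has_pd_linear)
next
  case (const c)
  then show ?case by (intro exI[of _ "\<lambda>x. 0"]) (auto intro: has_pd_const)
next
  case (add f g)
  then obtain a b where "rp a" "rp b" "\<And>x. has_pd i f (a x) x" "\<And>x. has_pd i g (b x) x" by blast
  then show ?case by (intro exI[of _ "\<lambda>x. a x + b x"]) (auto intro: has_pd_add)
next
  case (mult f g)
  then obtain a b where "rp a" "rp b" "\<And>x. has_pd i f (a x) x" "\<And>x. has_pd i g (b x) x" by blast
  with mult.hyps show ?case
    by (intro exI[of _ "\<lambda>x. a x * g x + f x * b x"]) (auto intro: has_pd_mult)
qed

lemma rp_has_pd: assumes "rp f" shows "has_pd i f (pd i f x) x"
  using rp_ex_pd[OF assms, of i] has_pd_imp by metis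

lemma rp_pd: assumes "rp f" shows "rp (pd i f)"
proof -
  obtain g where g: "rp g" "\<forall>x. has_pd i f (g x) x" using rp_ex_pd[OF assms] by blast
  then have "pd i f = g" using has_pd_imp by blast
  with g show ?thesis by simp
qed

lemma rp_dpart: "rp f \<Longrightarrow> rp (dpart al f)"
  by (induction al) (auto intro: rp_pd)

lemma pd_add: "rp f \<Longrightarrow> rp g \<Longrightarrow> pd i (\<lambda>x. f x + g x) = (\<lambda>x. pd i f x + pd i g x)"
  by (intro ext has_pd_imp has_pd_add rp_has_pd)

lemma pd_mult: "rp f \<Longrightarrow> rp g \<Longrightarrow> pd i (\<lambda>x. f x * g x) = (\<lambda>x. pd i f x * g x + f x * pd i g x)"
  by (intro ext has_pd_imp has_pd_mult rp_has_pd)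

lemma pd_const: "pd i (\<lambda>x. c) = (\<lambda>x. 0)"
  by (intro ext has_pd_imp has_pd_const)

lemma pd_cmult: "rp f \<Longrightarrow> pd i (\<lambda>x. c * f x) = (\<lambda>x. c * pd i f x)"
  by (intro ext has_pd_imp has_pd_cmult rp_has_pd)

lemma pd_diff: "rp f \<Longrightarrow> rp g \<Longrightarrow> pd i (\<lambda>x. f x - g x) = (\<lambda>x. pd i f x - pd i g x)"
  using pd_add[of f "\<lambda>x. -1 * g x" i] pd_cmult[of g i "-1"] by auto

lemma pd_linear: "bounded_linear f \<Longrightarrow> pd i f = (\<lambda>x. f (axis i 1))"
  by (intro ext has_pd_imp has_pd_linear)

lemma pd_coord: "pd i (\<lambda>x. x $ j) = (\<lambda>x. if i = j then 1 else 0)"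
  by (simp add: pd_linear bounded_linear_vec_nth axis_def eq_commute[of i j])

lemma pd_sum:
  assumes "finite A" "\<And>a. a \<in> A \<Longrightarrow> rp (f a)"
  shows "pd i (\<lambda>x. \<Sum>a\<in>A. f a x) = (\<lambda>x. \<Sum>a\<in>A. pd i (f a) x)"
  using assms
proof (induction A)
  case empty
  then show ?case by (simp add: pd_const)
next
  case (insert a A)
  then show ?case by (simp add: pd_add real_polynomial_function_sum)
qed

text \<open>Symmetry of second derivatives is algebraic here: it holds for linear forms and
  constants and is preserved by sums and by the Leibniz rule.\<close>

lemma pd_comm: assumes "rp f" shows "pd i (pd j f) = pd j (pd i f)"
  using assms
proof (induction f)
  case (linear f)
  then show ?case by (simp add: pd_linear pd_const)
next
  case (mult f g)
  then show ?case by (simp add: pd_mult pd_add rp_pd real_polynomial_function.intros algebra_simps)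
qed (simp_all add: pd_const pd_add rp_pd)

lemma dpart_append: "dpart (al @ be) f = dpart al (dpart be f)"
  by (induction al) auto

lemma dpart_cmult: "rp f \<Longrightarrow> dpart al (\<lambda>x. c * f x) = (\<lambda>x. c * dpart al f x)"
  by (induction al) (auto simp: pd_cmult rp_dpart)

lemma rp_continuous: "rp f \<Longrightarrow> continuous_on S f"
  using continuous_on_polymonial_function real_polynomial_function_eq by blast

lemma integrable_on_ball:
  fixes f :: "real ^ 'n::finite \<Rightarrow> real"
  assumes "continuous_on (cball a R) f"
  shows "f integrable_on ball a R"
proof -
  have "f absolutely_integrable_on cball a R"
    using borel_integrable_compact[OF compact_cball assms]
    by (simp add: set_integrable_def integrable_completion)
  then show ?thesis
    by (metis ball_subset_cball absolutely_integrable_on_def set_integrable_subset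
        set_lebesgue_integral_eq_integral(1) lmeasurable_ball fmeasurableD)
qed

lemma rp_integrable: "rp f \<Longrightarrow> f integrable_on ball a R"
  by (intro integrable_on_ball rp_continuous)

section \<open>Polynomial-valued curves\<close>

text \<open>A curve is carried together with its time derivative and is a finite sum of scalar
  functions times fixed polynomials. Differentiating under the integral and exchanging time with
  space derivatives thus reduce to finite sums, and no topology on polynomials enters.\<close>

inductive poly_curve :: "(real \<Rightarrow> ('n::finite) rfun) \<Rightarrow> (real \<Rightarrow> 'n rfun) \<Rightarrow> bool" where
  poly_curve_term: "rp w \<Longrightarrow> (\<And>t. (c has_real_derivative c' t) (at t)) \<Longrightarrow>
    poly_curve (\<lambda>t x. c t * w x) (\<lambda>t x. c' t * w x)"
| poly_curve_add: "poly_curve v v' \<Longrightarrow> poly_curve u u' \<Longrightarrow> poly_curve (\<lambda>t x. v t x + u t x) (\<lambda>t x. v' t x + u' t x)"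

lemma poly_curve_cong: "poly_curve v v' \<Longrightarrow> (\<And>t x. v t x = u t x) \<Longrightarrow> (\<And>t x. v' t x = u' t x) \<Longrightarrow> poly_curve u u'"
proof -
  assume "poly_curve v v'" "\<And>t x. v t x = u t x" "\<And>t x. v' t x = u' t x"
  moreover from this have "v = u" "v' = u'" by (auto intro!: ext)
  ultimately show ?thesis by simp
qed

lemma poly_curve_rp: "poly_curve v v' \<Longrightarrow> rp (v t)" and poly_curve_rp': "poly_curve v v' \<Longrightarrow> rp (v' t)"
  by (induction rule: poly_curve.induct) auto

lemma poly_curve_const: "rp w \<Longrightarrow> poly_curve (\<lambda>t. w) (\<lambda>t x. 0)"
  by (rule poly_curve_cong[OF poly_curve_term[of w "\<lambda>t. 1" "\<lambda>t. 0"]]) auto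

lemma poly_curve_deriv: "poly_curve v v' \<Longrightarrow> ((\<lambda>t. v t x) has_real_derivative v' t x) (at t)"
  by (induction rule: poly_curve.induct) (auto intro!: derivative_eq_intros)

lemma poly_curve_pd: "poly_curve v v' \<Longrightarrow> poly_curve (\<lambda>t. pd i (v t)) (\<lambda>t. pd i (v' t))"
proof (induction rule: poly_curve.induct)
  case (poly_curve_term w c c')
  then show ?case
    by (intro poly_curve_cong[OF poly_curve.poly_curve_term[of "pd i w" c c']]) (auto simp: rp_pd pd_cmult)
next
  case (poly_curve_add v v' u u')
  show ?case
    by (rule poly_curve_cong[OF poly_curve.poly_curve_add[OF poly_curve_add.IH]])
      (use poly_curve_add.hyps in \<open>auto simp: poly_curve_rp poly_curve_rp' pd_add\<close>)
qed

lemma poly_curve_dpart: "poly_curve v v' \<Longrightarrow> poly_curve (\<lambda>t. dpart al (v t)) (\<lambda>t. dpart al (v' t))"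
  by (induction al) (auto dest: poly_curve_pd)

lemma poly_curve_mult:
  assumes "poly_curve v v'" "poly_curve u u'"
  shows "poly_curve (\<lambda>t x. v t x * u t x) (\<lambda>t x. v' t x * u t x + v t x * u' t x)"
  using assms
proof (induction rule: poly_curve.induct)
  case (poly_curve_term w c c')
  note * = poly_curve_term
  from \<open>poly_curve u u'\<close> show ?case
  proof (induction rule: poly_curve.induct)
    case (poly_curve_term z b b')
    show ?case
      by (rule poly_curve_cong[OF poly_curve.poly_curve_term[of "\<lambda>x. w x * z x" "\<lambda>t. c t * b t" "\<lambda>t. c' t * b t + c t * b' t"]])
        (use * poly_curve_term in \<open>auto intro!: derivative_eq_intros simp: algebra_simps\<close>)
  next
    case (poly_curve_add v v' u u')
    show ?case
      by (rule poly_curve_cong[OF poly_curve.poly_curve_add[OF poly_curve_add.IH]]) (auto simp: algebra_simps)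
  qed
next
  case (poly_curve_add a a' b b')
  show ?case
    by (rule poly_curve_cong[OF poly_curve.poly_curve_add[OF poly_curve_add.IH]]) (use poly_curve_add in \<open>auto simp: algebra_simps\<close>)
qed

lemma poly_curve_mult_rp: "rp w \<Longrightarrow> poly_curve v v' \<Longrightarrow> poly_curve (\<lambda>t x. w x * v t x) (\<lambda>t x. w x * v' t x)"
  by (rule poly_curve_cong[OF poly_curve_mult[OF poly_curve_const]]) auto

lemma poly_curve_cmult: "poly_curve v v' \<Longrightarrow> poly_curve (\<lambda>t x. c * v t x) (\<lambda>t x. c * v' t x)"
  by (rule poly_curve_mult_rp) auto

lemma poly_curve_diff: "poly_curve v v' \<Longrightarrow> poly_curve u u' \<Longrightarrow> poly_curve (\<lambda>t x. v t x - u t x) (\<lambda>t x. v' t x - u' t x)"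
  by (rule poly_curve_cong[OF poly_curve_add[OF _ poly_curve_cmult[of u u' "-1"]]]) auto

lemma poly_curve_sum:
  assumes "finite A" "\<And>a. a \<in> A \<Longrightarrow> poly_curve (v a) (v' a)"
  shows "poly_curve (\<lambda>t x. \<Sum>a\<in>A. v a t x) (\<lambda>t x. \<Sum>a\<in>A. v' a t x)"
  using assms
proof (induction A)
  case empty
  show ?case using poly_curve_const[of "\<lambda>x. 0"] by auto
next
  case (insert a A)
  then show ?case by (auto intro: poly_curve_add)
qed

lemma poly_curve_shift: "poly_curve v v' \<Longrightarrow> poly_curve (\<lambda>t. v (t + s)) (\<lambda>t. v' (t + s))"
proof (induction rule: poly_curve.induct)
  case (poly_curve_term w c c')
  show ?case
    by (rule poly_curve.poly_curve_term) (use poly_curve_term DERIV_shift in \<open>blast+\<close>)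
qed (auto intro: poly_curve_add)

lemma poly_curve_integral:
  "poly_curve v v' \<Longrightarrow> ((\<lambda>t. integral (ball a R) (v t)) has_real_derivative integral (ball a R) (v' t)) (at t)"
proof (induction rule: poly_curve.induct)
  case (poly_curve_term w c c')
  then show ?case by (auto intro!: derivative_eq_intros)
next
  case (poly_curve_add v v' u u')
  then show ?case
    by (auto intro!: derivative_eq_intros simp: integral_add rp_integrable poly_curve_rp poly_curve_rp')
qed

lemma poly_curve_antideriv:
  assumes "poly_curve v v'" shows "\<exists>V. poly_curve V v \<and> (\<forall>x. V 0 x = 0)"
  using assms
proof (induction rule: poly_curve.induct)
  case (poly_curve_term w c c')
  \<comment> \<open>The coefficient \<open>c\<close> is differentiable, hence continuous, so it has
    an antiderivative on the whole line. The witness below uses \<open>F t - F 0\<close> in order to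
    start at zero.\<close>
  have "\<exists>F. \<forall>x :: real. -\<infinity> < ereal x \<longrightarrow> ereal x < \<infinity> \<longrightarrow> (F has_vector_derivative c x) (at x)"
    using poly_curve_term by (intro einterval_antiderivative) (auto intro: DERIV_isCont)
  then obtain F where F: "\<And>x. (F has_real_derivative c x) (at x)"
    by (auto simp: has_real_derivative_iff_has_vector_derivative)
  show ?case
    by (rule exI[of _ "\<lambda>t x. (F t - F 0) * w x"], intro conjI poly_curve.poly_curve_term poly_curve_term)
      (auto intro!: derivative_eq_intros F)
next
  case (poly_curve_add v v' u u')
  then obtain V U where "poly_curve V v" "poly_curve U u" "\<forall>x. V 0 x = 0" "\<forall>x. U 0 x = 0" by blast
  then show ?case by (intro exI[of _ "\<lambda>t x. V t x + U t x"]) (auto intro: poly_curve.poly_curve_add)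
qed

section \<open>Functions with finitely many continuous partial derivatives\<close>

primrec Ck :: "nat \<Rightarrow> ('n::finite) rfun \<Rightarrow> bool" where
  "Ck 0 f \<longleftrightarrow> continuous_on UNIV f"
| "Ck (Suc m) f \<longleftrightarrow> continuous_on UNIV f \<and> (\<forall>i. (\<forall>x. has_pd i f (pd i f x) x) \<and> Ck m (pd i f))"

lemma Ck_continuous: "Ck m f \<Longrightarrow> continuous_on UNIV f"
  by (cases m) auto

lemma Ck_SucI:
  assumes "continuous_on UNIV f" "\<And>i x. has_pd i f (g i x) x" "\<And>i. Ck m (g i)"
  shows "Ck (Suc m) f"
proof -
  have "pd i f = g i" for i using assms(2) has_pd_imp by blast
  with assms show ?thesis by auto
qed

lemma Ck_Suc_imp: "Ck (Suc m) f \<Longrightarrow> Ck m f"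
proof (induction m arbitrary: f)
  case (Suc m)
  then show ?case by (metis Ck.simps(2))
qed auto

lemma Ck_mono: "m \<le> n \<Longrightarrow> Ck n f \<Longrightarrow> Ck m f"
  by (induction rule: dec_induct) (auto dest: Ck_Suc_imp simp del: Ck.simps)

lemma Ck_rp: "rp f \<Longrightarrow> Ck m f"
  by (induction m arbitrary: f) (auto simp: rp_continuous rp_has_pd rp_pd)

lemma Ck_add: "Ck m f \<Longrightarrow> Ck m g \<Longrightarrow> Ck m (\<lambda>x. f x + g x)"
proof (induction m arbitrary: f g)
  case (Suc m)
  show ?case
    by (rule Ck_SucI[where g="\<lambda>i x. pd i f x + pd i g x"])
      (use Suc in \<open>auto intro: has_pd_add continuous_on_add\<close>)
qed (auto intro: continuous_on_add)

lemma Ck_mult: "Ck m f \<Longrightarrow> Ck m g \<Longrightarrow> Ck m (\<lambda>x. f x * g x)"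
proof (induction m arbitrary: f g)
  case (Suc m)
  have *: "Ck m f" "Ck m g" using Suc.prems by (auto dest: Ck_Suc_imp simp del: Ck.simps)
  show ?case
  proof (rule Ck_SucI[where g="\<lambda>i x. pd i f x * g x + f x * pd i g x"])
    show "continuous_on UNIV (\<lambda>x. f x * g x)"
      using Suc.prems by (intro continuous_on_mult) auto
    show "has_pd i (\<lambda>x. f x * g x) (pd i f x * g x + f x * pd i g x) x" for i x
      using Suc.prems by (intro has_pd_mult) auto
    show "Ck m (\<lambda>x. pd i f x * g x + f x * pd i g x)" for i
      using Suc.prems by (intro Ck_add Suc.IH *) auto
  qed
qed (auto intro: continuous_on_mult)

lemma has_pd_inverse:
  assumes "has_pd i f a x" "f x \<noteq> 0"
  shows "has_pd i (\<lambda>x. inverse (f x)) (- a * (inverse (f x) * inverse (f x))) x"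
  using assms unfolding has_pd_def by (auto intro!: derivative_eq_intros simp: field_simps)

lemma Ck_inverse: "Ck m f \<Longrightarrow> (\<And>x. f x \<noteq> 0) \<Longrightarrow> Ck m (\<lambda>x. inverse (f x))"
proof (induction m)
  case (Suc m)
  have f: "Ck m f" using Suc.prems(1) by (rule Ck_Suc_imp)
  show ?case
  proof (rule Ck_SucI[where g="\<lambda>i x. (-1 * pd i f x) * (inverse (f x) * inverse (f x))"])
    show "continuous_on UNIV (\<lambda>x. inverse (f x))"
      using Suc.prems Ck_continuous by (blast intro: continuous_on_inverse)
    show "has_pd i (\<lambda>x. inverse (f x)) (-1 * pd i f x * (inverse (f x) * inverse (f x))) x" for i x
      using has_pd_inverse Suc.prems by (metis Ck.simps(2) mult_minus1)
    have "Ck m (pd i f)" for i using Suc.prems by simp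
    moreover have "Ck m (\<lambda>x. -1)" by (rule Ck_rp) auto
    ultimately show "Ck m (\<lambda>x. -1 * pd i f x * (inverse (f x) * inverse (f x)))" for i
      by (intro Ck_mult Suc.IH f Suc.prems)
  qed
qed (auto intro: continuous_on_inverse)

text \<open>At the kink the difference quotient is at most \<open>\<bar>h\<bar> ^ Suc n\<close>,
  which tends to 0. Truncated powers supply cutoffs of any finite order of smoothness.\<close>

lemma DERIV_max_power:
  "((\<lambda>s::real. (max 0 s) ^ Suc (Suc n)) has_real_derivative real (Suc (Suc n)) * (max 0 s) ^ Suc n) (at s)"
proof -
  consider "s > 0" | "s < 0" | "s = 0" by linarith
  then show ?thesis
  proof cases
    case 1
    have "((\<lambda>s. s ^ Suc (Suc n)) has_real_derivative real (Suc (Suc n)) * (max 0 s) ^ Suc n) (at s)"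
      using 1 DERIV_pow[of "Suc (Suc n)" s] by simp
    then show ?thesis
      by (rule has_field_derivative_transform_within_open[of _ _ _ "{0<..}"]) (use 1 in auto)
  next
    case 2
    have "((\<lambda>s::real. 0) has_real_derivative real (Suc (Suc n)) * (max 0 s) ^ Suc n) (at s)"
      using 2 by simp
    then show ?thesis
      by (rule has_field_derivative_transform_within_open[of _ _ _ "{..<0}"]) (use 2 in auto)
  next
    case 3
    have "((\<lambda>h. ((max 0 h) ^ Suc (Suc n)) / h) \<longlongrightarrow> 0) (at (0::real))"
    proof (rule Lim_null_comparison[where g="\<lambda>h. \<bar>h\<bar> ^ Suc n"])
      show "\<forall>\<^sub>F h in at (0::real). norm (max 0 h ^ Suc (Suc n) / h) \<le> \<bar>h\<bar> ^ Suc n"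
      proof (intro always_eventually allI)
        fix h :: real
        show "norm (max 0 h ^ Suc (Suc n) / h) \<le> \<bar>h\<bar> ^ Suc n"
        proof (cases "h > 0")
          case False
          then have "max 0 h = 0" by simp
          then show ?thesis by (simp del: power_Suc)
        qed (simp add: field_simps)
      qed
      have "((\<lambda>h::real. \<bar>h\<bar> ^ Suc n) \<longlongrightarrow> \<bar>0\<bar> ^ Suc n) (at 0)"
        by (intro tendsto_intros)
      then show "((\<lambda>h::real. \<bar>h\<bar> ^ Suc n) \<longlongrightarrow> 0) (at 0)" by simp
    qed
    then show ?thesis using 3 by (simp add: DERIV_def)
  qed
qed

lemma has_pd_max_power:
  assumes "has_pd i q a x"
  shows "has_pd i (\<lambda>x. (max 0 (q x)) ^ Suc (Suc n)) (real (Suc (Suc n)) * (max 0 (q x)) ^ Suc n * a) x"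
  using DERIV_chain2[OF DERIV_max_power assms[unfolded has_pd_def], of n]
  unfolding has_pd_def by simp

text \<open>Each derivative costs one power, so the exponent \<open>Suc m\<close> allows
  \<open>m\<close> derivatives and still leaves a continuous truncation.\<close>

lemma Ck_max_power:
  assumes "rp q" shows "Ck m (\<lambda>x. (max 0 (q x)) ^ Suc m)"
proof (induction m)
  case 0
  then show ?case using assms by (simp, intro continuous_intros rp_continuous)
next
  case (Suc m)
  show ?case
  proof (rule Ck_SucI[where g="\<lambda>i x. real (Suc (Suc m)) * (max 0 (q x)) ^ Suc m * pd i q x"])
    show "continuous_on UNIV (\<lambda>x. max 0 (q x) ^ Suc (Suc m))"
      using assms by (intro continuous_intros rp_continuous)
    show "has_pd i (\<lambda>x. max 0 (q x) ^ Suc (Suc m)) (real (Suc (Suc m)) * max 0 (q x) ^ Suc m * pd i q x) x" for i x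
      by (rule has_pd_max_power[OF rp_has_pd[OF assms]])
    show "Ck m (\<lambda>x. real (Suc (Suc m)) * max 0 (q x) ^ Suc m * pd i q x)" for i
      by (intro Ck_mult Suc.IH Ck_rp rp_pd assms real_polynomial_function.intros)
  qed
qed

section \<open>Integrals of translates\<close>

lemma has_pd_integral_translate:
  fixes F :: "('n::finite) rfun"
  assumes F: "\<And>x. has_pd i F (G x) x" and cont: "continuous_on UNIV F" "continuous_on UNIV G" "continuous_on UNIV P"
  shows "has_pd i (\<lambda>x. integral (cbox a b) (\<lambda>y. F (x + y) * P y)) (integral (cbox a b) (\<lambda>y. G (x + y) * P y)) x"
proof -
  have d: "((\<lambda>t. F (x + t *\<^sub>R axis i 1 + y) * P y) has_field_derivative G (x + t *\<^sub>R axis i 1 + y) * P y) (at t)" for t y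
  proof -
    have "((\<lambda>s. F ((x + t *\<^sub>R axis i 1 + y) + s *\<^sub>R axis i 1)) has_real_derivative G (x + t *\<^sub>R axis i 1 + y)) (at 0)"
      using F[of "x + t *\<^sub>R axis i 1 + y"] unfolding has_pd_def .
    then have "((\<lambda>s. F (x + (s + t) *\<^sub>R axis i 1 + y)) has_real_derivative G (x + t *\<^sub>R axis i 1 + y)) (at 0)"
      by (simp add: algebra_simps)
    then have "((\<lambda>s. F (x + s *\<^sub>R axis i 1 + y)) has_real_derivative G (x + t *\<^sub>R axis i 1 + y)) (at t)"
      using DERIV_shift[of "\<lambda>s. F (x + s *\<^sub>R axis i 1 + y)" _ 0 t] by simp
    then show ?thesis by (auto intro!: derivative_eq_intros)
  qed
  have "((\<lambda>t. integral (cbox a b) (\<lambda>y. F (x + t *\<^sub>R axis i 1 + y) * P y)) has_field_derivative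
      integral (cbox a b) (\<lambda>y. G (x + 0 *\<^sub>R axis i 1 + y) * P y)) (at 0 within UNIV)"
  proof (rule leibniz_rule_field_derivative)
    show "((\<lambda>t. F (x + t *\<^sub>R axis i 1 + y) * P y) has_field_derivative G (x + t *\<^sub>R axis i 1 + y) * P y)
        (at t within UNIV)" for t y using d by simp
    show "(\<lambda>y. F (x + t *\<^sub>R axis i 1 + y) * P y) integrable_on cbox a b" for t
      by (intro integrable_continuous continuous_intros continuous_on_compose2[OF cont(1)]
          continuous_on_compose2[OF cont(3)]) auto
    show "continuous_on (UNIV \<times> cbox a b) (\<lambda>(t, y). G (x + t *\<^sub>R axis i 1 + y) * P y)"
      unfolding split_beta
      by (intro continuous_intros continuous_on_compose2[OF cont(2)]
          continuous_on_compose2[OF cont(3)]) auto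
  qed auto
  then show ?thesis unfolding has_pd_def by simp
qed

lemma integral_eq_superset:
  fixes f :: "'a::euclidean_space \<Rightarrow> real"
  assumes "\<And>x. x \<notin> S \<Longrightarrow> f x = 0" "S \<subseteq> A" "S \<subseteq> B"
  shows "integral A f = integral B f"
proof -
  have "(\<lambda>x. if x \<in> A then f x else 0) = f" "(\<lambda>x. if x \<in> B then f x else 0) = f"
    by (rule ext, use assms in \<open>auto split: if_splits\<close>)+
  then show ?thesis using integral_restrict_UNIV[of A f] integral_restrict_UNIV[of B f] by simp
qed

definition cube :: "real \<Rightarrow> (real ^ 'n::finite) set" where
  "cube C = cbox (\<chi> i. - C) (\<chi> i. C)"

lemma cball_subset_cube_translate:
  fixes x :: "real ^ 'n::finite"
  assumes "\<rho> + norm x \<le> C"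
  shows "cball 0 \<rho> \<subseteq> cbox ((\<chi> i. - C) + x) ((\<chi> i. C) + x)"
proof
  fix y :: "real ^ 'n" assume "y \<in> cball 0 \<rho>"
  then have "\<bar>y $ i\<bar> \<le> \<rho>" "\<bar>x $ i\<bar> \<le> norm x" for i
    using component_le_norm_cart[of y i] component_le_norm_cart[of x i] by auto
  then have "\<bar>y $ i\<bar> + \<bar>x $ i\<bar> \<le> C" for i using assms by (meson add_mono order_trans)
  then have "- C + x $ i \<le> y $ i \<and> y $ i \<le> C + x $ i" for i
    by (smt (verit))
  then show "y \<in> cbox ((\<chi> i. - C) + x) ((\<chi> i. C) + x)"
    by (simp add: mem_box_cart)
qed

lemma cball_subset_cube: "\<rho> \<le> C \<Longrightarrow> cball (0 :: real ^ 'n::finite) \<rho> \<subseteq> cube C"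
  using cball_subset_cube_translate[of \<rho> "0 :: real ^ 'n" C] by (simp add: cube_def)

text \<open>Substituting z = x + y moves the cube by x. The cube and its translate both contain the
  support once \<open>\<rho> + norm x \<le> C\<close>, so the original cube may be put back.\<close>

lemma integral_translate:
  fixes F :: "('n::finite) rfun"
  assumes F: "continuous_on UNIV F" "\<And>x. norm x > \<rho> \<Longrightarrow> F x = 0"
    and P: "continuous_on UNIV P" and C: "\<rho> + norm x \<le> C"
  shows "integral (cube C) (\<lambda>y. F (x + y) * P y) = integral (cube C) (\<lambda>z. F z * P (z - x))"
proof -
  let ?g = "\<lambda>z. F z * P (z - x)"
  let ?a = "(\<chi> i. - C) + x" and ?b = "(\<chi> i. C) + x"
  have "continuous_on UNIV ?g"
    by (intro continuous_intros F continuous_on_compose2[OF P]) auto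
  then have "?g integrable_on cbox ?a ?b"
    using continuous_on_subset integrable_continuous by blast
  then have "(?g has_integral integral (cbox ?a ?b) ?g) (cbox ?a ?b)"
    by (rule integrable_integral)
  from has_integral_affinity'[OF this, of 1 x]
  have "((\<lambda>y. F (x + y) * P y) has_integral integral (cbox ?a ?b) ?g) (cube C)"
    by (simp add: cube_def add.commute)
  then have "integral (cube C) (\<lambda>y. F (x + y) * P y) = integral (cbox ?a ?b) ?g"
    by (rule integral_unique)
  also have "\<dots> = integral (cube C) ?g"
    by (rule integral_eq_superset[of "cball 0 \<rho>"])
      (use F C cball_subset_cube_translate[OF C] cball_subset_cube[of \<rho> C] norm_ge_zero[of x] in auto)
  finally show ?thesis .
qed

text \<open>The integral of a compactly supported function does not change under small translations,
  and its derivative in the translation parameter is the integral of \<open>G\<close>. This replaces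
  iterated integration in coordinates.\<close>

lemma integral_pd_eq_0:
  fixes F :: "('n::finite) rfun"
  assumes F: "\<And>x. has_pd i F (G x) x" "continuous_on UNIV F" "continuous_on UNIV G"
    and supp: "\<And>x. norm x > \<rho> \<Longrightarrow> F x = 0" and C: "\<rho> + 1 \<le> C"
  shows "integral (cube C) G = 0"
proof -
  have "has_pd i (\<lambda>x. integral (cube C) (\<lambda>y. F (x + y) * 1)) (integral (cube C) (\<lambda>y. G (0 + y) * 1)) 0"
    unfolding cube_def by (rule has_pd_integral_translate) (use F in auto)
  then have "((\<lambda>t. integral (cube C) (\<lambda>y. F (t *\<^sub>R axis i 1 + y))) has_real_derivative integral (cube C) G) (at 0)"
    by (simp add: has_pd_def)
  moreover have "((\<lambda>t. integral (cube C) (\<lambda>y. F (t *\<^sub>R axis i 1 + y))) has_real_derivative 0) (at 0)"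
  proof (rule has_field_derivative_transform_within_open[of "\<lambda>t. integral (cube C) F" 0 0 "ball 0 1"])
    fix t :: real assume "t \<in> ball 0 1"
    then have "\<rho> + norm (t *\<^sub>R axis i 1 :: real ^ 'n) \<le> C" using C by simp
    then show "integral (cube C) F = integral (cube C) (\<lambda>y. F (t *\<^sub>R axis i 1 + y))"
      using integral_translate[of F \<rho> "\<lambda>x. 1" "t *\<^sub>R axis i 1" C] F supp by simp
  qed auto
  ultimately show ?thesis by (rule DERIV_unique)
qed

lemma rp_inner_self: "rp (\<lambda>x :: real ^ 'n::finite. x \<bullet> x)"
  unfolding inner_vec_def inner_real_def
  by (intro real_polynomial_function_sum real_polynomial_function.intros(4) rp_coord) auto

lemma pd_inner_self: "pd i (\<lambda>x :: real ^ 'n::finite. x \<bullet> x) = (\<lambda>x. 2 * x $ i)"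
  unfolding inner_vec_def inner_real_def
  by (subst pd_sum) (auto intro: real_polynomial_function.intros(4) rp_coord
      simp: pd_mult rp_coord pd_coord sum.distrib if_distrib[of "\<lambda>a. a * _"] if_distrib[of "\<lambda>a. _ * a"] cong: if_cong)

text \<open>Testing against the cutoff \<open>w\<^sub>+\<^sup>2 / (w\<^sub>+\<^sup>2 + \<delta>)\<close>, where \<open>w = R\<^sup>2 - |x|\<^sup>2\<close>, replaces the
  surface integral in the divergence theorem: the gradient of the cutoff times \<open>w\<close> is bounded and
  tends to \<open>0\<close> pointwise as \<open>\<delta> \<rightarrow> 0\<close>.\<close>

lemma integral_div_nonpos:
  fixes X :: "'n::finite \<Rightarrow> 'n rfun"
  assumes R: "R > 0" and X: "\<And>i. rp (X i)"
    and C: "C \<ge> 0" "\<And>x. norm x < R \<Longrightarrow> (\<Sum>i\<in>UNIV. x $ i * X i x) \<le> C * (R\<^sup>2 - x \<bullet> x)"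
  shows "integral (ball 0 R) (\<lambda>x. \<Sum>i\<in>UNIV. pd i (X i) x) \<le> 0"
proof -
  define w where "w = (\<lambda>x :: real ^ 'n. R\<^sup>2 - x \<bullet> x)"
  define m where "m = (\<lambda>x. max 0 (w x))"
  define q where "q = (\<lambda>d x. (m x)\<^sup>2 * inverse ((m x)\<^sup>2 + d))"
  \<comment> \<open>\<open>- r d x * x $ i\<close> is the partial derivative of the cutoff
    \<open>q d\<close> in direction \<open>i\<close>, so \<open>G d i\<close> is the partial
    derivative of the cutoff times \<open>X i\<close>.\<close>
  define r where "r = (\<lambda>d x. 4 * (d * m x * (inverse ((m x)\<^sup>2 + d))\<^sup>2))"
  define G where "G = (\<lambda>d i x. q d x * pd i (X i) x - r d x * (x $ i * X i x))"
  have rpw: "rp w" unfolding w_def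
    by (intro real_polynomial_function_diff rp_inner_self real_polynomial_function.intros)
  have pdw: "pd i w x = - 2 * x $ i" for i x
    unfolding w_def by (simp add: pd_diff rp_inner_self real_polynomial_function.intros pd_const pd_inner_self)
  have m0: "m x \<ge> 0" for x by (simp add: m_def)
  have m_out: "m x = 0" if "norm x \<ge> R" for x
  proof -
    have "R\<^sup>2 \<le> x \<bullet> x" using that R by (simp add: power2_norm_eq_inner[symmetric] power_mono)
    then show ?thesis by (simp add: m_def w_def)
  qed
  have m_in: "m x = R\<^sup>2 - x \<bullet> x" "m x > 0" if "norm x < R" for x
  proof -
    have "x \<bullet> x < R\<^sup>2" using that R by (simp add: power2_norm_eq_inner[symmetric] power_strict_mono)
    then show "m x = R\<^sup>2 - x \<bullet> x" "m x > 0" by (simp_all add: m_def w_def)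
  qed
  have contm: "continuous_on S m" for S unfolding m_def by (intro continuous_intros rp_continuous rpw)
  have nz: "(m x)\<^sup>2 + d \<noteq> 0" if "d > 0" for d x using that by (smt (verit) zero_le_power2)
  have contq: "continuous_on S (q d)" "continuous_on S (r d)" if "d > 0" for S d
    unfolding q_def r_def using nz[OF that] by (intro continuous_intros contm; simp)+
  have contG: "continuous_on S (G d i)" if "d > 0" for S d i
    unfolding G_def by (intro continuous_intros contq that rp_continuous rp_pd X rp_coord)
  have contx: "continuous_on S (\<lambda>x. \<Sum>i\<in>UNIV. x $ i * X i x)" for S
    by (intro continuous_intros rp_continuous X rp_coord)
  have hom_poly: "has_pd i (\<lambda>x. q d x * X i x) (G d i x) x" if d: "d > 0" for d i x
  proof -
    have "has_pd i (\<lambda>x. (m x)\<^sup>2) (- 4 * m x * x $ i) x"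
      using has_pd_max_power[OF rp_has_pd[OF rpw, of i x], of 0] by (simp add: pdw m_def power2_eq_square mult.assoc)
    then have a: "has_pd i (\<lambda>x. (m x)\<^sup>2 + d) (- 4 * m x * x $ i + 0) x"
      and b: "has_pd i (\<lambda>x. (m x)\<^sup>2) (- 4 * m x * x $ i) x"
      using has_pd_add has_pd_const by blast+
    have "has_pd i (\<lambda>x. q d x * X i x)
        (((- 4 * m x * x $ i) * inverse ((m x)\<^sup>2 + d) + (m x)\<^sup>2 *
         (- (- 4 * m x * x $ i + 0) * (inverse ((m x)\<^sup>2 + d) * inverse ((m x)\<^sup>2 + d)))) * X i x + q d x * pd i (X i) x) x"
      unfolding q_def
      by (intro has_pd_mult has_pd_inverse a b rp_has_pd X nz d)
    moreover have eq: "((- 4 * m x * x $ i) * inverse ((m x)\<^sup>2 + d) + (m x)\<^sup>2 *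
         (- (- 4 * m x * x $ i + 0) * (inverse ((m x)\<^sup>2 + d) * inverse ((m x)\<^sup>2 + d)))) = - r d x * x $ i"
      unfolding r_def using nz[OF d, of x] by (simp add: divide_simps power2_eq_square) algebra
    ultimately have "has_pd i (\<lambda>x. q d x * X i x) ((- r d x * x $ i) * X i x + q d x * pd i (X i) x) x"
      by (simp only: eq)
    then show ?thesis unfolding G_def by (simp add: algebra_simps)
  qed
  have Gi: "integral (cube (R + 1)) (G d i) = 0" if d: "d > 0" for d i
  proof (rule integral_pd_eq_0[where F="\<lambda>x. q d x * X i x" and \<rho>=R])
    show "continuous_on UNIV (\<lambda>x. q d x * X i x)"
      by (intro continuous_intros contq d rp_continuous X)
    show "q d x * X i x = 0" if "norm x > R" for x
      using m_out[of x] that by (simp add: q_def)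
  qed (use hom_poly[OF d] contG[OF d] in auto)
  have sumG: "integral (ball 0 R) (\<lambda>x. \<Sum>i\<in>UNIV. G d i x) = 0" if d: "d > 0" for d
  proof -
    have "integral (ball 0 R) (\<lambda>x. \<Sum>i\<in>UNIV. G d i x) = integral (cube (R + 1)) (\<lambda>x. \<Sum>i\<in>UNIV. G d i x)"
    proof (rule integral_eq_superset[of "ball 0 R"])
      fix x :: "real ^ 'n" assume "x \<notin> ball 0 R"
      then have "m x = 0" using m_out by simp
      then show "(\<Sum>i\<in>UNIV. G d i x) = 0" by (simp add: G_def q_def r_def)
    next
      show "ball 0 R \<subseteq> (cube (R + 1) :: (real ^ 'n) set)"
        using cball_subset_cube[of R "R + 1"] ball_subset_cball by force
    qed auto
    also have "\<dots> = (\<Sum>i\<in>UNIV. integral (cube (R + 1)) (G d i))"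
      unfolding cube_def by (intro integral_sum integrable_continuous contG d) auto
    finally show ?thesis using Gi d by simp
  qed
  define D where "D = (\<lambda>x. \<Sum>i\<in>UNIV. pd i (X i) x)"
  have contD: "continuous_on S D" for S unfolding D_def by (intro continuous_intros rp_continuous rp_pd X)
  define dn where "dn = (\<lambda>n. 1 / real (Suc n))"
  have dn: "dn n > 0" for n by (simp add: dn_def)
  have dn0: "dn \<longlonglongrightarrow> 0" unfolding dn_def by (rule LIMSEQ_Suc[OF lim_1_over_n])
  define B where "B = (\<lambda>d x. r d x * (C * m x))"
  have contB: "continuous_on S (B d)" if "d > 0" for S d
    unfolding B_def by (intro continuous_intros contq contm that)
  have le: "integral (ball 0 R) (\<lambda>x. q d x * D x) \<le> integral (ball 0 R) (B d)" if d: "d > 0" for d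
  proof -
    have "integral (ball 0 R) (\<lambda>x. \<Sum>i\<in>UNIV. G d i x) =
      integral (ball 0 R) (\<lambda>x. q d x * D x - r d x * (\<Sum>i\<in>UNIV. x $ i * X i x))"
      by (simp add: G_def D_def sum_subtractf sum_distrib_left)
    also have "\<dots> = integral (ball 0 R) (\<lambda>x. q d x * D x) - integral (ball 0 R) (\<lambda>x. r d x * (\<Sum>i\<in>UNIV. x $ i * X i x))"
      by (intro integral_diff integrable_on_ball continuous_on_mult contq contD d contx)
    finally have "integral (ball 0 R) (\<lambda>x. q d x * D x) = integral (ball 0 R) (\<lambda>x. r d x * (\<Sum>i\<in>UNIV. x $ i * X i x))"
      using sumG[OF d] by simp
    also have "\<dots> \<le> integral (ball 0 R) (B d)"
    proof (intro integral_le integrable_on_ball contB d continuous_on_mult contq contx)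
      fix x :: "real ^ 'n" assume "x \<in> ball 0 R"
      then have x: "norm x < R" by simp
      have "r d x \<ge> 0" unfolding r_def using d m0[of x] by simp
      then show "r d x * (\<Sum>i\<in>UNIV. x $ i * X i x) \<le> B d x"
        unfolding B_def using C(2)[OF x] m_in(1)[OF x] by (intro mult_left_mono) auto
    qed
    finally show ?thesis .
  qed
  have lim1: "(\<lambda>n. integral (ball 0 R) (\<lambda>x. q (dn n) x * D x)) \<longlonglongrightarrow> integral (ball 0 R) D"
  proof (rule dominated_convergence(2)[where h="\<lambda>x. \<bar>D x\<bar>"])
    fix n x
    show "(\<lambda>x. q (dn n) x * D x) integrable_on ball 0 R"
      by (intro integrable_on_ball continuous_intros contq contD dn)
    have "\<bar>q (dn n) x\<bar> \<le> 1" unfolding q_def using dn[of n] by (simp add: divide_simps add_nonneg_pos)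
    then show "norm (q (dn n) x * D x) \<le> \<bar>D x\<bar>" by (simp add: abs_mult mult_left_le_one_le)
  next
    show "(\<lambda>x. \<bar>D x\<bar>) integrable_on ball 0 R" by (intro integrable_on_ball continuous_intros contD)
    show "(\<lambda>n. q (dn n) x * D x) \<longlonglongrightarrow> D x" if "x \<in> ball 0 R" for x
    proof -
      have "(\<lambda>n. (m x)\<^sup>2 * inverse ((m x)\<^sup>2 + dn n) * D x) \<longlonglongrightarrow> (m x)\<^sup>2 * inverse ((m x)\<^sup>2 + 0) * D x"
        using m_in(2)[of x] that by (intro tendsto_intros dn0) auto
      then show ?thesis using m_in(2)[of x] that by (simp add: q_def)
    qed
  qed
  \<comment> \<open>\<open>B d x\<close> is \<open>4 * C\<close> times d m^2 / (m^2 + d)^2. That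
    quotient lies between 0 and 1 and tends to 0 with d wherever m > 0, so the constant
    \<open>4 * C\<close> dominates.\<close>
  have lim2: "(\<lambda>n. integral (ball 0 R) (B (dn n))) \<longlonglongrightarrow> integral (ball 0 R) (\<lambda>x :: real ^ 'n. 0)"
  proof (rule dominated_convergence(2)[where h="\<lambda>x. 4 * C"])
    fix n and x :: "real ^ 'n"
    show "(B (dn n)) integrable_on ball 0 R" by (intro integrable_on_ball contB dn)
    let ?d = "dn n"
    have "0 \<le> ?d * ?d + (?d * (m x)\<^sup>2 + ((m x)\<^sup>2)\<^sup>2)" using dn[of n] by simp
    then have "?d * (m x)\<^sup>2 \<le> ((m x)\<^sup>2 + ?d)\<^sup>2" by (simp add: power2_eq_square algebra_simps)
    then have "?d * (m x)\<^sup>2 * (inverse ((m x)\<^sup>2 + ?d))\<^sup>2 \<le> ((m x)\<^sup>2 + ?d)\<^sup>2 * (inverse ((m x)\<^sup>2 + ?d))\<^sup>2"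
      by (intro mult_right_mono) auto
    then have "?d * (m x)\<^sup>2 * (inverse ((m x)\<^sup>2 + ?d))\<^sup>2 \<le> 1"
      using nz[OF dn[of n], of x] by (simp flip: power_mult_distrib)
    moreover have "?d * (m x)\<^sup>2 * (inverse ((m x)\<^sup>2 + ?d))\<^sup>2 \<ge> 0" using dn[of n] by simp
    moreover have "B ?d x = 4 * C * (?d * (m x)\<^sup>2 * (inverse ((m x)\<^sup>2 + ?d))\<^sup>2)"
      by (simp add: B_def r_def power2_eq_square)
    ultimately show "norm (B ?d x) \<le> 4 * C" using C(1) by (simp add: abs_mult mult_left_le)
  next
    show "(\<lambda>x. 4 * C) integrable_on (ball 0 R :: (real ^ 'n) set)" by (intro integrable_on_ball continuous_intros)
    show "(\<lambda>n. B (dn n) x) \<longlonglongrightarrow> 0" if "x \<in> ball 0 R" for x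
    proof -
      have "(\<lambda>n. 4 * (dn n * m x * (inverse ((m x)\<^sup>2 + dn n))\<^sup>2) * (C * m x)) \<longlonglongrightarrow>
          4 * (0 * m x * (inverse ((m x)\<^sup>2 + 0))\<^sup>2) * (C * m x)"
        using m_in(2)[of x] that by (intro tendsto_intros dn0) auto
      then show ?thesis by (simp add: B_def r_def)
    qed
  qed
  have "integral (ball 0 R) D \<le> integral (ball 0 R) (\<lambda>x :: real ^ 'n. 0)"
    using le dn by (intro LIMSEQ_le[OF lim1 lim2]) auto
  then show ?thesis by (simp add: D_def)
qed

section \<open>The energy estimate\<close>

definition L1 :: "real \<Rightarrow> ('n::finite) rfun \<Rightarrow> 'n rfun \<Rightarrow> 'n rfun" where
  "L1 s f g = (\<lambda>x. - s * f x - (\<Sum>i\<in>UNIV. x $ i * pd i f x) + g x)"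

definition L2 :: "real \<Rightarrow> ('n::finite) rfun \<Rightarrow> 'n rfun \<Rightarrow> 'n rfun" where
  "L2 s f g = (\<lambda>x. (\<Sum>i\<in>UNIV. pd i (pd i f) x) - (s + 1) * g x - (\<Sum>i\<in>UNIV. x $ i * pd i g x))"

lemma rp_radial: "rp f \<Longrightarrow> rp (\<lambda>x. \<Sum>i\<in>UNIV. x $ i * pd i f x)"
  by (intro real_polynomial_function_sum real_polynomial_function.intros(4) rp_coord rp_pd) auto

lemma rp_Laplace: "rp f \<Longrightarrow> rp (\<lambda>x. \<Sum>i\<in>UNIV. pd i (pd i f) x)"
  by (intro real_polynomial_function_sum rp_pd) auto

lemma rp_L1: "rp f \<Longrightarrow> rp g \<Longrightarrow> rp (L1 s f g)"
  unfolding L1_def by (intro rp_intros rp_radial)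

lemma rp_L2: "rp f \<Longrightarrow> rp g \<Longrightarrow> rp (L2 s f g)"
  unfolding L2_def by (intro rp_intros(1-4) rp_radial rp_Laplace)

text \<open>The commutator of \<open>pd i\<close> with the radial derivative is \<open>pd i\<close>
  itself. This is what raises the parameter \<open>s\<close> by one with every derivative.\<close>

lemma pd_radial:
  assumes "rp f"
  shows "pd i (\<lambda>x. \<Sum>j\<in>UNIV. x $ j * pd j f x) = (\<lambda>x. pd i f x + (\<Sum>j\<in>UNIV. x $ j * pd j (pd i f) x))"
proof -
  have "pd i (\<lambda>x. \<Sum>j\<in>UNIV. x $ j * pd j f x) = (\<lambda>x. \<Sum>j\<in>UNIV. pd i (\<lambda>x. x $ j * pd j f x) x)"
    using assms by (intro pd_sum real_polynomial_function.intros(4) rp_coord rp_pd) auto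
  also have "\<dots> = (\<lambda>x. \<Sum>j\<in>UNIV. (if i = j then pd j f x else 0) + x $ j * pd j (pd i f) x)"
    using assms pd_comm[OF assms, of i] by (simp add: pd_mult rp_coord rp_pd pd_coord if_distrib[of "\<lambda>a. a * _"] cong: if_cong)
  finally show ?thesis by (simp add: sum.distrib)
qed

lemma pd_L1: assumes "rp f" "rp g" shows "pd i (L1 s f g) = L1 (s + 1) (pd i f) (pd i g)"
proof -
  have "pd i (L1 s f g) = (\<lambda>x. - s * pd i f x - (pd i f x + (\<Sum>j\<in>UNIV. x $ j * pd j (pd i f) x)) + pd i g x)"
    unfolding L1_def
    by (simp only: pd_add pd_diff pd_cmult pd_radial assms rp_radial rp_intros(1-4))
  then show ?thesis by (simp add: L1_def algebra_simps)
qed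

lemma pd_L2: assumes "rp f" "rp g" shows "pd i (L2 s f g) = L2 (s + 1) (pd i f) (pd i g)"
proof -
  have lap: "pd i (\<lambda>x. \<Sum>j\<in>UNIV. pd j (pd j f) x) = (\<lambda>x. \<Sum>j\<in>UNIV. pd j (pd j (pd i f)) x)"
    using assms by (subst pd_sum) (auto simp: rp_pd pd_comm[of _ i])
  have "pd i (L2 s f g) = (\<lambda>x. (\<Sum>j\<in>UNIV. pd j (pd j (pd i f)) x) - (s + 1) * pd i g x -
      (pd i g x + (\<Sum>j\<in>UNIV. x $ j * pd j (pd i g) x)))"
    unfolding L2_def
    by (simp only: pd_diff pd_cmult pd_radial lap assms rp_radial rp_Laplace rp_intros(1-4))
  then show ?thesis by (simp add: L2_def algebra_simps)
qed

definition wave_sol :: "real \<Rightarrow> (real \<Rightarrow> ('n::finite) rfun) \<Rightarrow> (real \<Rightarrow> 'n rfun) \<Rightarrow> bool" where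
  "wave_sol s v1 v2 \<longleftrightarrow> poly_curve v1 (\<lambda>t. L1 s (v1 t) (v2 t)) \<and> poly_curve v2 (\<lambda>t. L2 s (v1 t) (v2 t))"

lemma wave_sol_rp: "wave_sol s v1 v2 \<Longrightarrow> rp (v1 t)" "wave_sol s v1 v2 \<Longrightarrow> rp (v2 t)"
  unfolding wave_sol_def by (auto intro: poly_curve_rp)

lemma wave_sol_pd:
  assumes "wave_sol s v1 v2" shows "wave_sol (s + 1) (\<lambda>t. pd i (v1 t)) (\<lambda>t. pd i (v2 t))"
  using assms wave_sol_rp[OF assms]
    poly_curve_pd[of v1 "\<lambda>t. L1 s (v1 t) (v2 t)" i] poly_curve_pd[of v2 "\<lambda>t. L2 s (v1 t) (v2 t)" i]
  unfolding wave_sol_def by (simp add: pd_L1 pd_L2)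

lemma wave_sol_dpart: "wave_sol s v1 v2 \<Longrightarrow> wave_sol (s + length al) (\<lambda>t. dpart al (v1 t)) (\<lambda>t. dpart al (v2 t))"
proof (induction al)
  case (Cons i al)
  have "s + real (length (i # al)) = s + real (length al) + 1" by simp
  with wave_sol_pd[OF Cons.IH[OF Cons.prems], of i] show ?case by (simp only: dpart.simps)
qed simp

definition energy_density :: "('n::finite) rfun \<Rightarrow> 'n rfun \<Rightarrow> 'n rfun" where
  "energy_density f g = (\<lambda>x. (\<Sum>i\<in>UNIV. (pd i f x)\<^sup>2) + (g x)\<^sup>2)"

lemma rp_energy_density: "rp f \<Longrightarrow> rp g \<Longrightarrow> rp (energy_density f g)"
  unfolding energy_density_def
  by (intro real_polynomial_function_sum real_polynomial_function_power real_polynomial_function.intros(3) rp_pd) auto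

text \<open>The integrand is a multiple of the energy density plus twice a divergence. In the rate,
  the dimension comes from the divergence of the field x when the transport term is integrated by
  parts, and -2 (s + 1) from the terms of order zero acting on the gradient of \<open>f\<close> and
  on \<open>g\<close>. What remains is the sign of the flux through the boundary.\<close>

lemma energy_rate:
  fixes f g :: "('n::finite) rfun"
  assumes R: "R \<ge> 1" and f: "rp f" and g: "rp g"
  shows "integral (ball 0 R) (\<lambda>x. (\<Sum>i\<in>UNIV. 2 * pd i f x * pd i (L1 s f g) x) + 2 * g x * L2 s f g x)
    \<le> (real CARD('n) - 2 - 2 * s) * integral (ball 0 R) (energy_density f g)"
proof -
  define e where "e = energy_density f g"
  \<comment> \<open>The flux field: the first summand belongs to the radial transport, the second to
    the wave equation.\<close>
  define X where "X = (\<lambda>i x. - (1/2) * (x $ i * e x) + g x * pd i f x)"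
  have rpe: "rp e" unfolding e_def by (rule rp_energy_density[OF f g])
  have rpX: "rp (X i)" for i
    unfolding X_def by (intro real_polynomial_function.intros rp_coord rpe g rp_pd f)
  have e_eq: "e x = (\<Sum>i\<in>UNIV. (pd i f x)\<^sup>2) + (g x)\<^sup>2" for x by (simp add: e_def energy_density_def)
  have e0: "e x \<ge> 0" for x unfolding e_eq by (intro add_nonneg_nonneg sum_nonneg) auto
  have pde: "pd i e x = (\<Sum>j\<in>UNIV. 2 * pd j f x * pd i (pd j f) x) + 2 * g x * pd i g x" for i x
  proof -
    have "e = (\<lambda>x. (\<Sum>j\<in>UNIV. pd j f x * pd j f x) + g x * g x)"
      by (simp add: e_def energy_density_def power2_eq_square)
    then show ?thesis
      by (simp add: pd_add pd_mult pd_sum real_polynomial_function_sum real_polynomial_function.intros rp_pd f g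
          algebra_simps sum.distrib)
  qed
  have pdX: "pd i (X i) x = - (1/2) * e x - (1/2) * (x $ i * pd i e x) + pd i g x * pd i f x + g x * pd i (pd i f) x" for i x
    unfolding X_def
    by (subst pd_add pd_cmult pd_mult;
      (intro real_polynomial_function.intros rp_coord rpe g rp_pd f)?)+ (simp add: pd_coord algebra_simps)
  have rad: "(\<Sum>i\<in>UNIV. x $ i * pd i e x) =
     (\<Sum>j\<in>UNIV. 2 * pd j f x * (\<Sum>i\<in>UNIV. x $ i * pd i (pd j f) x)) + 2 * g x * (\<Sum>i\<in>UNIV. x $ i * pd i g x)" for x
    unfolding pde distrib_left sum.distrib sum_distrib_left
    by (subst sum.swap) (simp add: mult_ac)
  have ident: "(\<Sum>i\<in>UNIV. 2 * pd i f x * pd i (L1 s f g) x) + 2 * g x * L2 s f g x =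
      (real CARD('n) - 2 - 2 * s) * e x + 2 * (\<Sum>i\<in>UNIV. pd i (X i) x)" for x
  proof -
    have "(\<Sum>i\<in>UNIV. pd i (X i) x) = - (real CARD('n) / 2) * e x - (1/2) * (\<Sum>i\<in>UNIV. x $ i * pd i e x)
        + (\<Sum>i\<in>UNIV. pd i g x * pd i f x) + g x * (\<Sum>i\<in>UNIV. pd i (pd i f) x)"
      unfolding pdX by (simp add: sum.distrib sum_subtractf sum_distrib_left sum_negf)
    moreover have "(\<Sum>i\<in>UNIV. 2 * pd i f x * pd i (L1 s f g) x) =
       - 2 * (s + 1) * (\<Sum>i\<in>UNIV. (pd i f x)\<^sup>2) - (\<Sum>j\<in>UNIV. 2 * pd j f x * (\<Sum>i\<in>UNIV. x $ i * pd i (pd j f) x))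
       + 2 * (\<Sum>i\<in>UNIV. pd i g x * pd i f x)"
      unfolding pd_L1[OF f g] unfolding L1_def
      by (simp add: algebra_simps power2_eq_square sum.distrib sum_subtractf sum_distrib_left sum_negf)
    ultimately show ?thesis
      unfolding rad L2_def e_eq by (simp add: algebra_simps power2_eq_square)
  qed
  \<comment> \<open>A bound for the density on the closed ball turns the pointwise flux estimate
    into one with a constant factor, as the divergence inequality requires.\<close>
  obtain K where K: "\<And>x. x \<in> cball 0 R \<Longrightarrow> \<bar>e x\<bar> \<le> K"
  proof -
    have "compact (e ` cball 0 R)" by (intro compact_continuous_image rp_continuous rpe) auto
    then have "bounded (e ` cball 0 R)" by (rule compact_imp_bounded)
    then obtain a where "\<forall>y\<in>e ` cball 0 R. norm y \<le> a" unfolding bounded_iff by blast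
    then show ?thesis using that[of a] by auto
  qed
  have K0: "K \<ge> 0" using K[of 0] R by auto
  have le: "(\<Sum>i\<in>UNIV. x $ i * X i x) \<le> K / 2 * (R\<^sup>2 - x \<bullet> x)" if x: "norm x < R" for x
  proof -
    define v where "v = (\<chi> i. pd i f x)"
    define n where "n = norm x"
    have n: "0 \<le> n" "n < R" using x by (auto simp: n_def)
    have nv: "(norm v)\<^sup>2 = (\<Sum>i\<in>UNIV. (pd i f x)\<^sup>2)"
      unfolding power2_norm_eq_inner inner_vec_def v_def by (simp add: power2_eq_square)
    have xv: "x \<bullet> v = (\<Sum>i\<in>UNIV. x $ i * pd i f x)" by (simp add: inner_vec_def v_def)
    have nn: "x \<bullet> x = (\<Sum>i\<in>UNIV. x $ i * x $ i)" by (simp add: inner_vec_def)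
    have "(\<Sum>i\<in>UNIV. x $ i * X i x) = - (1/2) * n\<^sup>2 * e x + g x * (x \<bullet> v)"
      unfolding X_def n_def power2_norm_eq_inner nn xv
      by (simp add: distrib_left sum.distrib sum_distrib_left sum_distrib_right mult_ac sum_subtractf sum_negf algebra_simps)
    also have "g x * (x \<bullet> v) \<le> \<bar>g x\<bar> * (n * norm v)"
    proof -
      have "g x * (x \<bullet> v) \<le> \<bar>g x\<bar> * \<bar>x \<bullet> v\<bar>" by (metis abs_ge_self abs_mult)
      also have "\<dots> \<le> \<bar>g x\<bar> * (n * norm v)"
        unfolding n_def by (intro mult_left_mono Cauchy_Schwarz_ineq2) auto
      finally show ?thesis .
    qed
    also have "\<bar>g x\<bar> * (n * norm v) \<le> n * (e x / 2)"
    proof -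
      have "\<bar>g x\<bar> * norm v \<le> e x / 2"
        using sum_squares_bound[of "\<bar>g x\<bar>" "norm v"] unfolding e_eq nv[symmetric] by simp
      then have "n * (\<bar>g x\<bar> * norm v) \<le> n * (e x / 2)" using n by (intro mult_left_mono)
      then show ?thesis by (simp add: mult_ac)
    qed
    also have "- (1/2) * n\<^sup>2 * e x + n * (e x / 2) = e x / 2 * (n * (1 - n))"
      by (simp add: algebra_simps power2_eq_square)
    \<comment> \<open>Since \<open>R \<ge> 1\<close>, the factor 1 - n is at most R - n, which
      vanishes at the boundary.\<close>
    also have "\<dots> \<le> e x / 2 * (R\<^sup>2 - n\<^sup>2)"
    proof -
      have "n * (1 - n) \<le> n * (R - n)" using n R by (intro mult_left_mono) auto
      also have "\<dots> \<le> (R + n) * (R - n)" using n R by (intro mult_right_mono) auto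
      finally show ?thesis using e0[of x]
        by (intro mult_left_mono) (auto simp: algebra_simps power2_eq_square)
    qed
    also have "\<dots> \<le> K / 2 * (R\<^sup>2 - n\<^sup>2)"
      using K[of x] x n by (intro mult_right_mono) (auto intro: power_mono)
    finally show ?thesis by (simp add: n_def power2_norm_eq_inner)
  qed
  have "integral (ball 0 R) (\<lambda>x. \<Sum>i\<in>UNIV. pd i (X i) x) \<le> 0"
    using R K0 le by (intro integral_div_nonpos[where C="K / 2"] rpX) auto
  moreover have "integral (ball 0 R) (\<lambda>x. (real CARD('n) - 2 - 2 * s) * e x + 2 * (\<Sum>i\<in>UNIV. pd i (X i) x)) =
     (real CARD('n) - 2 - 2 * s) * integral (ball 0 R) e + 2 * integral (ball 0 R) (\<lambda>x. \<Sum>i\<in>UNIV. pd i (X i) x)"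
    by (subst integral_add) (auto intro!: rp_integrable rp_intros rpe rp_pd rpX)
  ultimately show ?thesis unfolding ident by (simp add: e_def)
qed

lemma gronwall_exp:
  fixes E :: "real \<Rightarrow> real"
  assumes E: "\<And>t. (E has_real_derivative E' t) (at t)" and le: "\<And>t. E' t \<le> a * E t" and "t \<ge> 0"
  shows "E t \<le> exp (a * t) * E 0"
proof -
  have "exp (- a * t) * E t \<le> exp (- a * 0) * E 0"
  proof (rule DERIV_nonpos_imp_nonincreasing[OF \<open>t \<ge> 0\<close>], intro exI conjI)
    fix x
    show "((\<lambda>t. exp (- a * t) * E t) has_real_derivative exp (- a * x) * (E' x - a * E x)) (at x)"
      using E by (auto intro!: derivative_eq_intros simp: algebra_simps)
    show "exp (- a * x) * (E' x - a * E x) \<le> 0"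
      using le[of x] by (simp add: mult_nonneg_nonpos)
  qed
  then have "exp (a * t) * (exp (- a * t) * E t) \<le> exp (a * t) * E 0"
    by (intro mult_left_mono) auto
  then show ?thesis by (simp add: mult.assoc[symmetric] exp_add[symmetric])
qed

lemma energy_decay:
  fixes v1 v2 :: "real \<Rightarrow> ('n::finite) rfun"
  assumes R: "R \<ge> 1" and sol: "wave_sol s v1 v2" and t: "t \<ge> 0"
  shows "integral (ball 0 R) (energy_density (v1 t) (v2 t)) \<le>
    exp ((real CARD('n) - 2 - 2 * s) * t) * integral (ball 0 R) (energy_density (v1 0) (v2 0))"
proof (rule gronwall_exp[where E="\<lambda>t. integral (ball 0 R) (energy_density (v1 t) (v2 t))", OF _ _ t])
  fix t
  let ?e' = "\<lambda>t x. (\<Sum>i\<in>UNIV. 2 * pd i (v1 t) x * pd i (L1 s (v1 t) (v2 t)) x) + 2 * v2 t x * L2 s (v1 t) (v2 t) x"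
  have p: "poly_curve v1 (\<lambda>t. L1 s (v1 t) (v2 t))" "poly_curve v2 (\<lambda>t. L2 s (v1 t) (v2 t))"
    using sol by (auto simp: wave_sol_def)
  have "poly_curve (\<lambda>t. energy_density (v1 t) (v2 t)) ?e'"
    by (rule poly_curve_cong[OF poly_curve_add[OF poly_curve_sum[OF _ poly_curve_mult[OF poly_curve_pd[OF p(1)] poly_curve_pd[OF p(1)]]] poly_curve_mult[OF p(2) p(2)]]])
      (auto simp: energy_density_def power2_eq_square algebra_simps sum.distrib sum_distrib_left)
  then show "((\<lambda>t. integral (ball 0 R) (energy_density (v1 t) (v2 t))) has_real_derivative integral (ball 0 R) (?e' t)) (at t)"
    by (rule poly_curve_integral)
  show "integral (ball 0 R) (?e' t) \<le> (real CARD('n) - 2 - 2 * s) * integral (ball 0 R) (energy_density (v1 t) (v2 t))"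
    by (intro energy_rate R wave_sol_rp[OF sol])
qed

section \<open>Square integrable functions on the ball\<close>

text \<open>Functions are total but matter only on the open ball. Continuity up to the boundary
  therefore means that some continuous function on the closed ball agrees with \<open>f\<close>
  inside.\<close>

definition cont_ext :: "real \<Rightarrow> ('n::finite) rfun \<Rightarrow> bool" where
  "cont_ext R f \<longleftrightarrow> (\<exists>g. continuous_on (cball 0 R) g \<and> (\<forall>x\<in>ball 0 R. g x = f x))"

lemma cont_ext_integrable: assumes "cont_ext R f" shows "f integrable_on ball 0 R"
proof -
  obtain g where "continuous_on (cball 0 R) g" "\<And>x. x \<in> ball 0 R \<Longrightarrow> g x = f x"
    using assms unfolding cont_ext_def by blast
  then show ?thesis using integrable_on_ball integrable_eq by blast
qed

lemma cont_ext_mult: assumes "cont_ext R f" "cont_ext R g" shows "cont_ext R (\<lambda>x. f x * g x)"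
proof -
  obtain a b where "continuous_on (cball 0 R) a" "\<forall>x\<in>ball 0 R. a x = f x"
    "continuous_on (cball 0 R) b" "\<forall>x\<in>ball 0 R. b x = g x"
    using assms unfolding cont_ext_def by blast
  then show ?thesis unfolding cont_ext_def by (intro exI[of _ "\<lambda>x. a x * b x"]) (auto intro: continuous_on_mult)
qed

lemma cont_ext_add: assumes "cont_ext R f" "cont_ext R g" shows "cont_ext R (\<lambda>x. f x + g x)"
proof -
  obtain a b where "continuous_on (cball 0 R) a" "\<forall>x\<in>ball 0 R. a x = f x"
    "continuous_on (cball 0 R) b" "\<forall>x\<in>ball 0 R. b x = g x"
    using assms unfolding cont_ext_def by blast
  then show ?thesis unfolding cont_ext_def by (intro exI[of _ "\<lambda>x. a x + b x"]) (auto intro: continuous_on_add)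
qed

lemma cont_ext_rp: "rp f \<Longrightarrow> cont_ext R f"
  unfolding cont_ext_def using rp_continuous by blast

lemma cont_ext_cmult: "cont_ext R f \<Longrightarrow> cont_ext R (\<lambda>x. c * f x)"
  by (rule cont_ext_mult[OF cont_ext_rp]) (auto intro: rp_intros)

definition ball_inner :: "real \<Rightarrow> ('n::finite) rfun \<Rightarrow> 'n rfun \<Rightarrow> real" where
  "ball_inner R f g = integral (ball 0 R) (\<lambda>x. f x * g x)"

definition ball_norm :: "real \<Rightarrow> ('n::finite) rfun \<Rightarrow> real" where
  "ball_norm R f = sqrt (integral (ball 0 R) (\<lambda>x. (f x)\<^sup>2))"

lemma ball_norm_cong: "(\<And>x. x \<in> ball 0 R \<Longrightarrow> f x = g x) \<Longrightarrow> ball_norm R f = ball_norm R g"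
  unfolding ball_norm_def by (auto intro!: arg_cong[of _ _ sqrt] integral_cong)

lemma cont_ext_power2: "cont_ext R f \<Longrightarrow> cont_ext R (\<lambda>x. (f x)\<^sup>2)"
  using cont_ext_mult[of R f f] by (simp add: power2_eq_square)

lemma integral_square_nonneg: "cont_ext R f \<Longrightarrow> integral (ball 0 R) (\<lambda>x. (f x)\<^sup>2) \<ge> 0"
  by (intro integral_nonneg cont_ext_integrable cont_ext_power2) auto

lemma ball_norm_nonneg: "cont_ext R f \<Longrightarrow> ball_norm R f \<ge> 0"
  unfolding ball_norm_def by (simp add: integral_square_nonneg)

lemma ball_norm_power2: "cont_ext R f \<Longrightarrow> (ball_norm R f)\<^sup>2 = integral (ball 0 R) (\<lambda>x. (f x)\<^sup>2)"
  unfolding ball_norm_def by (simp add: integral_square_nonneg)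

lemma ball_inner_self: "cont_ext R f \<Longrightarrow> ball_inner R f f = (ball_norm R f)\<^sup>2"
  unfolding ball_inner_def by (simp add: ball_norm_power2 flip: power2_eq_square)

lemma ball_inner_le_ball_norm:
  assumes "cont_ext R f" "cont_ext R g" shows "\<bar>ball_inner R f g\<bar> \<le> ball_norm R f * ball_norm R g"
proof -
  let ?F = "integral (ball 0 R) (\<lambda>x. (f x)\<^sup>2)" and ?G = "integral (ball 0 R) (\<lambda>x. (g x)\<^sup>2)"
  have nonneg: "0 \<le> a\<^sup>2 * ?F + 2 * a * b * ball_inner R f g + b\<^sup>2 * ?G" for a b
  proof -
    have "0 \<le> integral (ball 0 R) (\<lambda>x. (a * f x + b * g x)\<^sup>2)"
      by (intro integral_square_nonneg cont_ext_add cont_ext_cmult assms)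
    also have "\<dots> = integral (ball 0 R) (\<lambda>x. a\<^sup>2 * (f x)\<^sup>2 + 2 * a * b * (f x * g x) + b\<^sup>2 * (g x)\<^sup>2)"
      by (simp add: power2_eq_square algebra_simps)
    also have "\<dots> = a\<^sup>2 * ?F + 2 * a * b * ball_inner R f g + b\<^sup>2 * ?G"
      by (simp add: integral_add cont_ext_integrable cont_ext_add cont_ext_cmult cont_ext_mult cont_ext_power2 assms ball_inner_def del: power2_eq_square)
    finally show ?thesis .
  qed
  have "(ball_inner R f g)\<^sup>2 \<le> ?F * ?G"
  proof (cases "?G = 0")
    case True
    show ?thesis
    proof (rule ccontr)
      assume "\<not> ?thesis"
      then have nz: "ball_inner R f g \<noteq> 0" using True by auto
      \<comment> \<open>With a = 1 this b brings the quadratic form down to -1.\<close>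
      have "0 \<le> 1\<^sup>2 * ?F + 2 * 1 * (- (?F + 1) / (2 * ball_inner R f g)) * ball_inner R f g + (- (?F + 1) / (2 * ball_inner R f g))\<^sup>2 * ?G"
        by (rule nonneg)
      moreover have "2 * 1 * (- (?F + 1) / (2 * ball_inner R f g)) * ball_inner R f g = - (?F + 1)"
        using nz by simp
      ultimately show False using True by simp
    qed
  next
    case False
    then have G: "?G > 0" using integral_square_nonneg[OF assms(2)] by simp
    \<comment> \<open>The ratio b / a that minimises the quadratic form, scaled by \<open>?G\<close>
      to avoid a division.\<close>
    have "0 \<le> ?G\<^sup>2 * ?F + 2 * ?G * (- ball_inner R f g) * ball_inner R f g + (- ball_inner R f g)\<^sup>2 * ?G"
      by (rule nonneg)
    then have "0 \<le> ?G * (?F * ?G - (ball_inner R f g)\<^sup>2)" by (simp add: power2_eq_square algebra_simps)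
    then show ?thesis using G by (simp add: zero_le_mult_iff)
  qed
  then have "sqrt ((ball_inner R f g)\<^sup>2) \<le> sqrt (?F * ?G)" by (rule real_sqrt_le_mono)
  then show ?thesis by (simp add: ball_norm_def real_sqrt_mult)
qed

lemma ball_norm_triangle:
  assumes "cont_ext R f" "cont_ext R g" shows "ball_norm R (\<lambda>x. f x + g x) \<le> ball_norm R f + ball_norm R g"
proof (rule power2_le_imp_le)
  have "(ball_norm R (\<lambda>x. f x + g x))\<^sup>2 = integral (ball 0 R) (\<lambda>x. (f x)\<^sup>2 + 2 * (f x * g x) + (g x)\<^sup>2)"
    by (subst ball_norm_power2[OF cont_ext_add[OF assms]]) (simp add: power2_eq_square algebra_simps)
  also have "\<dots> = (ball_norm R f)\<^sup>2 + 2 * ball_inner R f g + (ball_norm R g)\<^sup>2"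
    by (simp add: integral_add cont_ext_integrable cont_ext_add cont_ext_cmult cont_ext_mult cont_ext_power2 assms ball_inner_def ball_norm_power2)
  also have "\<dots> \<le> (ball_norm R f + ball_norm R g)\<^sup>2"
    using ball_inner_le_ball_norm[OF assms] by (simp add: power2_sum)
  finally show "(ball_norm R (\<lambda>x. f x + g x))\<^sup>2 \<le> (ball_norm R f + ball_norm R g)\<^sup>2" .
qed (intro add_nonneg_nonneg ball_norm_nonneg assms)

lemma ball_norm_cmult: "ball_norm R (\<lambda>x. c * f x) = \<bar>c\<bar> * ball_norm R f"
  by (simp add: ball_norm_def power_mult_distrib real_sqrt_mult)

lemma ball_norm_sum:
  assumes "finite A" "\<And>a. a \<in> A \<Longrightarrow> cont_ext R (f a)"
  shows "ball_norm R (\<lambda>x. \<Sum>a\<in>A. f a x) \<le> (\<Sum>a\<in>A. ball_norm R (f a)) \<and> cont_ext R (\<lambda>x. \<Sum>a\<in>A. f a x)"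
  using assms
proof (induction A)
  case empty
  then show ?case by (simp add: ball_norm_def cont_ext_rp real_polynomial_function.intros(2))
next
  case (insert a A)
  then have "ball_norm R (\<lambda>x. f a x + (\<Sum>a\<in>A. f a x)) \<le> ball_norm R (f a) + ball_norm R (\<lambda>x. \<Sum>a\<in>A. f a x)"
    by (intro ball_norm_triangle) auto
  then show ?case using insert by (auto intro: cont_ext_add)
qed

text \<open>Used with \<open>b r = B(\<phi> r, \<phi> h)\<close> for a bilinear form \<open>B\<close> with \<open>n\<^sup>2 = B(\<phi> h, \<phi> h)\<close>.\<close>

lemma norm_mean_value:
  fixes b :: "real \<Rightarrow> real"
  assumes b: "\<And>r. (b has_real_derivative b' r) (at r)" and "b 0 = 0" "b h = n\<^sup>2"
    and le: "\<And>r. 0 \<le> r \<Longrightarrow> r \<le> h \<Longrightarrow> b' r \<le> c * n" and "0 \<le> h" "0 \<le> n" "0 \<le> c"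
  shows "n \<le> h * c"
proof -
  have "b h - c * n * h \<le> b 0 - c * n * 0"
    by (rule DERIV_nonpos_imp_nonincreasing[OF \<open>0 \<le> h\<close>, of "\<lambda>r. b r - c * n * r"])
      (use le in \<open>auto intro!: exI derivative_eq_intros b\<close>)
  then have "n * n \<le> n * (h * c)" using assms by (simp add: power2_eq_square algebra_simps)
  then show ?thesis using assms by (cases "n = 0") auto
qed

text \<open>This stands in for the bound of an L2-valued integral by the integral of the norms: the
  curve is tested against its own endpoint, so only a scalar function is differentiated.\<close>

lemma ball_norm_mean_value:
  assumes v: "poly_curve v v'" "\<And>x. v 0 x = 0" and c: "\<And>r. 0 \<le> r \<Longrightarrow> r \<le> h \<Longrightarrow> ball_norm R (v' r) \<le> c"
    and h: "0 \<le> h"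
  shows "ball_norm R (v h) \<le> h * c"
proof (rule norm_mean_value[of "\<lambda>r. ball_inner R (v r) (v h)" "\<lambda>r. ball_inner R (v' r) (v h)"])
  note rpv = poly_curve_rp[OF v(1)] poly_curve_rp'[OF v(1)]
  show "((\<lambda>r. ball_inner R (v r) (v h)) has_real_derivative ball_inner R (v' r) (v h)) (at r)" for r
    unfolding ball_inner_def
    by (rule poly_curve_integral, rule poly_curve_cong[OF poly_curve_mult_rp[OF rpv(1)[of h] v(1)]]) (auto simp: mult_ac)
  show "ball_inner R (v 0) (v h) = 0" using v by (simp add: ball_inner_def)
  show "ball_inner R (v h) (v h) = (ball_norm R (v h))\<^sup>2" by (intro ball_inner_self cont_ext_rp rpv)
  show n0: "ball_norm R (v h) \<ge> 0" by (intro ball_norm_nonneg cont_ext_rp rpv)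
  show "ball_inner R (v' r) (v h) \<le> c * ball_norm R (v h)" if "0 \<le> r" "r \<le> h" for r
  proof -
    have "ball_inner R (v' r) (v h) \<le> ball_norm R (v' r) * ball_norm R (v h)"
      by (intro abs_le_D1[OF ball_inner_le_ball_norm] cont_ext_rp rpv)
    also have "\<dots> \<le> c * ball_norm R (v h)" using c that n0 by (intro mult_right_mono) auto
    finally show ?thesis .
  qed
  show "0 \<le> c" using c[of 0] h ball_norm_nonneg[of R "v' 0"] rpv by (auto intro: cont_ext_rp order_trans)
qed (use h in auto)

section \<open>The Poincare inequality\<close>

text \<open>Polynomials in two vector variables, written as finite sums of products. Integrating out
  one variable leaves a polynomial, and Fubini's theorem becomes an induction over the sum.\<close>

inductive separable :: "(real ^ 'n::finite \<Rightarrow> real ^ 'n \<Rightarrow> real) \<Rightarrow> bool" where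
  separable_term: "rp a \<Longrightarrow> rp b \<Longrightarrow> separable (\<lambda>x y. a x * b y)"
| separable_add: "separable F \<Longrightarrow> separable G \<Longrightarrow> separable (\<lambda>x y. F x y + G x y)"

lemma separable_mult:
  assumes "separable F" "separable G" shows "separable (\<lambda>x y. F x y * G x y)"
  using assms
proof (induction rule: separable.induct)
  case (separable_term a b)
  note * = separable_term
  from \<open>separable G\<close> show ?case
  proof (induction rule: separable.induct)
    case (separable_term c d)
    with * have "separable (\<lambda>x y. (a x * c x) * (b y * d y))" by (intro separable.separable_term rp_intros)
    then show ?case by (simp add: mult_ac)
  next
    case (separable_add F G)
    then show ?case using separable.separable_add by (fastforce simp: distrib_left)
  qed
next
  case (separable_add F H)
  then show ?case using separable.separable_add by (fastforce simp: distrib_right)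
qed

lemma separable_fst: "rp a \<Longrightarrow> separable (\<lambda>x y. a x)"
  using separable_term[of a "\<lambda>y. 1"] by (auto intro: rp_intros)

lemma separable_snd: "rp a \<Longrightarrow> separable (\<lambda>x y. a y)"
  using separable_term[of "\<lambda>y. 1" a] by (auto intro: rp_intros)

lemma separable_diff: "separable F \<Longrightarrow> separable G \<Longrightarrow> separable (\<lambda>x y. F x y - G x y)"
  using separable_add[of F "\<lambda>x y. -1 * G x y"] separable_mult[OF separable_fst[of "\<lambda>x. -1"]]
  by (auto intro: rp_intros)

text \<open>Two instances are used: weights 1/2 and 1/2 for midpoints in the Poincare inequality,
  weights -1 and 1 for convolution kernels.\<close>

lemma separable_affine: assumes "rp g" shows "separable (\<lambda>x y. g (\<alpha> *\<^sub>R x + \<beta> *\<^sub>R y))"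
  using assms
proof (induction g)
  case (linear f)
  then interpret f: bounded_linear f .
  have "separable (\<lambda>x y. \<alpha> * f x + \<beta> * f y)"
    using linear by (intro separable_add separable_fst separable_snd rp_intros(3)) (auto intro: real_polynomial_function.intros)
  then show ?case by (simp add: f.add f.scaleR)
qed (auto intro: separable_add separable_mult separable_fst rp_intros)

lemma separable_rp: "separable F \<Longrightarrow> rp (\<lambda>x. F x y)" and separable_rp': "separable F \<Longrightarrow> rp (F x)"
  by (induction rule: separable.induct) (auto intro: rp_intros)

lemma separable_integral_rp:
  assumes "separable F" shows "rp (\<lambda>y. integral (ball c R) (\<lambda>x. F x y))"
  using assms
proof (induction rule: separable.induct)
  case (separable_term a b)
  then show ?case by (auto intro: rp_intros)
next
  case (separable_add F G)
  then show ?case by (simp add: integral_add rp_integrable separable_rp rp_intros)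
qed

lemma separable_swap: assumes "separable F" shows "separable (\<lambda>x y. F y x)"
  using assms
proof (induction rule: separable.induct)
  case (separable_term a b)
  then show ?case using separable.separable_term[of b a] by (simp add: mult.commute)
qed (rule separable.separable_add)

lemma separable_integral_swap:
  assumes "separable F"
  shows "integral (ball c R) (\<lambda>y. integral (ball c R) (\<lambda>x. F x y)) = integral (ball c R) (\<lambda>x. integral (ball c R) (\<lambda>y. F x y))"
  using assms
proof (induction rule: separable.induct)
  case (separable_term a b)
  then show ?case by (simp add: mult.commute)
next
  case (separable_add F G)
  then show ?case
    by (simp add: integral_add rp_integrable separable_rp separable_rp' separable_integral_rp separable_integral_rp[OF separable_swap])
qed

lemma bounded_linear_expand:
  fixes f :: "real ^ 'n::finite \<Rightarrow> real"
  assumes "bounded_linear f" shows "f z = (\<Sum>i\<in>UNIV. z $ i * f (axis i 1))"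
proof -
  interpret bounded_linear f by fact
  have "f z = f (\<Sum>i\<in>UNIV. z $ i *\<^sub>R axis i 1)"
    using basis_expansion[of z] by (simp add: scalar_mult_eq_scaleR)
  then show ?thesis by (simp add: sum scaleR)
qed

lemma poly_curve_segment:
  assumes "rp g"
  shows "poly_curve (\<lambda>s x. g ((1 - s) *\<^sub>R x + s *\<^sub>R y))
    (\<lambda>s x. \<Sum>i\<in>UNIV. (y $ i - x $ i) * pd i g ((1 - s) *\<^sub>R x + s *\<^sub>R y))"
  using assms
proof (induction g)
  case (linear f)
  then interpret f: bounded_linear f .
  have "f y - f x = (\<Sum>i\<in>UNIV. (y $ i - x $ i) * f (axis i 1))" for x
    using bounded_linear_expand[OF linear, of "y - x"] by (simp add: f.diff)
  then show ?case
    by (intro poly_curve_cong[OF poly_curve_add[OF poly_curve_term[of f "\<lambda>s. 1 - s" "\<lambda>s. -1"] poly_curve_term[of "\<lambda>x. f y" "\<lambda>s. s" "\<lambda>s. 1"]]])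
      (auto intro!: derivative_eq_intros real_polynomial_function.intros(1,2) linear simp: f.add f.scaleR pd_linear[OF linear])
next
  case (const c)
  show ?case by (rule poly_curve_cong[OF poly_curve_const[of "\<lambda>x. c"]]) (auto simp: pd_const intro: rp_intros)
next
  case (add f g)
  show ?case
    by (rule poly_curve_cong[OF poly_curve_add[OF add.IH]])
      (auto simp: pd_add[OF add.hyps] algebra_simps sum.distrib sum_subtractf)
next
  case (mult f g)
  show ?case
    by (rule poly_curve_cong[OF poly_curve_mult[OF mult.IH]])
      (auto simp: pd_mult[OF mult.hyps] algebra_simps sum.distrib sum_subtractf sum_distrib_left)
qed

lemma rp_affine: assumes "rp g" shows "rp (\<lambda>x. g (a *\<^sub>R x + b))"
  using assms
proof (induction g)
  case (linear f)
  then interpret f: bounded_linear f .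
  have "rp (\<lambda>x. a * f x + f b)"
    by (intro rp_intros real_polynomial_function.intros(1) linear)
  then show ?case by (simp add: f.add f.scaleR)
qed (auto intro: rp_intros)

text \<open>The map x -> (1 - s) x + s y sends the ball into itself by convexity, and the
  substitution costs the factor (1 - s)^(-d), at most 2^d because
  \<open>s \<le> 1 / 2\<close>.\<close>

lemma integral_contraction_le:
  fixes q :: "('n::finite) rfun"
  assumes q: "rp q" "\<And>x. q x \<ge> 0" and s: "0 \<le> s" "s \<le> 1 / 2" and y: "y \<in> ball 0 R"
  shows "integral (ball 0 R) (\<lambda>x. q ((1 - s) *\<^sub>R x + s *\<^sub>R y)) \<le> 2 ^ CARD('n) * integral (ball 0 R) q"
proof -
  \<comment> \<open>Extension by zero, so that the affine change of variables can be carried out on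
    boxes.\<close>
  define Q where "Q = (\<lambda>z. if z \<in> ball 0 R then q z else 0)"
  let ?a = "(\<chi> i. - R) :: real ^ 'n" and ?b = "(\<chi> i. R) :: real ^ 'n" and ?c = "s *\<^sub>R y" and ?m = "1 - s"
  have sub: "ball 0 R \<subseteq> (cube R :: (real ^ 'n) set)" using cball_subset_cube[of R R] ball_subset_cball by force
  have m: "?m \<ge> 1 / 2" "?m > 0" using s by auto
  have "(q has_integral integral (ball 0 R) q) (ball 0 R)"
    by (intro integrable_integral rp_integrable q)
  then have "(Q has_integral integral (ball 0 R) q) (cube R)"
    unfolding Q_def using sub by (subst has_integral_restrict) auto
  from has_integral_affinity'[OF this[unfolded cube_def] m(2), of ?c]
  have hi: "((\<lambda>x. Q (?m *\<^sub>R x + ?c)) has_integral integral (ball 0 R) q /\<^sub>R ?m ^ CARD('n))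
    (cbox ((?a - ?c) /\<^sub>R ?m) ((?b - ?c) /\<^sub>R ?m))" (is "(_ has_integral _) ?K") by simp
  have inb: "?m *\<^sub>R x + ?c \<in> ball 0 R" if "x \<in> ball 0 R" for x
    using convexD[OF convex_ball[of 0 R] that y, of ?m s] s by simp
  have "integral (ball 0 R) (\<lambda>x. q (?m *\<^sub>R x + ?c)) = integral (ball 0 R) (\<lambda>x. Q (?m *\<^sub>R x + ?c))"
    using inb by (intro integral_cong) (auto simp: Q_def)
  also have "\<dots> \<le> integral ?K (\<lambda>x. Q (?m *\<^sub>R x + ?c))"
  proof (rule integral_subset_le)
    show "ball 0 R \<subseteq> ?K"
    proof
      fix x :: "real ^ 'n" assume "x \<in> ball 0 R"
      then have "?m *\<^sub>R x + ?c \<in> cbox ?a ?b" using inb sub unfolding cube_def by blast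
      then have "- R \<le> ?m * x $ i + s * y $ i \<and> ?m * x $ i + s * y $ i \<le> R" for i
        by (simp add: mem_box_cart)
      then have "(- R - s * y $ i) / ?m \<le> x $ i \<and> x $ i \<le> (R - s * y $ i) / ?m" for i
        using m(2) by (simp add: pos_divide_le_eq[OF m(2)] pos_le_divide_eq[OF m(2)] mult.commute[of "x $ i"] algebra_simps)
      then show "x \<in> ?K" by (simp add: mem_box_cart divide_inverse mult.commute[of "inverse _"])
    qed
    have "(\<lambda>x. q (?m *\<^sub>R x + ?c)) integrable_on ball 0 R" by (intro rp_integrable rp_affine q)
    then show "(\<lambda>x. Q (?m *\<^sub>R x + ?c)) integrable_on ball 0 R"
      by (rule integrable_eq) (use inb in \<open>auto simp: Q_def\<close>)
    show "(\<lambda>x. Q (?m *\<^sub>R x + ?c)) integrable_on ?K" using hi by blast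
  qed (use q in \<open>auto simp: Q_def\<close>)
  also have "\<dots> = (1 / ?m) ^ CARD('n) * integral (ball 0 R) q"
    using integral_unique[OF hi] by (simp add: divide_inverse power_inverse)
  also have "\<dots> \<le> 2 ^ CARD('n) * integral (ball 0 R) q"
  proof (intro mult_right_mono power_mono)
    show "1 / ?m \<le> 2" using m by (simp add: field_simps)
  qed (use m q in \<open>auto intro: integral_nonneg rp_integrable\<close>)
  finally show ?thesis .
qed

text \<open>The segment from x to y is followed only up to its midpoint, where the contraction is
  still boundedly invertible; at s = 1 it would collapse the ball to y. The factor \<open>R\<close>
  is half the diameter: speed at most 2 R during a parameter interval of length 1/2.\<close>

lemma poincare_midpoint:
  fixes g :: "('n::finite) rfun"
  assumes g: "rp g" and y: "y \<in> ball 0 R"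
  shows "integral (ball 0 R) (\<lambda>x. (g x - g ((1/2) *\<^sub>R x + (1/2) *\<^sub>R y))\<^sup>2)
    \<le> R\<^sup>2 * 2 ^ CARD('n) * integral (ball 0 R) (\<lambda>x. \<Sum>i\<in>UNIV. (pd i g x)\<^sup>2)"
proof -
  have R: "R > 0" using y by (metis ball_eq_empty empty_iff not_le)
  define q where "q = (\<lambda>x. \<Sum>i\<in>UNIV. (pd i g x)\<^sup>2)"
  define v where "v = (\<lambda>s x. g ((1 - s) *\<^sub>R x + s *\<^sub>R y) - g x)"
  define v' where "v' = (\<lambda>s x. \<Sum>i\<in>UNIV. (y $ i - x $ i) * pd i g ((1 - s) *\<^sub>R x + s *\<^sub>R y))"
  have rpq: "rp q" unfolding q_def by (intro rp_intros rp_pd g) auto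
  have q0: "q x \<ge> 0" for x unfolding q_def by (intro sum_nonneg) auto
  let ?I = "2 ^ CARD('n) * integral (ball 0 R) q"
  have I0: "?I \<ge> 0" by (intro mult_nonneg_nonneg integral_nonneg rp_integrable rpq q0) auto
  have pv: "poly_curve v v'"
    unfolding v_def v'_def by (rule poly_curve_cong[OF poly_curve_diff[OF poly_curve_segment[OF g] poly_curve_const[OF g]]]) auto
  have "ball_norm R (v (1/2)) \<le> (1/2) * (2 * R * sqrt ?I)"
  proof (rule ball_norm_mean_value[OF pv])
    fix s :: real assume s: "0 \<le> s" "s \<le> 1/2"
    have rpv: "rp (v' s)" by (rule poly_curve_rp'[OF pv])
    have "(ball_norm R (v' s))\<^sup>2 = integral (ball 0 R) (\<lambda>x. (v' s x)\<^sup>2)" by (intro ball_norm_power2 cont_ext_rp rpv)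
    also have "\<dots> \<le> integral (ball 0 R) (\<lambda>x. (2 * R)\<^sup>2 * q ((1 - s) *\<^sub>R x + s *\<^sub>R y))"
    proof (intro integral_le rp_integrable rp_intros rpv rp_affine rpq)
      fix x :: "real ^ 'n" assume x: "x \<in> ball 0 R"
      let ?w = "\<chi> i. pd i g ((1 - s) *\<^sub>R x + s *\<^sub>R y)"
      have nw: "(norm ?w)\<^sup>2 = q ((1 - s) *\<^sub>R x + s *\<^sub>R y)"
        unfolding power2_norm_eq_inner inner_vec_def q_def by (simp add: power2_eq_square)
      have "v' s x = (y - x) \<bullet> ?w" by (simp add: v'_def inner_vec_def)
      then have "\<bar>v' s x\<bar> \<le> norm (y - x) * norm ?w" using Cauchy_Schwarz_ineq2 by metis
      also have "\<dots> \<le> (2 * R) * norm ?w"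
        using norm_triangle_ineq4[of y x] x y by (intro mult_right_mono) auto
      finally have "\<bar>v' s x\<bar>\<^sup>2 \<le> ((2 * R) * norm ?w)\<^sup>2" by (intro power_mono) auto
      then show "(v' s x)\<^sup>2 \<le> (2 * R)\<^sup>2 * q ((1 - s) *\<^sub>R x + s *\<^sub>R y)"
        by (simp add: power_mult_distrib nw)
    qed
    also have "\<dots> = (2 * R)\<^sup>2 * integral (ball 0 R) (\<lambda>x. q ((1 - s) *\<^sub>R x + s *\<^sub>R y))" by simp
    also have "\<dots> \<le> (2 * R)\<^sup>2 * ?I"
      by (intro mult_left_mono integral_contraction_le rpq q0 s y) auto
    also have "\<dots> = (2 * R * sqrt ?I)\<^sup>2" using I0 by (simp add: power_mult_distrib)
    finally show "ball_norm R (v' s) \<le> 2 * R * sqrt ?I"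
      using R I0 by (intro power2_le_imp_le[of "ball_norm R (v' s)"]) auto
  qed (auto simp: v_def)
  then have "(ball_norm R (v (1/2)))\<^sup>2 \<le> (R * sqrt ?I)\<^sup>2"
    by (intro power_mono ball_norm_nonneg cont_ext_rp poly_curve_rp[OF pv]) auto
  also have "\<dots> = R\<^sup>2 * ?I" using I0 by (simp add: power_mult_distrib)
  finally have "(ball_norm R (v (1/2)))\<^sup>2 \<le> R\<^sup>2 * ?I" .
  moreover have "(ball_norm R (v (1/2)))\<^sup>2 = integral (ball 0 R) (\<lambda>x. (v (1/2) x)\<^sup>2)"
    by (intro ball_norm_power2 cont_ext_rp poly_curve_rp[OF pv])
  ultimately show ?thesis
    by (simp add: v_def q_def power2_commute mult_ac)
qed

text \<open>The values g x and g y are compared through the value at the midpoint, which is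
  symmetric in x and y, so after exchanging the integrals both halves give the same term. The double
  integral of (g x - g y)^2 equals 2 V times the squared norm of g minus twice the squared integral
  of g.\<close>

lemma poincare:
  fixes g :: "('n::finite) rfun"
  assumes g: "rp g" and R: "R > 0"
  defines "V \<equiv> integral (ball 0 R) (\<lambda>x :: real ^ 'n. 1)"
  shows "V > 0" and "(ball_norm R g)\<^sup>2 \<le> (integral (ball 0 R) g)\<^sup>2 / V
    + 2 * (R\<^sup>2 * 2 ^ CARD('n)) * integral (ball 0 R) (\<lambda>x. \<Sum>i\<in>UNIV. (pd i g x)\<^sup>2)"
proof -
  let ?int = "integral (ball (0 :: real ^ 'n) R)"
  define K where "K = R\<^sup>2 * 2 ^ CARD('n) * ?int (\<lambda>x. \<Sum>i\<in>UNIV. (pd i g x)\<^sup>2)"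
  define m where "m = (\<lambda>x y. g ((1/2) *\<^sub>R x + (1/2) *\<^sub>R y))"
  have "V = measure lebesgue (ball (0 :: real ^ 'n) R)"
    unfolding V_def by (rule lmeasure_integral[symmetric, OF lmeasurable_ball])
  then show V: "V > 0" using R content_ball_pos[of R "0 :: real ^ 'n"] by (simp add: measure_completion)
  have sm: "separable m" unfolding m_def by (rule separable_affine[OF g])
  have Vc: "?int (\<lambda>y. c) = V * c" for c
    using integral_mult_left[of "ball (0 :: real ^ 'n) R" "\<lambda>x. 1" c] unfolding V_def by simp
  have s1: "separable (\<lambda>x y. (g x - m x y)\<^sup>2)" and s2: "separable (\<lambda>x y. (m x y - g y)\<^sup>2)"
    and s3: "separable (\<lambda>x y. (g x - g y)\<^sup>2)"
    unfolding power2_eq_square by (intro separable_mult separable_diff separable_fst separable_snd g sm)+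
  have s4: "separable (\<lambda>x y. 2 * (g x - m x y)\<^sup>2 + 2 * (m x y - g y)\<^sup>2)"
    by (intro separable_add separable_mult[OF separable_fst[of "\<lambda>x. 2"]] s1 s2 rp_intros(1))
  have i1: "(\<lambda>x. (g x - m x y)\<^sup>2) integrable_on ball 0 R" "(\<lambda>x. (m x y - g y)\<^sup>2) integrable_on ball 0 R" for y
    by (rule rp_integrable[OF separable_rp[OF s1]] rp_integrable[OF separable_rp[OF s2]])+
  have i2: "(\<lambda>y. ?int (\<lambda>x. (g x - m x y)\<^sup>2)) integrable_on ball 0 R"
    "(\<lambda>y. ?int (\<lambda>x. (m x y - g y)\<^sup>2)) integrable_on ball 0 R"
    by (rule rp_integrable[OF separable_integral_rp[OF s1]] rp_integrable[OF separable_integral_rp[OF s2]])+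
  have "?int (\<lambda>y. ?int (\<lambda>x. (g x - g y)\<^sup>2)) \<le> ?int (\<lambda>y. ?int (\<lambda>x. 2 * (g x - m x y)\<^sup>2 + 2 * (m x y - g y)\<^sup>2))"
  proof (rule integral_le[OF rp_integrable[OF separable_integral_rp[OF s3]] rp_integrable[OF separable_integral_rp[OF s4]]])
    fix y
    show "?int (\<lambda>x. (g x - g y)\<^sup>2) \<le> ?int (\<lambda>x. 2 * (g x - m x y)\<^sup>2 + 2 * (m x y - g y)\<^sup>2)"
    proof (rule integral_le[OF rp_integrable[OF separable_rp[OF s3]] rp_integrable[OF separable_rp[OF s4]]])
      fix x
      have "0 \<le> ((g x - m x y) - (m x y - g y))\<^sup>2" by simp
      then show "(g x - g y)\<^sup>2 \<le> 2 * (g x - m x y)\<^sup>2 + 2 * (m x y - g y)\<^sup>2"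
        by (simp add: power2_eq_square algebra_simps)
    qed
  qed
  also have "\<dots> = 2 * ?int (\<lambda>y. ?int (\<lambda>x. (g x - m x y)\<^sup>2)) + 2 * ?int (\<lambda>y. ?int (\<lambda>x. (m x y - g y)\<^sup>2))"
    by (simp add: integral_add i1 i2)
  also have "?int (\<lambda>y. ?int (\<lambda>x. (m x y - g y)\<^sup>2)) = ?int (\<lambda>x. ?int (\<lambda>y. (m x y - g y)\<^sup>2))"
    by (rule separable_integral_swap[OF s2])
  also have "\<dots> = ?int (\<lambda>y. ?int (\<lambda>x. (g x - m x y)\<^sup>2))"
    by (simp add: m_def add.commute power2_commute)
  also have "2 * ?int (\<lambda>y. ?int (\<lambda>x. (g x - m x y)\<^sup>2)) + 2 * ?int (\<lambda>y. ?int (\<lambda>x. (g x - m x y)\<^sup>2)) \<le> 4 * (V * K)"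
  proof -
    have "?int (\<lambda>y. ?int (\<lambda>x. (g x - m x y)\<^sup>2)) \<le> ?int (\<lambda>y. K)"
    proof (rule integral_le[OF i2(1)])
      show "(\<lambda>y. K) integrable_on (ball 0 R :: (real ^ 'n) set)" by (intro rp_integrable rp_intros)
      show "?int (\<lambda>x. (g x - m x y)\<^sup>2) \<le> K" if "y \<in> ball 0 R" for y
        unfolding m_def K_def by (rule poincare_midpoint[OF g that])
    qed
    then show ?thesis using Vc by simp
  qed
  finally have D: "?int (\<lambda>y. ?int (\<lambda>x. (g x - g y)\<^sup>2)) \<le> 4 * (V * K)" by simp
  have gg: "?int (\<lambda>y. g y * g y) = (ball_norm R g)\<^sup>2" by (simp add: ball_norm_power2 cont_ext_rp g flip: power2_eq_square)
  have "?int (\<lambda>x. (g x - g y)\<^sup>2) = (ball_norm R g)\<^sup>2 - 2 * g y * ?int g + V * (g y)\<^sup>2" for y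
  proof -
    have "?int (\<lambda>x. (g x - g y)\<^sup>2) = ?int (\<lambda>x. (g x * g x - 2 * g y * g x) + (g y * g y))"
      by (simp add: power2_eq_square algebra_simps)
    also have "\<dots> = ?int (\<lambda>x. g x * g x) - 2 * g y * ?int g + V * (g y * g y)"
      by (simp add: integral_add integral_diff rp_integrable rp_intros g Vc del: mult.assoc)
    finally show ?thesis by (simp add: gg power2_eq_square)
  qed
  then have "?int (\<lambda>y. ?int (\<lambda>x. (g x - g y)\<^sup>2)) = ?int (\<lambda>y. ((ball_norm R g)\<^sup>2 - (2 * ?int g) * g y) + V * (g y * g y))"
    by (simp add: power2_eq_square mult_ac)
  also have "\<dots> = V * (ball_norm R g)\<^sup>2 - 2 * ?int g * ?int g + V * ?int (\<lambda>y. g y * g y)"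
    by (simp add: integral_add integral_diff rp_integrable rp_intros g Vc del: mult.assoc)
  also note gg
  finally have "V * (ball_norm R g)\<^sup>2 \<le> (?int g)\<^sup>2 + 2 * (V * K)" using D by (simp add: power2_eq_square)
  then have "(ball_norm R g)\<^sup>2 \<le> ((?int g)\<^sup>2 + 2 * (V * K)) / V" using V by (simp add: field_simps)
  also have "\<dots> = (?int g)\<^sup>2 / V + 2 * K" using V by (simp add: field_simps)
  finally show "(ball_norm R g)\<^sup>2 \<le> (?int g)\<^sup>2 / V + 2 * (R\<^sup>2 * 2 ^ CARD('n)) * ?int (\<lambda>x. \<Sum>i\<in>UNIV. (pd i g x)\<^sup>2)"
    by (simp add: K_def mult.assoc)
qed

section \<open>The growth bound\<close>

text \<open>With q = c / (a + \<omega>) the function q exp (\<omega> t) solves the equation with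
  source c exp (\<omega> t), and subtracting it under the integrating factor leaves a nonincreasing
  function. The constant contains the lower bound \<open>b\<close> in place of a + \<omega>, so that
  one constant serves all orders of derivatives.\<close>

lemma duhamel_le:
  fixes A :: "real \<Rightarrow> real"
  assumes A: "\<And>t. (A has_real_derivative A' t) (at t)"
    and le: "\<And>t. 0 \<le> t \<Longrightarrow> A' t + a * A t \<le> c * exp (\<omega> * t)"
    and b: "0 < b" "b \<le> a + \<omega>" and c: "0 \<le> c" and t: "0 \<le> t"
  shows "A t \<le> exp (\<omega> * t) * (\<bar>A 0\<bar> + c / b)"
proof -
  define q where "q = c / (a + \<omega>)"
  have q: "0 \<le> q" "q \<le> c / b" "q * (a + \<omega>) = c"
    unfolding q_def using b c by (auto intro: divide_left_mono)
  have "exp (a * t) * A t - q * exp ((a + \<omega>) * t) \<le> exp (a * 0) * A 0 - q * exp ((a + \<omega>) * 0)"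
  proof (rule DERIV_nonpos_imp_nonincreasing[OF t], intro exI conjI)
    fix x :: real assume x: "0 \<le> x"
    show "((\<lambda>t. exp (a * t) * A t - q * exp ((a + \<omega>) * t)) has_real_derivative
       exp (a * x) * (A' x + a * A x) - q * (a + \<omega>) * exp ((a + \<omega>) * x)) (at x)"
      by (auto intro!: derivative_eq_intros A simp: algebra_simps)
    have "exp (a * x) * (A' x + a * A x) \<le> exp (a * x) * (c * exp (\<omega> * x))"
      by (intro mult_left_mono le x) auto
    also have "\<dots> = c * exp ((a + \<omega>) * x)" by (simp add: distrib_right exp_add)
    finally show "exp (a * x) * (A' x + a * A x) - q * (a + \<omega>) * exp ((a + \<omega>) * x) \<le> 0"
      using q(3) by simp
  qed
  then have 1: "exp (a * t) * A t \<le> \<bar>A 0\<bar> + q * exp ((a + \<omega>) * t)" using q(1) by simp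
  have "1 \<le> exp ((a + \<omega>) * t)" using b t by simp
  then have "\<bar>A 0\<bar> * 1 \<le> \<bar>A 0\<bar> * exp ((a + \<omega>) * t)" by (intro mult_left_mono) auto
  with 1 have "exp (a * t) * A t \<le> (\<bar>A 0\<bar> + q) * exp ((a + \<omega>) * t)" by (simp add: distrib_right)
  also have "\<dots> \<le> (\<bar>A 0\<bar> + c / b) * exp ((a + \<omega>) * t)" using q by (intro mult_right_mono) auto
  also have "exp ((a + \<omega>) * t) = exp (a * t) * exp (\<omega> * t)"
    by (simp add: distrib_right exp_add)
  finally have "exp (a * t) * A t \<le> exp (a * t) * (exp (\<omega> * t) * (\<bar>A 0\<bar> + c / b))"
    by (simp only: mult_ac)
  then show ?thesis by (rule mult_left_le_imp_le) simp
qed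

lemma duhamel_abs_le:
  fixes A :: "real \<Rightarrow> real"
  assumes A: "\<And>t. (A has_real_derivative A' t) (at t)"
    and le: "\<And>t. 0 \<le> t \<Longrightarrow> \<bar>A' t + a * A t\<bar> \<le> c * exp (\<omega> * t)"
    and b: "0 < b" "b \<le> a + \<omega>" and c: "0 \<le> c" and t: "0 \<le> t"
  shows "\<bar>A t\<bar> \<le> exp (\<omega> * t) * (\<bar>A 0\<bar> + c / b)"
proof -
  have "A t \<le> exp (\<omega> * t) * (\<bar>A 0\<bar> + c / b)"
    by (rule duhamel_le[OF A abs_le_D1[OF le] b c t])
  moreover have "- A t \<le> exp (\<omega> * t) * (\<bar>- A 0\<bar> + c / b)"
  proof (rule duhamel_le[of "\<lambda>t. - A t" "\<lambda>t. - A' t" a, OF DERIV_minus[OF A] _ b c t])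
    show "- A' t + a * - A t \<le> c * exp (\<omega> * t)" if "0 \<le> t" for t
      using abs_le_D2[OF le[OF that]] by simp
  qed
  ultimately show ?thesis by (simp add: abs_le_iff)
qed

text \<open>The constant must not depend on the curve or on \<open>a\<close>,
  \<open>\<omega>\<close>, \<open>K\<close>, which is why these are quantified inside. Integrating
  the equation over the ball gives A' + a A for A = \<integral> g as minus the integral of x . grad
  g plus that of r. The radial term is not integrated by parts but paired with the known gradient.
  Duhamel then bounds the mean, and Poincare recovers g from mean and gradient.\<close>

lemma ball_norm_le_of_pd_le:
  fixes R b :: real
  assumes R: "R > 0" and b: "b > 0"
  shows "\<exists>C\<ge>0. \<forall>(g :: real \<Rightarrow> ('n::finite) rfun) r a \<omega> K.
    poly_curve g (\<lambda>t x. - a * g t x - (\<Sum>i\<in>UNIV. x $ i * pd i (g t) x) + r t x) \<longrightarrow> (\<forall>t. rp (r t)) \<longrightarrow>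
    b \<le> a + \<omega> \<longrightarrow> 0 \<le> K \<longrightarrow> (\<forall>t\<ge>0. \<forall>i. ball_norm R (pd i (g t)) \<le> K * exp (\<omega> * t)) \<longrightarrow>
    (\<forall>t\<ge>0. ball_norm R (r t) \<le> K * exp (\<omega> * t)) \<longrightarrow> ball_norm R (g 0) \<le> K \<longrightarrow>
    (\<forall>t\<ge>0. ball_norm R (g t) \<le> C * K * exp (\<omega> * t))"
proof -
  let ?int = "integral (ball (0 :: real ^ 'n) R)"
  define V :: real where "V = ?int (\<lambda>x. 1)"
  define \<kappa> where "\<kappa> = (\<Sum>i\<in>UNIV. ball_norm R (\<lambda>x :: real ^ 'n. x $ i)) + ball_norm R (\<lambda>x :: real ^ 'n. 1)"
  \<comment> \<open>The first summand is the squared bound for the integral of g with Poincare's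
    weight 1 / V, the second the Poincare factor times the number of directions. Both concern
    squares, so the constant obtained is \<open>sqrt C\<close>.\<close>
  define C where "C = (\<kappa> * (1 + 1 / b))\<^sup>2 / V + 2 * (R\<^sup>2 * 2 ^ CARD('n)) * real CARD('n)"
  have V: "V > 0" unfolding V_def by (rule poincare(1)[OF rp_intros(1)[of 0] R])
  have nlc: "ball_norm R (\<lambda>x :: real ^ 'n. x $ i) \<ge> 0" "ball_norm R (\<lambda>x :: real ^ 'n. 1) \<ge> 0" for i
    by (intro ball_norm_nonneg cont_ext_rp rp_intros)+
  have \<kappa>: "\<kappa> \<ge> ball_norm R (\<lambda>x :: real ^ 'n. 1)" "\<kappa> \<ge> 0"
    unfolding \<kappa>_def using nlc sum_nonneg[of UNIV "\<lambda>i. ball_norm R (\<lambda>x :: real ^ 'n. x $ i)"] by auto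
  have C0: "C \<ge> 0" unfolding C_def using V b by auto
  have main: "ball_norm R (g t) \<le> sqrt C * K * exp (\<omega> * t)"
    if g: "poly_curve g (\<lambda>t x. - a * g t x - (\<Sum>i\<in>UNIV. x $ i * pd i (g t) x) + r t x)" and r: "\<And>t. rp (r t)"
    and a: "b \<le> a + \<omega>" and K: "0 \<le> K" and dg: "\<And>t i. 0 \<le> t \<Longrightarrow> ball_norm R (pd i (g t)) \<le> K * exp (\<omega> * t)"
    and nr: "\<And>t. 0 \<le> t \<Longrightarrow> ball_norm R (r t) \<le> K * exp (\<omega> * t)" and g0: "ball_norm R (g 0) \<le> K" and t: "0 \<le> t"
    for g :: "real \<Rightarrow> 'n rfun" and r a \<omega> K t
  proof -
    note rpg = poly_curve_rp[OF g]
    define A where "A = (\<lambda>t. ?int (g t))"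
    define A' where "A' = (\<lambda>t. ?int (\<lambda>x. - a * g t x - (\<Sum>i\<in>UNIV. x $ i * pd i (g t) x) + r t x))"
    have int_le: "\<bar>?int q\<bar> \<le> \<kappa> * ball_norm R q" if "rp q" for q :: "'n rfun"
    proof -
      have "\<bar>?int q\<bar> \<le> ball_norm R (\<lambda>x :: real ^ 'n. 1) * ball_norm R q"
        using ball_inner_le_ball_norm[OF cont_ext_rp[OF rp_intros(1)[of 1]] cont_ext_rp[OF that], of R] by (simp add: ball_inner_def)
      also have "\<dots> \<le> \<kappa> * ball_norm R q" using \<kappa> that by (intro mult_right_mono ball_norm_nonneg cont_ext_rp)
      finally show ?thesis .
    qed
    have A'_eq: "A' t + a * A t = - (\<Sum>i\<in>UNIV. ball_inner R (\<lambda>x. x $ i) (pd i (g t))) + ball_inner R (\<lambda>x. 1) (r t)" for t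
    proof -
      have "A' t = - a * ?int (g t) - (\<Sum>i\<in>UNIV. ?int (\<lambda>x. x $ i * pd i (g t) x)) + ?int (r t)"
        unfolding A'_def
        by (simp add: integral_add integral_diff integral_sum rp_integrable rp_intros real_polynomial_function_minus rp_pd rpg r)
      then show ?thesis by (simp add: A_def ball_inner_def)
    qed
    have "\<bar>A t\<bar> \<le> exp (\<omega> * t) * (\<bar>A 0\<bar> + \<kappa> * K / b)"
    proof (rule duhamel_abs_le[of A A' a, OF _ _ b a _ t])
      show "(A has_real_derivative A' t) (at t)" for t
        unfolding A_def A'_def by (rule poly_curve_integral[OF g])
      show "0 \<le> \<kappa> * K" using \<kappa> K by simp
      fix t :: real assume t: "0 \<le> t"
      have "\<bar>A' t + a * A t\<bar> \<le> (\<Sum>i\<in>UNIV. \<bar>ball_inner R (\<lambda>x. x $ i) (pd i (g t))\<bar>) + \<bar>ball_inner R (\<lambda>x. 1) (r t)\<bar>"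
        unfolding A'_eq
        using sum_abs[of "\<lambda>i. ball_inner R (\<lambda>x. x $ i) (pd i (g t))" UNIV] by linarith
      also have "\<dots> \<le> (\<Sum>i\<in>UNIV. ball_norm R (\<lambda>x :: real ^ 'n. x $ i) * (K * exp (\<omega> * t))) + ball_norm R (\<lambda>x :: real ^ 'n. 1) * (K * exp (\<omega> * t))"
      proof (intro add_mono sum_mono)
        fix i
        have "\<bar>ball_inner R (\<lambda>x. x $ i) (pd i (g t))\<bar> \<le> ball_norm R (\<lambda>x :: real ^ 'n. x $ i) * ball_norm R (pd i (g t))"
          by (intro ball_inner_le_ball_norm cont_ext_rp rp_intros rp_pd rpg)
        also have "\<dots> \<le> ball_norm R (\<lambda>x :: real ^ 'n. x $ i) * (K * exp (\<omega> * t))"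
          using nlc dg[OF t] by (intro mult_left_mono)
        finally show "\<bar>ball_inner R (\<lambda>x. x $ i) (pd i (g t))\<bar> \<le> ball_norm R (\<lambda>x :: real ^ 'n. x $ i) * (K * exp (\<omega> * t))" .
      next
        have "\<bar>ball_inner R (\<lambda>x. 1) (r t)\<bar> \<le> ball_norm R (\<lambda>x :: real ^ 'n. 1) * ball_norm R (r t)"
          by (intro ball_inner_le_ball_norm cont_ext_rp rp_intros r)
        also have "\<dots> \<le> ball_norm R (\<lambda>x :: real ^ 'n. 1) * (K * exp (\<omega> * t))"
          using nlc nr[OF t] by (intro mult_left_mono)
        finally show "\<bar>ball_inner R (\<lambda>x. 1) (r t)\<bar> \<le> ball_norm R (\<lambda>x :: real ^ 'n. 1) * (K * exp (\<omega> * t))" .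
      qed
      also have "\<dots> = \<kappa> * K * exp (\<omega> * t)"
        unfolding \<kappa>_def by (simp add: sum_distrib_right distrib_right mult.assoc)
      finally show "\<bar>A' t + a * A t\<bar> \<le> \<kappa> * K * exp (\<omega> * t)" .
    qed
    also have "\<dots> \<le> exp (\<omega> * t) * (\<kappa> * K + \<kappa> * K / b)"
      using order_trans[OF int_le[OF rpg[of 0]] mult_left_mono[OF g0 \<kappa>(2)]]
      unfolding A_def by (intro mult_left_mono add_right_mono) auto
    also have "\<dots> = \<kappa> * (1 + 1 / b) * (K * exp (\<omega> * t))" by (simp add: algebra_simps)
    finally have "\<bar>A t\<bar> \<le> \<kappa> * (1 + 1 / b) * (K * exp (\<omega> * t))" .
    then have "\<bar>A t\<bar>\<^sup>2 \<le> (\<kappa> * (1 + 1 / b) * (K * exp (\<omega> * t)))\<^sup>2" by (intro power_mono) auto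
    then have At: "(A t)\<^sup>2 / V \<le> (\<kappa> * (1 + 1 / b))\<^sup>2 / V * (K * exp (\<omega> * t))\<^sup>2"
      using V by (simp add: power_mult_distrib divide_right_mono)
    have "?int (\<lambda>x. \<Sum>i\<in>UNIV. (pd i (g t) x)\<^sup>2) = (\<Sum>i\<in>UNIV. (ball_norm R (pd i (g t)))\<^sup>2)"
      by (simp add: integral_sum rp_integrable rp_intros rp_pd rpg ball_norm_power2 cont_ext_rp)
    also have "\<dots> \<le> (\<Sum>i\<in>(UNIV :: 'n set). (K * exp (\<omega> * t))\<^sup>2)"
      by (intro sum_mono power_mono dg t ball_norm_nonneg cont_ext_rp rp_pd rpg)
    also have "\<dots> = real CARD('n) * (K * exp (\<omega> * t))\<^sup>2" by simp
    finally have "2 * (R\<^sup>2 * 2 ^ CARD('n)) * ?int (\<lambda>x. \<Sum>i\<in>UNIV. (pd i (g t) x)\<^sup>2)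
      \<le> 2 * (R\<^sup>2 * 2 ^ CARD('n)) * (real CARD('n) * (K * exp (\<omega> * t))\<^sup>2)" by (intro mult_left_mono) auto
    with At poincare(2)[OF rpg[of t] R, folded V_def A_def]
    have "(ball_norm R (g t))\<^sup>2 \<le> (\<kappa> * (1 + 1 / b))\<^sup>2 / V * (K * exp (\<omega> * t))\<^sup>2 +
        2 * (R\<^sup>2 * 2 ^ CARD('n)) * (real CARD('n) * (K * exp (\<omega> * t))\<^sup>2)"
      unfolding A_def by linarith
    also have "\<dots> = C * (K * exp (\<omega> * t))\<^sup>2"
      unfolding C_def by (simp only: distrib_right mult.assoc)
    also have "\<dots> = (sqrt C * K * exp (\<omega> * t))\<^sup>2" using C0 by (simp add: power_mult_distrib)
    finally show ?thesis by (rule power2_le_imp_le) (use C0 K in auto)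
  qed
  show ?thesis
  proof (rule exI[of _ "sqrt C"], rule conjI, goal_cases)
    case 1
    show ?case using C0 by simp
  next
    case 2
    show ?case
      by (intro allI impI)
        (rule main, assumption, blast, assumption, assumption, blast, blast, assumption, assumption)
  qed
qed

section \<open>Sobolev norms as sums over derivative words\<close>

lemma finite_words: "finite {al :: 'n::finite list. length al \<le> k}"
  using finite_lists_length_le[of "UNIV :: 'n set" k] by simp

lemma hk_sq_eq_ball_norm:
  assumes "\<And>al. cont_ext R (dpart al f)"
  shows "hk_sq k R f = (\<Sum>al | length al \<le> k. (ball_norm R (dpart al f))\<^sup>2)"
  unfolding hk_sq_def using ball_norm_power2[OF assms] by simp

lemma Nrm_power2:
  assumes "\<And>al. cont_ext R (dpart al (fst u))" "\<And>al. cont_ext R (dpart al (snd u))"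
  shows "(Nrm k R u)\<^sup>2 = (\<Sum>al | length al \<le> k. (ball_norm R (dpart al (fst u)))\<^sup>2) + (\<Sum>al | length al \<le> k - 1. (ball_norm R (dpart al (snd u)))\<^sup>2)"
    and "Nrm k R u \<ge> 0"
  unfolding Nrm_def by (simp_all add: hk_sq_eq_ball_norm assms sum_nonneg)

lemma ball_norm_le_Nrm:
  assumes "\<And>al. cont_ext R (dpart al (fst u))" "\<And>al. cont_ext R (dpart al (snd u))"
  shows "length al \<le> k \<Longrightarrow> ball_norm R (dpart al (fst u)) \<le> Nrm k R u"
    and "length al \<le> k - 1 \<Longrightarrow> ball_norm R (dpart al (snd u)) \<le> Nrm k R u"
proof -
  note N = Nrm_power2[where u=u and k=k, OF assms]
  have s: "0 \<le> (\<Sum>al | length al \<le> k. (ball_norm R (dpart al (fst u)))\<^sup>2)"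
    "0 \<le> (\<Sum>al | length al \<le> k - 1. (ball_norm R (dpart al (snd u)))\<^sup>2)" by (intro sum_nonneg; simp)+
  { assume "length al \<le> k"
    then have "(ball_norm R (dpart al (fst u)))\<^sup>2 \<le> (\<Sum>al | length al \<le> k. (ball_norm R (dpart al (fst u)))\<^sup>2)"
      by (intro member_le_sum[of al _ "\<lambda>al. (ball_norm R (dpart al (fst u)))\<^sup>2"] finite_words) auto
    then have "(ball_norm R (dpart al (fst u)))\<^sup>2 \<le> (Nrm k R u)\<^sup>2" using s N by linarith
    then show "ball_norm R (dpart al (fst u)) \<le> Nrm k R u" using N(2) by (rule power2_le_imp_le) }
  { assume "length al \<le> k - 1"
    then have "(ball_norm R (dpart al (snd u)))\<^sup>2 \<le> (\<Sum>al | length al \<le> k - 1. (ball_norm R (dpart al (snd u)))\<^sup>2)"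
      by (intro member_le_sum[of al _ "\<lambda>al. (ball_norm R (dpart al (snd u)))\<^sup>2"] finite_words) auto
    then have "(ball_norm R (dpart al (snd u)))\<^sup>2 \<le> (Nrm k R u)\<^sup>2" using s N by linarith
    then show "ball_norm R (dpart al (snd u)) \<le> Nrm k R u" using N(2) by (rule power2_le_imp_le) }
qed

lemma Nrm_le:
  fixes u :: "('n::finite) rpair"
  assumes "\<And>al. cont_ext R (dpart al (fst u))" "\<And>al. cont_ext R (dpart al (snd u))" and "0 \<le> B"
    and "\<And>al. length al \<le> k \<Longrightarrow> ball_norm R (dpart al (fst u)) \<le> B"
    and "\<And>al. length al \<le> k - 1 \<Longrightarrow> ball_norm R (dpart al (snd u)) \<le> B"
  shows "Nrm k R u \<le> sqrt (2 * real (card {al :: 'n list. length al \<le> k})) * B"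
proof (rule power2_le_imp_le)
  let ?c = "\<lambda>k. real (card {al :: 'n list. length al \<le> k})"
  have "(\<Sum>al | length al \<le> k. (ball_norm R (dpart al (fst u)))\<^sup>2) \<le> (\<Sum>al :: 'n list | length al \<le> k. B\<^sup>2)"
    by (intro sum_mono power_mono assms ball_norm_nonneg) auto
  moreover have "(\<Sum>al | length al \<le> k - 1. (ball_norm R (dpart al (snd u)))\<^sup>2) \<le> (\<Sum>al :: 'n list | length al \<le> k - 1. B\<^sup>2)"
    by (intro sum_mono power_mono assms ball_norm_nonneg) auto
  moreover have "(\<Sum>al :: 'n list | length al \<le> k - 1. B\<^sup>2) \<le> (\<Sum>al :: 'n list | length al \<le> k. B\<^sup>2)"
    by (intro sum_mono2 finite_words) auto
  ultimately have "(Nrm k R u)\<^sup>2 \<le> 2 * ?c k * B\<^sup>2"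
    using Nrm_power2(1)[where u=u and k=k, OF assms(1,2)] by simp
  also have "\<dots> = (sqrt (2 * ?c k) * B)\<^sup>2" by (simp add: power_mult_distrib)
  finally show "(Nrm k R u)\<^sup>2 \<le> (sqrt (2 * ?c k) * B)\<^sup>2" .
qed (use assms(3) in auto)

text \<open>Level \<open>j\<close> combines derivatives of order k - j of the first component with
  those of order k - j - 1 of the second. The energy settles j = 0. In the induction step each
  derivative obeys a transport equation whose gradient and source are already bounded at the
  preceding level; the source is a derivative of \<open>v2\<close> for the first component and the
  Laplacian of a derivative of \<open>v1\<close> for the second. The form
  \<open>Suc (length al) = k - j\<close> makes the second condition empty at j = k.\<close>

lemma wave_sol_level_bound:
  fixes R \<omega> s :: real
  assumes R: "R \<ge> 1" and k: "k \<ge> 1" and \<omega>: "real CARD('n) / 2 - real k - s \<le> \<omega>" "- s < \<omega>"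
  shows "j \<le> k \<Longrightarrow> \<exists>C\<ge>0. \<forall>(v1 :: real \<Rightarrow> ('n::finite) rfun) v2. wave_sol s v1 v2 \<longrightarrow> (\<forall>t\<ge>0.
    (\<forall>al. length al = k - j \<longrightarrow> ball_norm R (dpart al (v1 t)) \<le> C * Nrm k R (v1 0, v2 0) * exp (\<omega> * t)) \<and>
    (\<forall>al. Suc (length al) = k - j \<longrightarrow> ball_norm R (dpart al (v2 t)) \<le> C * Nrm k R (v1 0, v2 0) * exp (\<omega> * t)))"
proof (induction j)
  case 0
  \<comment> \<open>The initial energy of a word of length k - 1 consists of
    \<open>CARD('n) + 1\<close> squares, each at most the squared norm of the data.\<close>
  let ?C = "sqrt (real CARD('n) + 1)"
  have "(\<forall>al. length al = k \<longrightarrow> ball_norm R (dpart al (v1 t)) \<le> ?C * Nrm k R (v1 0, v2 0) * exp (\<omega> * t)) \<and>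
    (\<forall>al. Suc (length al) = k \<longrightarrow> ball_norm R (dpart al (v2 t)) \<le> ?C * Nrm k R (v1 0, v2 0) * exp (\<omega> * t))"
    if sol: "wave_sol s v1 v2" and t: "t \<ge> 0" for v1 v2 :: "real \<Rightarrow> 'n rfun" and t
  proof -
    define N0 where "N0 = Nrm k R (v1 0, v2 0)"
    have cbd: "cont_ext R (dpart al (v1 t))" "cont_ext R (dpart al (v2 t))" for al t
      by (intro cont_ext_rp rp_dpart wave_sol_rp[OF sol])+
    have N0: "N0 \<ge> 0" unfolding N0_def by (rule Nrm_power2(2)) (use cbd in auto)
    have E_eq: "integral (ball 0 R) (energy_density (dpart be (v1 t)) (dpart be (v2 t))) =
      (\<Sum>i\<in>UNIV. (ball_norm R (dpart (i # be) (v1 t)))\<^sup>2) + (ball_norm R (dpart be (v2 t)))\<^sup>2" for be t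
      unfolding energy_density_def ball_norm_power2[OF cbd(1)] ball_norm_power2[OF cbd(2)]
      by (simp add: integral_add integral_sum rp_integrable rp_intros rp_pd rp_dpart wave_sol_rp[OF sol])
    have key: "(\<Sum>i\<in>UNIV. (ball_norm R (dpart (i # be) (v1 t)))\<^sup>2) + (ball_norm R (dpart be (v2 t)))\<^sup>2 \<le> (?C * N0 * exp (\<omega> * t))\<^sup>2"
      if be: "Suc (length be) = k" for be
    proof -
      have "(\<Sum>i\<in>UNIV. (ball_norm R (dpart (i # be) (v1 0)))\<^sup>2) \<le> (\<Sum>i\<in>(UNIV :: 'n set). N0\<^sup>2)"
      proof (intro sum_mono power_mono ball_norm_nonneg cbd)
        show "ball_norm R (dpart (i # be) (v1 0)) \<le> N0" for i
          unfolding N0_def using be cbd ball_norm_le_Nrm(1)[of R "(v1 0, v2 0)" "i # be" k]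
          by (simp del: dpart.simps)
      qed
      moreover have "(ball_norm R (dpart be (v2 0)))\<^sup>2 \<le> N0\<^sup>2"
        unfolding N0_def using be cbd ball_norm_le_Nrm(2)[of R "(v1 0, v2 0)" be k]
        by (intro power_mono ball_norm_nonneg) auto
      ultimately have E0: "integral (ball 0 R) (energy_density (dpart be (v1 0)) (dpart be (v2 0))) \<le> (real CARD('n) + 1) * N0\<^sup>2"
        unfolding E_eq by (simp add: algebra_simps)
      have lk: "real (length be) = real k - 1" using be by auto
      have "integral (ball 0 R) (energy_density (dpart be (v1 t)) (dpart be (v2 t))) \<le>
        exp ((real CARD('n) - 2 - 2 * (s + length be)) * t) * integral (ball 0 R) (energy_density (dpart be (v1 0)) (dpart be (v2 0)))"
        by (rule energy_decay[OF R wave_sol_dpart[OF sol] t])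
      also have "\<dots> \<le> exp (2 * \<omega> * t) * ((real CARD('n) + 1) * N0\<^sup>2)"
      proof (intro mult_mono E0)
        have "(real CARD('n) - 2 - 2 * (s + length be)) * t \<le> 2 * \<omega> * t"
          using \<omega>(1) lk t by (intro mult_right_mono) auto
        then show "exp ((real CARD('n) - 2 - 2 * (s + length be)) * t) \<le> exp (2 * \<omega> * t)" by simp
        show "0 \<le> integral (ball 0 R) (energy_density (dpart be (v1 0)) (dpart be (v2 0)))"
          unfolding E_eq by (intro add_nonneg_nonneg sum_nonneg) auto
      qed auto
      also have "\<dots> = (?C * N0 * exp (\<omega> * t))\<^sup>2"
        by (simp add: power_mult_distrib exp_double[symmetric] mult_ac)
      finally show ?thesis unfolding E_eq .
    qed
    have nn: "0 \<le> ?C * N0 * exp (\<omega> * t)" using N0 by simp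
    show ?thesis unfolding N0_def[symmetric]
    proof (intro conjI allI impI)
      fix al :: "'n list" assume al: "length al = k"
      then obtain i be where ib: "al = i # be" using k by (cases al) auto
      have "(ball_norm R (dpart (i # be) (v1 t)))\<^sup>2 \<le> (\<Sum>i\<in>UNIV. (ball_norm R (dpart (i # be) (v1 t)))\<^sup>2)"
        by (rule member_le_sum[of i UNIV "\<lambda>i. (ball_norm R (dpart (i # be) (v1 t)))\<^sup>2"]) auto
      with key[of be] al ib have "(ball_norm R (dpart al (v1 t)))\<^sup>2 \<le> (?C * N0 * exp (\<omega> * t))\<^sup>2"
        using zero_le_power2[of "ball_norm R (dpart be (v2 t))"] by (simp only: length_Cons) linarith
      then show "ball_norm R (dpart al (v1 t)) \<le> ?C * N0 * exp (\<omega> * t)" using nn by (rule power2_le_imp_le)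
    next
      fix be :: "'n list" assume be: "Suc (length be) = k"
      have "0 \<le> (\<Sum>i\<in>UNIV. (ball_norm R (dpart (i # be) (v1 t)))\<^sup>2)" by (intro sum_nonneg) auto
      with key[OF be] have "(ball_norm R (dpart be (v2 t)))\<^sup>2 \<le> (?C * N0 * exp (\<omega> * t))\<^sup>2" by linarith
      then show "ball_norm R (dpart be (v2 t)) \<le> ?C * N0 * exp (\<omega> * t)" using nn by (rule power2_le_imp_le)
    qed
  qed
  then show ?case by (intro exI[of _ ?C]) auto
next
  case (Suc j)
  then have jk: "j \<le> k" and lj: "Suc (k - Suc j) = k - j" by simp_all
  from Suc.IH[OF jk] obtain C where C: "C \<ge> 0" and
    CC: "\<forall>(v1 :: real \<Rightarrow> 'n rfun) v2. wave_sol s v1 v2 \<longrightarrow> (\<forall>t\<ge>0.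
      (\<forall>al. length al = k - j \<longrightarrow> ball_norm R (dpart al (v1 t)) \<le> C * Nrm k R (v1 0, v2 0) * exp (\<omega> * t)) \<and>
      (\<forall>al. Suc (length al) = k - j \<longrightarrow> ball_norm R (dpart al (v2 t)) \<le> C * Nrm k R (v1 0, v2 0) * exp (\<omega> * t)))"
    by (elim exE conjE)
  have C1: "ball_norm R (dpart al (v1 t)) \<le> C * Nrm k R (v1 0, v2 0) * exp (\<omega> * t)"
    if "wave_sol s v1 v2" "t \<ge> 0" "length al = k - j" for v1 v2 :: "real \<Rightarrow> 'n rfun" and t al
    using CC[rule_format, OF that(1,2), THEN conjunct1, rule_format, OF that(3)] .
  have C2: "ball_norm R (dpart al (v2 t)) \<le> C * Nrm k R (v1 0, v2 0) * exp (\<omega> * t)"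
    if "wave_sol s v1 v2" "t \<ge> 0" "Suc (length al) = k - j" for v1 v2 :: "real \<Rightarrow> 'n rfun" and t al
    using CC[rule_format, OF that(1,2), THEN conjunct2, rule_format, OF that(3)] .
  \<comment> \<open>For the first component at order zero the damping is exactly \<open>s\<close>,
    so this is the smallest gap that occurs. It is positive because \<open>- s < \<omega>\<close> is
    strict.\<close>
  define b where "b = \<omega> + s"
  have b: "b > 0" using \<omega> by (simp add: b_def)
  have "R > 0" using R by simp
  from ball_norm_le_of_pd_le[where 'n='n, OF this b] obtain D where D: "D \<ge> 0" and
    DD: "\<forall>(g :: real \<Rightarrow> 'n rfun) r a \<omega> K.
    poly_curve g (\<lambda>t x. - a * g t x - (\<Sum>i\<in>UNIV. x $ i * pd i (g t) x) + r t x) \<longrightarrow> (\<forall>t. rp (r t)) \<longrightarrow>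
    b \<le> a + \<omega> \<longrightarrow> 0 \<le> K \<longrightarrow> (\<forall>t\<ge>0. \<forall>i. ball_norm R (pd i (g t)) \<le> K * exp (\<omega> * t)) \<longrightarrow>
    (\<forall>t\<ge>0. ball_norm R (r t) \<le> K * exp (\<omega> * t)) \<longrightarrow> ball_norm R (g 0) \<le> K \<longrightarrow>
    (\<forall>t\<ge>0. ball_norm R (g t) \<le> D * K * exp (\<omega> * t))" by (elim exE conjE)
  note D1 = DD[rule_format]
  \<comment> \<open>One factor for all three hypotheses: \<open>C\<close> for gradients,
    \<open>CARD('n)\<close> times \<open>C\<close> for the Laplacian as a sum of second derivatives,
    and 1 for the initial value.\<close>
  define B where "B = real CARD('n) * C + 1"
  have B: "B \<ge> 1" "B \<ge> C" "B \<ge> real CARD('n) * C" "B \<ge> 0"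
  proof -
    have "1 * C \<le> real CARD('n) * C" using C by (intro mult_right_mono) (auto simp: Suc_leI)
    then show "B \<ge> 1" "B \<ge> C" "B \<ge> real CARD('n) * C" "B \<ge> 0" using C by (auto simp: B_def)
  qed
  have "(\<forall>al. length al = k - Suc j \<longrightarrow> ball_norm R (dpart al (v1 t)) \<le> (D * B) * Nrm k R (v1 0, v2 0) * exp (\<omega> * t)) \<and>
    (\<forall>al. Suc (length al) = k - Suc j \<longrightarrow> ball_norm R (dpart al (v2 t)) \<le> (D * B) * Nrm k R (v1 0, v2 0) * exp (\<omega> * t))"
    if sol: "wave_sol s v1 v2" and t: "t \<ge> 0" for v1 v2 :: "real \<Rightarrow> 'n rfun" and t
  proof -
    define N0 where "N0 = Nrm k R (v1 0, v2 0)"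
    have rpd: "rp (dpart al (v1 t))" "rp (dpart al (v2 t))" for al t
      by (intro rp_dpart wave_sol_rp[OF sol])+
    note cbd = rpd[THEN cont_ext_rp]
    have N0: "N0 \<ge> 0" unfolding N0_def by (rule Nrm_power2(2)) (use cbd in auto)
    have scale: "q * N0 * exp (\<omega> * t) \<le> B * N0 * exp (\<omega> * t)" if "q \<le> B" for q t
      using that N0 by (intro mult_right_mono) auto
    have N0B: "N0 \<le> B * N0" using mult_right_mono[OF B(1) N0] by simp
    have p: "poly_curve (\<lambda>t. dpart al (v1 t)) (\<lambda>t. L1 (s + length al) (dpart al (v1 t)) (dpart al (v2 t)))"
      "poly_curve (\<lambda>t. dpart al (v2 t)) (\<lambda>t. L2 (s + length al) (dpart al (v1 t)) (dpart al (v2 t)))" for al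
      using wave_sol_dpart[OF sol, of al] unfolding wave_sol_def by auto
    show ?thesis unfolding N0_def[symmetric]
    proof (intro conjI allI impI)
      fix al :: "'n list" assume al: "length al = k - Suc j"
      have "ball_norm R (dpart al (v1 t)) \<le> D * (B * N0) * exp (\<omega> * t)"
      proof (rule D1[of "\<lambda>t. dpart al (v1 t)" "s + length al" "\<lambda>t. dpart al (v2 t)"])
        show "b \<le> s + real (length al) + \<omega>" by (simp add: b_def)
        show "ball_norm R (pd i (dpart al (v1 t))) \<le> B * N0 * exp (\<omega> * t)" if "0 \<le> t" for t i
          using C1[OF sol that, of "i # al"] al Suc.prems lj scale[OF B(2), of t] unfolding N0_def by simp
        show "ball_norm R (dpart al (v2 t)) \<le> B * N0 * exp (\<omega> * t)" if "0 \<le> t" for t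
          using C2[OF sol that, of al] al Suc.prems lj scale[OF B(2), of t] unfolding N0_def by simp
        show "ball_norm R (dpart al (v1 0)) \<le> B * N0"
          using ball_norm_le_Nrm(1)[of R "(v1 0, v2 0)" al k] cbd al N0B unfolding N0_def by simp
      qed (use p(1)[of al, unfolded L1_def] rpd t B N0 in auto)
      then show "ball_norm R (dpart al (v1 t)) \<le> (D * B) * N0 * exp (\<omega> * t)" by (simp add: mult_ac)
    next
      fix al :: "'n list" assume al: "Suc (length al) = k - Suc j"
      let ?lap = "\<lambda>t x. \<Sum>i\<in>UNIV. pd i (pd i (dpart al (v1 t))) x"
      have "ball_norm R (dpart al (v2 t)) \<le> D * (B * N0) * exp (\<omega> * t)"
      proof (rule D1[of "\<lambda>t. dpart al (v2 t)" "s + length al + 1" ?lap])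
        show "poly_curve (\<lambda>t. dpart al (v2 t)) (\<lambda>t x. - (s + length al + 1) * dpart al (v2 t) x
           - (\<Sum>i\<in>UNIV. x $ i * pd i (dpart al (v2 t)) x) + ?lap t x)"
          by (rule poly_curve_cong[OF p(2)[of al]]) (auto simp: L2_def algebra_simps)
        show "rp (?lap t)" for t by (intro rp_Laplace rpd)
        show "b \<le> s + real (length al) + 1 + \<omega>" by (simp add: b_def)
        show "ball_norm R (pd i (dpart al (v2 t))) \<le> B * N0 * exp (\<omega> * t)" if "0 \<le> t" for t i
          using C2[OF sol that, of "i # al"] al Suc.prems lj scale[OF B(2), of t] unfolding N0_def by simp
        show "ball_norm R (?lap t) \<le> B * N0 * exp (\<omega> * t)" if "0 \<le> t" for t
        proof -
          have "ball_norm R (?lap t) \<le> (\<Sum>i\<in>UNIV. ball_norm R (pd i (pd i (dpart al (v1 t)))))"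
            by (intro conjunct1[OF ball_norm_sum] cont_ext_rp rp_pd rpd) auto
          also have "\<dots> \<le> (\<Sum>i\<in>(UNIV :: 'n set). C * N0 * exp (\<omega> * t))"
          proof (rule sum_mono)
            fix i
            show "ball_norm R (pd i (pd i (dpart al (v1 t)))) \<le> C * N0 * exp (\<omega> * t)"
              using C1[OF sol that, of "i # i # al"] al Suc.prems lj unfolding N0_def by simp
          qed
          also have "\<dots> = (real CARD('n) * C) * N0 * exp (\<omega> * t)" by simp
          also have "\<dots> \<le> B * N0 * exp (\<omega> * t)" by (rule scale[OF B(3)])
          finally show ?thesis .
        qed
        have "length al \<le> k - 1" using al by simp
        from ball_norm_le_Nrm(2)[of R "(v1 0, v2 0)", OF _ _ this] cbd N0B
        show "ball_norm R (dpart al (v2 0)) \<le> B * N0" unfolding N0_def by simp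
      qed (use t B N0 in auto)
      then show "ball_norm R (dpart al (v2 t)) \<le> (D * B) * N0 * exp (\<omega> * t)" by (simp add: mult_ac)
    qed
  qed
  then show ?case using D B by (intro exI[of _ "D * B"]) auto
qed

theorem wave_sol_growth:
  fixes R \<omega> s :: real
  assumes R: "R \<ge> 1" and k: "k \<ge> 1" and \<omega>: "real CARD('n) / 2 - real k - s \<le> \<omega>" "- s < \<omega>"
  shows "\<exists>M\<ge>1. \<forall>(v1 :: real \<Rightarrow> ('n::finite) rfun) v2. wave_sol s v1 v2 \<longrightarrow> (\<forall>t\<ge>0.
    Nrm k R (v1 t, v2 t) \<le> M * exp (\<omega> * t) * Nrm k R (v1 0, v2 0))"
proof -
  define P where "P = (\<lambda>j C. C \<ge> 0 \<and> (\<forall>(v1 :: real \<Rightarrow> 'n rfun) v2. wave_sol s v1 v2 \<longrightarrow> (\<forall>t\<ge>0.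
    (\<forall>al. length al = k - j \<longrightarrow> ball_norm R (dpart al (v1 t)) \<le> C * Nrm k R (v1 0, v2 0) * exp (\<omega> * t)) \<and>
    (\<forall>al. Suc (length al) = k - j \<longrightarrow> ball_norm R (dpart al (v2 t)) \<le> C * Nrm k R (v1 0, v2 0) * exp (\<omega> * t)))))"
  have "\<forall>j\<in>{..k}. \<exists>C. P j C"
    unfolding P_def using wave_sol_level_bound[where 'n='n, OF assms] by auto
  then obtain C where P: "\<And>j. j \<le> k \<Longrightarrow> P j (C j)" using bchoice[of "{..k}" P] by auto
  have C: "C j \<ge> 0" if "j \<le> k" for j using P[OF that] by (simp add: P_def)
  have C1: "ball_norm R (dpart al (v1 t)) \<le> C j * Nrm k R (v1 0, v2 0) * exp (\<omega> * t)"
    if "j \<le> k" "wave_sol s v1 v2" "t \<ge> 0" "length al = k - j" for j al t and v1 v2 :: "real \<Rightarrow> 'n rfun"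
    using P[OF that(1), unfolded P_def, THEN conjunct2, rule_format, OF that(2,3), THEN conjunct1, rule_format, OF that(4)] .
  have C2: "ball_norm R (dpart al (v2 t)) \<le> C j * Nrm k R (v1 0, v2 0) * exp (\<omega> * t)"
    if "j \<le> k" "wave_sol s v1 v2" "t \<ge> 0" "Suc (length al) = k - j" for j al t and v1 v2 :: "real \<Rightarrow> 'n rfun"
    using P[OF that(1), unfolded P_def, THEN conjunct2, rule_format, OF that(2,3), THEN conjunct2, rule_format, OF that(4)] .
  define D where "D = (\<Sum>j\<le>k. C j)"
  have D: "C j \<le> D" if "j \<le> k" for j
    unfolding D_def using that C by (intro member_le_sum) auto
  have D0: "D \<ge> 0" unfolding D_def using C by (intro sum_nonneg) auto
  \<comment> \<open>A word of length l is covered by level k - l in the first component and by level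
    k - l - 1 in the second, and \<open>D\<close> dominates the constants of all levels. The added 1
    secures \<open>M \<ge> 1\<close>.\<close>
  define M where "M = sqrt (2 * real (card {al :: 'n list. length al \<le> k})) * D + 1"
  have "Nrm k R (v1 t, v2 t) \<le> M * exp (\<omega> * t) * Nrm k R (v1 0, v2 0)"
    if sol: "wave_sol s v1 v2" and t: "t \<ge> 0" for v1 v2 :: "real \<Rightarrow> 'n rfun" and t
  proof -
    define N0 where "N0 = Nrm k R (v1 0, v2 0)"
    have cbd: "cont_ext R (dpart al (v1 t))" "cont_ext R (dpart al (v2 t))" for al t
      by (intro cont_ext_rp rp_dpart wave_sol_rp[OF sol])+
    have N0: "N0 \<ge> 0" unfolding N0_def by (rule Nrm_power2(2)) (use cbd in auto)
    have scale: "C j * N0 * exp (\<omega> * t) \<le> D * N0 * exp (\<omega> * t)" if "j \<le> k" for j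
      using D[OF that] N0 by (intro mult_right_mono) auto
    have "Nrm k R (v1 t, v2 t) \<le> sqrt (2 * real (card {al :: 'n list. length al \<le> k})) * (D * N0 * exp (\<omega> * t))"
    proof (rule Nrm_le)
      fix al :: "'n list" assume al: "length al \<le> k"
      have "ball_norm R (dpart al (v1 t)) \<le> C (k - length al) * N0 * exp (\<omega> * t)"
        unfolding N0_def by (rule C1[OF _ sol t]) (use al in auto)
      also have "\<dots> \<le> D * N0 * exp (\<omega> * t)" by (rule scale) auto
      finally show "ball_norm R (dpart al (fst (v1 t, v2 t))) \<le> D * N0 * exp (\<omega> * t)" by simp
    next
      fix al :: "'n list" assume al: "length al \<le> k - 1"
      have "ball_norm R (dpart al (v2 t)) \<le> C (k - Suc (length al)) * N0 * exp (\<omega> * t)"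
        unfolding N0_def by (rule C2[OF _ sol t]) (use al k in auto)
      also have "\<dots> \<le> D * N0 * exp (\<omega> * t)" by (rule scale) auto
      finally show "ball_norm R (dpart al (snd (v1 t, v2 t))) \<le> D * N0 * exp (\<omega> * t)" by simp
    qed (use cbd D0 N0 in auto)
    also have "\<dots> = (M - 1) * (exp (\<omega> * t) * N0)" by (simp add: M_def)
    also have "\<dots> \<le> M * (exp (\<omega> * t) * N0)" using N0 by (intro mult_right_mono) auto
    finally show ?thesis by (simp add: N0_def mult.assoc)
  qed
  moreover have "M \<ge> 1" unfolding M_def using D0 by simp
  ultimately show ?thesis by blast
qed

section \<open>Solutions with polynomial data\<close>

text \<open>The zero function has every degree. This makes each class a linear space and lets a pair
  with one vanishing component be graded.\<close>

inductive hom_poly :: "nat \<Rightarrow> ('n::finite) rfun \<Rightarrow> bool" where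
  hom_poly_const: "hom_poly 0 (\<lambda>x. c)"
| hom_poly_coord: "hom_poly n f \<Longrightarrow> hom_poly (Suc n) (\<lambda>x. x $ i * f x)"
| hom_poly_add: "hom_poly n f \<Longrightarrow> hom_poly n g \<Longrightarrow> hom_poly n (\<lambda>x. f x + g x)"

lemma hom_poly_rp: "hom_poly n f \<Longrightarrow> rp f"
  by (induction rule: hom_poly.induct) (auto intro: rp_intros)

lemma hom_poly_cong: "hom_poly n f \<Longrightarrow> (\<And>x. f x = g x) \<Longrightarrow> hom_poly n g"
  by (metis ext)

lemma hom_poly_zero: "hom_poly n (\<lambda>x. 0)"
proof (induction n)
  case (Suc n)
  show ?case by (rule hom_poly_cong[OF hom_poly_coord[OF Suc]]) simp
qed (rule hom_poly_const)

lemma hom_poly_cmult: "hom_poly n f \<Longrightarrow> hom_poly n (\<lambda>x. c * f x)"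
proof (induction rule: hom_poly.induct)
  case (hom_poly_coord n f i)
  show ?case by (rule hom_poly_cong[OF hom_poly.hom_poly_coord[OF hom_poly_coord.IH, of i]]) simp
next
  case (hom_poly_add n f g)
  show ?case by (rule hom_poly_cong[OF hom_poly.hom_poly_add[OF hom_poly_add.IH]]) (simp add: distrib_left)
qed (rule hom_poly_const)

lemma hom_poly_mult: "hom_poly m f \<Longrightarrow> hom_poly n g \<Longrightarrow> hom_poly (m + n) (\<lambda>x. f x * g x)"
proof (induction rule: hom_poly.induct)
  case (hom_poly_const c)
  then show ?case using hom_poly_cmult by simp
next
  case (hom_poly_coord m f i)
  show ?case
    by (simp, rule hom_poly_cong[OF hom_poly.hom_poly_coord[OF hom_poly_coord.IH[OF hom_poly_coord.prems], of i]]) simp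
next
  case (hom_poly_add m f h)
  show ?case
    by (rule hom_poly_cong[OF hom_poly.hom_poly_add[OF hom_poly_add.IH[OF hom_poly_add.prems]]]) (simp add: distrib_right)
qed

text \<open>A constant has no degree to lose, so its derivative is recorded separately as zero
  rather than through truncated subtraction.\<close>

lemma hom_poly_pd: "hom_poly n f \<Longrightarrow> (n = 0 \<longrightarrow> pd i f = (\<lambda>x. 0)) \<and> (\<forall>m. n = Suc m \<longrightarrow> hom_poly m (pd i f))"
proof (induction rule: hom_poly.induct)
  case (hom_poly_const c)
  then show ?case by (simp add: pd_const)
next
  case (hom_poly_coord n f l)
  have eq: "pd i (\<lambda>x. x $ l * f x) = (\<lambda>x. (if i = l then 1 else 0) * f x + x $ l * pd i f x)"
    by (simp add: pd_mult rp_coord hom_poly_rp[OF hom_poly_coord.hyps] pd_coord)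
  have "hom_poly n (\<lambda>x. x $ l * pd i f x)"
  proof (cases n)
    case 0
    then show ?thesis using hom_poly_coord.IH hom_poly_zero by simp
  next
    case (Suc m)
    then show ?thesis using hom_poly_coord.IH hom_poly.hom_poly_coord by blast
  qed
  then show ?case unfolding eq using hom_poly_add hom_poly_cmult[OF hom_poly_coord.hyps] by blast
next
  case (hom_poly_add n f g)
  then show ?case by (auto simp: pd_add hom_poly_rp intro: hom_poly.hom_poly_add)
qed

text \<open>By Euler's identity the radial derivative is a scalar on each degree, which makes the
  operator diagonal up to a nilpotent part.\<close>

lemma hom_poly_euler: "hom_poly n f \<Longrightarrow> (\<Sum>i\<in>UNIV. x $ i * pd i f x) = real n * f x"
proof (induction rule: hom_poly.induct)
  case (hom_poly_const c)
  then show ?case by (simp add: pd_const)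
next
  case (hom_poly_coord n f l)
  have "(\<Sum>i\<in>UNIV. x $ i * pd i (\<lambda>x. x $ l * f x) x) =
    (\<Sum>i\<in>UNIV. (if i = l then x $ i * f x else 0) + x $ l * (x $ i * pd i f x))"
    by (intro sum.cong) (auto simp: pd_mult rp_coord hom_poly_rp[OF hom_poly_coord.hyps] pd_coord algebra_simps)
  also have "\<dots> = x $ l * f x + x $ l * (\<Sum>i\<in>UNIV. x $ i * pd i f x)"
    by (simp add: sum.distrib sum_distrib_left)
  finally show ?case by (simp add: hom_poly_coord.IH algebra_simps)
next
  case (hom_poly_add n f g)
  then show ?case by (simp add: pd_add hom_poly_rp distrib_left sum.distrib)
qed

text \<open>Only the existence of a decomposition into homogeneous parts is kept; superposition of
  solutions asks for no more.\<close>

inductive hom_sum :: "('n::finite) rfun \<Rightarrow> bool" where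
  hom_sum_hom_poly: "hom_poly n f \<Longrightarrow> hom_sum f"
| hom_sum_add: "hom_sum f \<Longrightarrow> hom_sum g \<Longrightarrow> hom_sum (\<lambda>x. f x + g x)"

lemma hom_sum_cong: assumes "hom_sum f" "\<And>x. f x = g x" shows "hom_sum g"
proof -
  have "f = g" using assms(2) by (rule ext)
  with assms(1) show ?thesis by simp
qed

lemma hom_sum_mult:
  assumes "hom_sum f" "hom_sum g" shows "hom_sum (\<lambda>x. f x * g x)"
  using assms
proof (induction rule: hom_sum.induct)
  case (hom_sum_hom_poly m f)
  note f = hom_sum_hom_poly(1)
  from hom_sum_hom_poly(2) show ?case
  proof (induction rule: hom_sum.induct)
    case (hom_sum_hom_poly n g)
    show ?case by (rule hom_sum.hom_sum_hom_poly[OF hom_poly_mult[OF f hom_sum_hom_poly]])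
  next
    case (hom_sum_add g h)
    show ?case by (rule hom_sum_cong[OF hom_sum.hom_sum_add[OF hom_sum_add.IH]]) (simp add: distrib_left)
  qed
next
  case (hom_sum_add f h)
  show ?case by (rule hom_sum_cong[OF hom_sum.hom_sum_add[OF hom_sum_add.IH[OF hom_sum_add.prems]]]) (simp add: distrib_right)
qed

lemma hom_poly_linear: assumes "bounded_linear f" shows "hom_poly 1 f"
proof -
  have "hom_poly 1 (\<lambda>x. \<Sum>i\<in>A. x $ i * f (axis i 1))" if "finite A" for A
    using that
  proof (induction A)
    case (insert i A)
    have "hom_poly 1 (\<lambda>x. x $ i * f (axis i 1))"
      unfolding One_nat_def by (rule hom_poly_coord[OF hom_poly_const])
    from hom_poly_add[OF this insert.IH] show ?case using insert.hyps by simp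
  qed (simp add: hom_poly_zero)
  then show ?thesis
    by (rule hom_poly_cong[of 1 "\<lambda>x. \<Sum>i\<in>UNIV. x $ i * f (axis i 1)"])
      (simp_all only: finite bounded_linear_expand[OF assms, symmetric])
qed

lemma rp_hom_sum: assumes "rp f" shows "hom_sum f"
  using assms
proof (induction f)
  case (linear f)
  then show ?case by (rule hom_sum_hom_poly[OF hom_poly_linear])
next
  case (const c)
  show ?case by (rule hom_sum_hom_poly[OF hom_poly_const])
next
  case (add f g)
  show ?case by (rule hom_sum_add[OF add.IH])
next
  case (mult f g)
  show ?case by (rule hom_sum_mult[OF mult.IH])
qed

section \<open>Superposition and time shifts of solutions\<close>

lemma L1_add: "rp f \<Longrightarrow> rp f' \<Longrightarrow> L1 s (\<lambda>x. f x + f' x) (\<lambda>x. g x + g' x) = (\<lambda>x. L1 s f g x + L1 s f' g' x)"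
  by (auto simp: L1_def pd_add algebra_simps sum.distrib)

lemma L2_add: "rp f \<Longrightarrow> rp f' \<Longrightarrow> rp g \<Longrightarrow> rp g' \<Longrightarrow>
    L2 s (\<lambda>x. f x + f' x) (\<lambda>x. g x + g' x) = (\<lambda>x. L2 s f g x + L2 s f' g' x)"
  by (auto simp: L2_def pd_add rp_pd algebra_simps sum.distrib)

lemma L1_cmult: "rp f \<Longrightarrow> L1 s (\<lambda>x. c * f x) (\<lambda>x. c * g x) = (\<lambda>x. c * L1 s f g x)"
  by (auto simp: L1_def pd_cmult algebra_simps sum_distrib_left)

lemma L2_cmult: "rp f \<Longrightarrow> rp g \<Longrightarrow> L2 s (\<lambda>x. c * f x) (\<lambda>x. c * g x) = (\<lambda>x. c * L2 s f g x)"
  by (auto simp: L2_def pd_cmult rp_pd algebra_simps sum_distrib_left)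

lemma wave_sol_add:
  assumes "wave_sol s v1 v2" "wave_sol s u1 u2"
  shows "wave_sol s (\<lambda>t x. v1 t x + u1 t x) (\<lambda>t x. v2 t x + u2 t x)"
  using assms wave_sol_rp[OF assms(1)] wave_sol_rp[OF assms(2)] unfolding wave_sol_def
  by (auto simp: L1_add L2_add intro: poly_curve_add)

lemma wave_sol_cmult:
  assumes "wave_sol s v1 v2"
  shows "wave_sol s (\<lambda>t x. c * v1 t x) (\<lambda>t x. c * v2 t x)"
  using assms wave_sol_rp[OF assms(1)] unfolding wave_sol_def
  by (auto simp: L1_cmult L2_cmult intro: poly_curve_cmult)

lemma wave_sol_shift:
  "wave_sol s v1 v2 \<Longrightarrow> wave_sol s (\<lambda>t. v1 (t + r)) (\<lambda>t. v2 (t + r))"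
  unfolding wave_sol_def
  using poly_curve_shift[of v1 "\<lambda>t. L1 s (v1 t) (v2 t)" r] poly_curve_shift[of v2 "\<lambda>t. L2 s (v1 t) (v2 t)" r]
  by blast

text \<open>Grade pairs so that \<open>(f, g)\<close> has level \<open>j\<close> if \<open>f\<close> is homogeneous of degree \<open>j\<close> and \<open>g\<close> of degree
  \<open>j - 1\<close>. On level \<open>j\<close> the operator is \<open>-(s + j) + N\<close> with \<open>N (f, g) = (g, \<Delta> f)\<close> lowering the level
  by one, so the solution is a finite sum with coefficients
  \<open>exp (-(s + J) t) (exp t - 1)\<^sup>m / m!\<close> in front of the \<open>m\<close>-th power of \<open>N\<close>.\<close>

definition graded :: "nat \<Rightarrow> ('n::finite) rfun \<Rightarrow> 'n rfun \<Rightarrow> bool" where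
  "graded j f g \<longleftrightarrow> hom_poly j f \<and> (case j of 0 \<Rightarrow> g = (\<lambda>x. 0) | Suc i \<Rightarrow> hom_poly i g)"

lemma graded_rp: "graded j f g \<Longrightarrow> rp f" "graded j f g \<Longrightarrow> rp g"
  by (auto simp: graded_def hom_poly_rp rp_intros split: nat.splits)

lemma hom_poly_Laplace:
  assumes "hom_poly (Suc (Suc n)) f" shows "hom_poly n (\<lambda>x. \<Sum>i\<in>UNIV. pd i (pd i f) x)"
proof -
  have *: "hom_poly n (pd i (pd i f))" for i
    using hom_poly_pd[OF assms, of i] hom_poly_pd[of "Suc n" "pd i f" i] by blast
  have "hom_poly n (\<lambda>x. \<Sum>i\<in>A. pd i (pd i f) x)" if "finite A" for A
    using that by (induction A) (auto intro: hom_poly_zero hom_poly_add *)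
  then show ?thesis by simp
qed

lemma graded_zero_Laplace: "graded 0 f g \<Longrightarrow> (\<Sum>i\<in>UNIV. pd i (pd i f) x) = 0"
  using hom_poly_pd[of 0 f] by (auto simp: graded_def pd_const)

text \<open>The nilpotent part maps into the next lower level. From level one the Laplacian is zero,
  which is exactly what level zero demands of its second component.\<close>

lemma graded_step: assumes "graded (Suc j) f g" shows "graded j g (\<lambda>x. \<Sum>i\<in>UNIV. pd i (pd i f) x)"
proof (cases j)
  case 0
  have "hom_poly 0 (pd i f)" for i using hom_poly_pd[of "Suc 0" f i] assms 0 by (auto simp: graded_def)
  then have "pd i (pd i f) = (\<lambda>x. 0)" for i using hom_poly_pd by blast
  then show ?thesis using assms 0 by (simp add: graded_def)
next
  case (Suc i)
  then show ?thesis using assms hom_poly_Laplace[of i f] by (simp add: graded_def)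
qed

lemma graded_L:
  assumes "graded j f g"
  shows "L1 s f g x = - (s + j) * f x + g x"
    and "L2 s f g x = (\<Sum>i\<in>UNIV. pd i (pd i f) x) - (s + j) * g x"
proof -
  show "L1 s f g x = - (s + j) * f x + g x"
    using assms hom_poly_euler[of j f x] by (simp add: L1_def graded_def algebra_simps)
  show "L2 s f g x = (\<Sum>i\<in>UNIV. pd i (pd i f) x) - (s + j) * g x"
    using assms hom_poly_euler[of "j - 1" g x]
    by (cases j) (auto simp: L2_def graded_def pd_const algebra_simps)
qed

definition flow_coeff :: "real \<Rightarrow> nat \<Rightarrow> real \<Rightarrow> real" where
  "flow_coeff a m t = exp (- a * t) * (exp t - 1) ^ m / fact m"

text \<open>Writing exp t as (exp t - 1) + 1 in the derivative of the power splits it in two: one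
  part changes the rate from -a to m - a, the other is the preceding coefficient.\<close>

lemma flow_coeff_deriv:
  "(flow_coeff a m has_real_derivative (real m - a) * flow_coeff a m t + (if m = 0 then 0 else flow_coeff a (m - 1) t)) (at t)"
proof (cases m)
  case 0
  show ?thesis unfolding flow_coeff_def 0 by (auto intro!: derivative_eq_intros)
next
  case (Suc n)
  have "((\<lambda>t. exp (- a * t) * (exp t - 1) ^ Suc n / fact (Suc n)) has_real_derivative
     (- a * exp (- a * t) * (exp t - 1) ^ Suc n + exp (- a * t) * (real (Suc n) * (exp t - 1) ^ n * exp t)) / fact (Suc n)) (at t)"
    by (auto intro!: derivative_eq_intros simp del: power_Suc fact_Suc)
  moreover have "(- a * exp (- a * t) * (exp t - 1) ^ Suc n + exp (- a * t) * (real (Suc n) * (exp t - 1) ^ n * exp t)) / fact (Suc n)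
    = (real m - a) * flow_coeff a m t + (if m = 0 then 0 else flow_coeff a (m - 1) t)"
  proof -
    have f: "fact (Suc n) = real (Suc n) * fact n" "fact n \<noteq> (0 :: real)" "real (Suc n) \<noteq> 0" by simp_all
    have "exp (- a * t) * (real (Suc n) * (exp t - 1) ^ n * exp t) =
      real (Suc n) * (exp (- a * t) * (exp t - 1) ^ Suc n) + real (Suc n) * (exp (- a * t) * (exp t - 1) ^ n)"
      by (simp add: algebra_simps)
    then show ?thesis unfolding flow_coeff_def Suc using f by (simp add: field_simps del: fact_Suc of_nat_Suc)
  qed
  ultimately show ?thesis unfolding flow_coeff_def Suc by simp
qed

text \<open>The induction constructs the tail of the finite sum: (f, g) is to be read as the
  \<open>m\<close>-th image under the nilpotent part of data of level \<open>J\<close>. With j = J -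
  m the rate m - (s + J) of the coefficient is the diagonal entry -(s + j), so the tail solves the
  equation up to a source with coefficient number m - 1. The next longer tail cancels this source,
  and for m = 0 there is none.\<close>

lemma graded_curve:
  "graded j f g \<Longrightarrow> j + m = J \<Longrightarrow> \<exists>v1 v2.
    poly_curve v1 (\<lambda>t x. L1 s (v1 t) (v2 t) x + (if m = 0 then 0 else flow_coeff (s + J) (m - 1) t) * f x) \<and>
    poly_curve v2 (\<lambda>t x. L2 s (v1 t) (v2 t) x + (if m = 0 then 0 else flow_coeff (s + J) (m - 1) t) * g x) \<and>
    (\<forall>x. v1 0 x = flow_coeff (s + J) m 0 * f x) \<and> (\<forall>x. v2 0 x = flow_coeff (s + J) m 0 * g x)"
proof (induction j arbitrary: f g m)
  case 0
  note rp = graded_rp[OF 0(1)]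
  have g0: "g = (\<lambda>x. 0)" using 0(1) by (simp add: graded_def)
  show ?case
  proof (intro exI conjI allI)
    show "poly_curve (\<lambda>t x. flow_coeff (s + J) m t * f x) (\<lambda>t x. L1 s (\<lambda>x. flow_coeff (s + J) m t * f x) (\<lambda>x. flow_coeff (s + J) m t * g x) x +
      (if m = 0 then 0 else flow_coeff (s + J) (m - 1) t) * f x)"
      by (rule poly_curve_cong[OF poly_curve_term[OF rp(1) flow_coeff_deriv[of "s + J" m]]], simp,
          unfold L1_cmult[OF rp(1)] graded_L(1)[OF 0(1)], unfold g0, use 0(2) in \<open>simp add: algebra_simps\<close>)
    show "poly_curve (\<lambda>t x. flow_coeff (s + J) m t * g x) (\<lambda>t x. L2 s (\<lambda>x. flow_coeff (s + J) m t * f x) (\<lambda>x. flow_coeff (s + J) m t * g x) x +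
      (if m = 0 then 0 else flow_coeff (s + J) (m - 1) t) * g x)"
      by (rule poly_curve_cong[OF poly_curve_term[OF rp(2) flow_coeff_deriv[of "s + J" m]]], simp,
          unfold L2_cmult[OF rp] graded_L(2)[OF 0(1)] graded_zero_Laplace[OF 0(1)], unfold g0, simp)
  qed auto
next
  case (Suc j)
  note rp = graded_rp[OF Suc.prems(1)]
  let ?lap = "\<lambda>x. \<Sum>i\<in>UNIV. pd i (pd i f) x"
  have J: "real J = real j + 1 + real m" using Suc.prems(2) by auto
  obtain v1 v2 where v: "poly_curve v1 (\<lambda>t x. L1 s (v1 t) (v2 t) x + flow_coeff (s + J) m t * g x)"
     "poly_curve v2 (\<lambda>t x. L2 s (v1 t) (v2 t) x + flow_coeff (s + J) m t * ?lap x)"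
     "\<And>x. v1 0 x = flow_coeff (s + J) (Suc m) 0 * g x" "\<And>x. v2 0 x = flow_coeff (s + J) (Suc m) 0 * ?lap x"
    using Suc.IH[OF graded_step[OF Suc.prems(1)], of "Suc m"] Suc.prems(2) by auto
  note rpv = poly_curve_rp[OF v(1)] poly_curve_rp[OF v(2)]
  have c0: "flow_coeff (s + J) (Suc m) 0 = 0" by (simp add: flow_coeff_def)
  have rc: "rp (\<lambda>x. c * f x)" "rp (\<lambda>x. c * g x)" for c by (intro rp_intros rp)+
  let ?u1 = "\<lambda>t x. flow_coeff (s + J) m t * f x + v1 t x" and ?u2 = "\<lambda>t x. flow_coeff (s + J) m t * g x + v2 t x"
  show ?case
  proof (intro exI conjI allI)
    show "poly_curve ?u1 (\<lambda>t x. L1 s (?u1 t) (?u2 t) x + (if m = 0 then 0 else flow_coeff (s + J) (m - 1) t) * f x)"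
      by (rule poly_curve_cong[OF poly_curve_add[OF poly_curve_term[OF rp(1) flow_coeff_deriv[of "s + J" m]] v(1)]], simp,
          unfold L1_add[OF rc(1) rpv(1)] L1_cmult[OF rp(1)] graded_L(1)[OF Suc.prems(1)],
          simp add: J algebra_simps)
    show "poly_curve ?u2 (\<lambda>t x. L2 s (?u1 t) (?u2 t) x + (if m = 0 then 0 else flow_coeff (s + J) (m - 1) t) * g x)"
      by (rule poly_curve_cong[OF poly_curve_add[OF poly_curve_term[OF rp(2) flow_coeff_deriv[of "s + J" m]] v(2)]], simp,
          unfold L2_add[OF rc(1) rpv(1) rc(2) rpv(2)] L2_cmult[OF rp] graded_L(2)[OF Suc.prems(1)],
          simp add: J algebra_simps)
  qed (use v(3,4) c0 in auto)
qed

lemma graded_wave_sol: assumes "graded j f g" shows "\<exists>v1 v2. wave_sol s v1 v2 \<and> v1 0 = f \<and> v2 0 = g"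
proof -
  obtain v1 v2 where "poly_curve v1 (\<lambda>t x. L1 s (v1 t) (v2 t) x + 0 * f x)" "poly_curve v2 (\<lambda>t x. L2 s (v1 t) (v2 t) x + 0 * g x)"
    "\<forall>x. v1 0 x = flow_coeff (s + j) 0 0 * f x" "\<forall>x. v2 0 x = flow_coeff (s + j) 0 0 * g x"
    using graded_curve[OF assms, of 0 j s] by auto
  then show ?thesis by (intro exI[of _ v1] exI[of _ v2]) (auto simp: wave_sol_def flow_coeff_def)
qed

lemma wave_sol_exists: assumes "rp f" "rp g" shows "\<exists>v1 v2. wave_sol s v1 v2 \<and> v1 0 = f \<and> v2 0 = g"
proof -
  have add: "\<exists>v1 v2. wave_sol s v1 v2 \<and> v1 0 = (\<lambda>x. f x + f' x) \<and> v2 0 = (\<lambda>x. g x + g' x)"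
    if "\<exists>v1 v2. wave_sol s v1 v2 \<and> v1 0 = f \<and> v2 0 = g" "\<exists>v1 v2. wave_sol s v1 v2 \<and> v1 0 = f' \<and> v2 0 = g'"
    for f g f' g' :: "'a rfun"
    using that wave_sol_add by blast
  have "\<exists>v1 v2. wave_sol s v1 v2 \<and> v1 0 = f \<and> v2 0 = (\<lambda>x. 0)" using rp_hom_sum[OF assms(1)]
  proof (induction rule: hom_sum.induct)
    case (hom_sum_hom_poly n f)
    then have "graded n f (\<lambda>x. 0)" by (auto simp: graded_def hom_poly_zero split: nat.splits)
    then show ?case by (rule graded_wave_sol)
  next
    case (hom_sum_add f f')
    show ?case using add[OF hom_sum_add.IH] by simp
  qed
  moreover have "\<exists>v1 v2. wave_sol s v1 v2 \<and> v1 0 = (\<lambda>x. 0) \<and> v2 0 = g" using rp_hom_sum[OF assms(2)]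
  proof (induction rule: hom_sum.induct)
    case (hom_sum_hom_poly n g)
    \<comment> \<open>Second components have degree one less than their level, so degree
      \<open>n\<close> belongs to level \<open>Suc n\<close>.\<close>
    then have "graded (Suc n) (\<lambda>x. 0) g" by (auto simp: graded_def hom_poly_zero)
    then show ?case by (rule graded_wave_sol)
  next
    case (hom_sum_add f f')
    show ?case using add[OF hom_sum_add.IH] by simp
  qed
  ultimately show ?thesis using add[of f "\<lambda>x. 0" "\<lambda>x. 0" g] by simp
qed

section \<open>Smooth functions on the closed ball\<close>

lemma has_pd_local:
  assumes "has_pd i f a x" "x \<in> ball 0 R" "\<And>y. y \<in> ball 0 R \<Longrightarrow> f y = g y"
  shows "has_pd i g a x"
  unfolding has_pd_def
proof (rule has_field_derivative_transform_within_open[OF assms(1)[unfolded has_pd_def]])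
  show "open ((\<lambda>t. x + t *\<^sub>R axis i 1) -` ball 0 R)"
    by (intro open_vimage continuous_intros open_ball)
qed (use assms in auto)

text \<open>\<open>deriv\<close> selects among the possible derivatives, so equivalent
  \<open>has_pd\<close> predicates yield the same value even where no derivative exists.\<close>

lemma pd_local: "x \<in> ball 0 R \<Longrightarrow> (\<And>y. y \<in> ball 0 R \<Longrightarrow> f y = g y) \<Longrightarrow> pd i f x = pd i g x"
proof -
  assume x: "x \<in> ball 0 R" and fg: "\<And>y. y \<in> ball 0 R \<Longrightarrow> f y = g y"
  have "has_pd i f a x \<longleftrightarrow> has_pd i g a x" for a
    using has_pd_local[of i f a x R g] has_pd_local[of i g a x R f] x fg by auto
  then show ?thesis unfolding pd_def deriv_def has_pd_def by simp
qed

lemma dpart_local: "(\<And>y. y \<in> ball 0 R \<Longrightarrow> f y = g y) \<Longrightarrow> x \<in> ball 0 R \<Longrightarrow> dpart al f x = dpart al g x"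
proof (induction al arbitrary: x)
  case (Cons i al)
  show ?case using pd_local[OF Cons.prems(2) Cons.IH[OF Cons.prems(1)]] by simp
qed simp

lemma smooth_cl_cont_ext: "smooth_cl R f \<Longrightarrow> cont_ext R (dpart al f)"
  unfolding smooth_cl_def cont_ext_def by blast

lemma smooth_cl_has_pd:
  assumes "smooth_cl R f" "x \<in> ball 0 R" shows "has_pd i (dpart al f) (pd i (dpart al f) x) x"
  using assms unfolding smooth_cl_def has_pd_def pd_def by (simp add: DERIV_deriv_iff_real_differentiable)

text \<open>Iterating the closure property yields, for each word, a member of \<open>F\<close> that
  agrees with the derivative on the ball. Smoothness is then proved by exhibiting a family closed
  under differentiation, without formulas for higher derivatives.\<close>

lemma smooth_cl_coinduct:
  assumes f: "f \<in> F" and cont_ext: "\<And>f. f \<in> F \<Longrightarrow> cont_ext R f"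
    and pd: "\<And>f i. f \<in> F \<Longrightarrow> \<exists>g\<in>F. \<forall>x\<in>ball 0 R. has_pd i f (g x) x"
  shows "smooth_cl R f"
proof -
  have step: "\<exists>g\<in>F. \<forall>x\<in>ball 0 R. dpart al f x = g x" for al
  proof (induction al)
    case (Cons i al)
    then obtain g where g: "g \<in> F" "\<And>x. x \<in> ball 0 R \<Longrightarrow> dpart al f x = g x" by blast
    obtain h where h: "h \<in> F" "\<And>x. x \<in> ball 0 R \<Longrightarrow> has_pd i g (h x) x" using pd[OF g(1)] by blast
    have "dpart (i # al) f x = h x" if "x \<in> ball 0 R" for x
      using has_pd_imp[OF has_pd_local[OF h(2)[OF that] that g(2)[symmetric]]] by simp
    then show ?case using h(1) by blast
  qed (use f in auto)
  show ?thesis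
    unfolding smooth_cl_def
  proof (intro conjI allI ballI)
    fix al i and x :: "real ^ 'a" assume x: "x \<in> ball 0 R"
    obtain g where g: "g \<in> F" "\<And>x. x \<in> ball 0 R \<Longrightarrow> dpart al f x = g x" using step by blast
    obtain h where h: "h \<in> F" "\<And>x. x \<in> ball 0 R \<Longrightarrow> has_pd i g (h x) x" using pd[OF g(1)] by blast
    have "has_pd i (dpart al f) (h x) x" using has_pd_local[OF h(2)[OF x] x] g(2) by auto
    then show "(\<lambda>t. dpart al f (x + t *\<^sub>R axis i 1)) differentiable (at 0)"
      unfolding has_pd_def using real_differentiable_def by blast
  next
    fix al
    obtain g where g: "g \<in> F" "\<And>x. x \<in> ball 0 R \<Longrightarrow> dpart al f x = g x" using step by blast
    then show "\<exists>g. continuous_on (cball 0 R) g \<and> (\<forall>x\<in>ball 0 R. g x = dpart al f x)"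
      using cont_ext[OF g(1)] unfolding cont_ext_def by auto
  qed
qed

lemma smooth_cl_rp: "rp f \<Longrightarrow> smooth_cl R f"
  by (rule smooth_cl_coinduct[of _ "Collect rp"]) (auto intro: cont_ext_rp rp_pd rp_has_pd)

lemma smooth_cl_pd: "smooth_cl R f \<Longrightarrow> smooth_cl R (pd i f)"
proof -
  assume f: "smooth_cl R f"
  have "dpart al (pd i f) = dpart (al @ [i]) f" for al by (simp add: dpart_append)
  with f show ?thesis unfolding smooth_cl_def by simp
qed

lemma smooth_cl_pd_nil: "smooth_cl R f \<Longrightarrow> x \<in> ball 0 R \<Longrightarrow> has_pd i f (pd i f x) x"
  using smooth_cl_has_pd[of R f x i "[]"] by simp

lemma smooth_cl_cont_ext_nil: "smooth_cl R f \<Longrightarrow> cont_ext R f"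
  using smooth_cl_cont_ext[of R f "[]"] by simp

lemma smooth_cl_add: assumes "smooth_cl R f" "smooth_cl R g" shows "smooth_cl R (\<lambda>x. f x + g x)"
proof (rule smooth_cl_coinduct[of _ "{\<lambda>x. f x + g x | f g. smooth_cl R f \<and> smooth_cl R g}"])
  fix h i assume "h \<in> {\<lambda>x. f x + g x | f g. smooth_cl R f \<and> smooth_cl R g}"
  then obtain f g where h: "h = (\<lambda>x. f x + g x)" "smooth_cl R f" "smooth_cl R g" by blast
  show "cont_ext R h" unfolding h(1) by (intro cont_ext_add smooth_cl_cont_ext_nil h)
  have "\<forall>x\<in>ball 0 R. has_pd i h (pd i f x + pd i g x) x"
    unfolding h(1) using h by (auto intro: has_pd_add smooth_cl_pd_nil)
  then show "\<exists>g\<in>{\<lambda>x. f x + g x | f g. smooth_cl R f \<and> smooth_cl R g}. \<forall>x\<in>ball 0 R. has_pd i h (g x) x"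
    using smooth_cl_pd[OF h(2), of i] smooth_cl_pd[OF h(3), of i]
    by (intro bexI[of _ "\<lambda>x. pd i f x + pd i g x"]) auto
qed (use assms in blast)

lemma smooth_cl_cmult: assumes "smooth_cl R f" shows "smooth_cl R (\<lambda>x. c * f x)"
proof (rule smooth_cl_coinduct[of _ "{\<lambda>x. c * f x | f. smooth_cl R f}"])
  fix h i assume "h \<in> {\<lambda>x. c * f x | f. smooth_cl R f}"
  then obtain f where h: "h = (\<lambda>x. c * f x)" "smooth_cl R f" by blast
  show "cont_ext R h" unfolding h(1) by (intro cont_ext_cmult smooth_cl_cont_ext_nil h)
  have "\<forall>x\<in>ball 0 R. has_pd i h (c * pd i f x) x"
    unfolding h(1) using h by (auto intro: has_pd_cmult smooth_cl_pd_nil)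
  then show "\<exists>g\<in>{\<lambda>x. c * f x | f. smooth_cl R f}. \<forall>x\<in>ball 0 R. has_pd i h (g x) x"
    using smooth_cl_pd[OF h(2), of i]
    by (intro bexI[of _ "\<lambda>x. c * pd i f x"]) auto
qed (use assms in blast)

lemma smooth_cl_coord_mult: assumes "smooth_cl R f" shows "smooth_cl R (\<lambda>x. x $ j * f x)"
proof -
  \<comment> \<open>Multiples of the coordinate alone are not closed under differentiation: the
    Leibniz rule leaves a multiple of \<open>f\<close> without it. Hence the additional smooth
    summand.\<close>
  let ?F = "{\<lambda>x. x $ j * f x + g x | f g. smooth_cl R f \<and> smooth_cl R g}"
  have "smooth_cl R (\<lambda>x. x $ j * f x + 0 * f x)"
  proof (rule smooth_cl_coinduct[of _ ?F])
    show "(\<lambda>x. x $ j * f x + 0 * f x) \<in> ?F"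
      by (rule CollectI, rule exI[of _ f], rule exI[of _ "\<lambda>x. 0 * f x"])
        (intro conjI refl assms smooth_cl_cmult)
  next
    fix h i assume "h \<in> ?F"
    then obtain f g where h: "h = (\<lambda>x. x $ j * f x + g x)" "smooth_cl R f" "smooth_cl R g" by blast
    show "cont_ext R h" unfolding h(1) by (intro cont_ext_add cont_ext_mult smooth_cl_cont_ext_nil h cont_ext_rp rp_coord)
    let ?\<delta> = "if i = j then 1 else 0"
    have pdc: "has_pd i (\<lambda>x. x $ j) ?\<delta> x" for x :: "real ^ 'a"
      using rp_has_pd[OF rp_coord, of i j x] by (simp add: pd_coord)
    have "\<forall>x\<in>ball 0 R. has_pd i h ((?\<delta> * f x + x $ j * pd i f x) + pd i g x) x"
      unfolding h(1)
      by (intro ballI has_pd_add has_pd_mult pdc smooth_cl_pd_nil[OF h(2)] smooth_cl_pd_nil[OF h(3)])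
    then have "\<forall>x\<in>ball 0 R. has_pd i h (x $ j * pd i f x + (?\<delta> * f x + pd i g x)) x"
      by (simp add: algebra_simps)
    moreover have "(\<lambda>x. x $ j * pd i f x + (?\<delta> * f x + pd i g x)) \<in> ?F"
      by (rule CollectI, rule exI[of _ "pd i f"], rule exI[of _ "\<lambda>x. ?\<delta> * f x + pd i g x"])
        (intro conjI refl smooth_cl_pd[OF h(2)] smooth_cl_add smooth_cl_cmult[OF h(2)] smooth_cl_pd[OF h(3)])
    ultimately show "\<exists>g\<in>?F. \<forall>x\<in>ball 0 R. has_pd i h (g x) x"
      by (rule bexI[of _ "\<lambda>x. x $ j * pd i f x + (?\<delta> * f x + pd i g x)"])
  qed
  then show ?thesis by simp
qed

lemma smooth_cl_sum:
  "finite A \<Longrightarrow> (\<And>a. a \<in> A \<Longrightarrow> smooth_cl R (f a)) \<Longrightarrow> smooth_cl R (\<lambda>x. \<Sum>a\<in>A. f a x)"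
proof (induction A rule: finite_induct)
  case empty
  show ?case by (simp add: smooth_cl_rp real_polynomial_function.intros(2))
next
  case (insert a A)
  then show ?case using smooth_cl_add[of R "f a"] by simp
qed

lemma dpart_add_ball:
  assumes "smooth_cl R f" "smooth_cl R g" "x \<in> ball 0 R"
  shows "dpart al (\<lambda>x. f x + g x) x = dpart al f x + dpart al g x"
  using assms(3)
proof (induction al arbitrary: x)
  case (Cons i al)
  have "pd i (dpart al (\<lambda>x. f x + g x)) x = pd i (\<lambda>x. dpart al f x + dpart al g x) x"
    by (rule pd_local[OF Cons.prems Cons.IH])
  also have "\<dots> = pd i (dpart al f) x + pd i (dpart al g) x"
    by (intro has_pd_imp has_pd_add smooth_cl_has_pd[OF assms(1) Cons.prems] smooth_cl_has_pd[OF assms(2) Cons.prems])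
  finally show ?case by simp
qed simp

lemma dpart_cmult_ball:
  assumes "smooth_cl R f" "x \<in> ball 0 R"
  shows "dpart al (\<lambda>x. c * f x) x = c * dpart al f x"
  using assms(2)
proof (induction al arbitrary: x)
  case (Cons i al)
  have "pd i (dpart al (\<lambda>x. c * f x)) x = pd i (\<lambda>x. c * dpart al f x) x"
    by (rule pd_local[OF Cons.prems Cons.IH])
  also have "\<dots> = c * pd i (dpart al f) x"
    by (intro has_pd_imp has_pd_cmult smooth_cl_has_pd[OF assms(1) Cons.prems])
  finally show ?case by simp
qed simp

section \<open>The Sobolev seminorm\<close>

lemma Dom_cont_ext:
  assumes "u \<in> Dom R" shows "cont_ext R (dpart al (fst u))" "cont_ext R (dpart al (snd u))"
  using assms by (auto simp: Dom_def intro: smooth_cl_cont_ext)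

lemma Dom_padd: "u \<in> Dom R \<Longrightarrow> v \<in> Dom R \<Longrightarrow> padd u v \<in> Dom R"
  by (auto simp: Dom_def padd_def intro: smooth_cl_add)

lemma Dom_pscale: "u \<in> Dom R \<Longrightarrow> pscale c u \<in> Dom R"
  by (auto simp: Dom_def pscale_def intro: smooth_cl_cmult)

lemma Dom_rp: "rp (fst u) \<Longrightarrow> rp (snd u) \<Longrightarrow> u \<in> Dom R"
  by (auto simp: Dom_def intro: smooth_cl_rp)

definition sobolev_norm :: "nat \<Rightarrow> real \<Rightarrow> ('n::finite) rfun \<Rightarrow> real" where
  "sobolev_norm k R f = L2_set (\<lambda>al. ball_norm R (dpart al f)) {al. length al \<le> k}"

lemma sobolev_norm_nonneg: "sobolev_norm k R f \<ge> 0" by (simp add: sobolev_norm_def L2_set_nonneg)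

lemma Nrm_eq_w:
  assumes "u \<in> Dom R" shows "Nrm k R u = sqrt ((sobolev_norm k R (fst u))\<^sup>2 + (sobolev_norm (k - 1) R (snd u))\<^sup>2)"
  unfolding Nrm_def sobolev_norm_def L2_set_def
  using hk_sq_eq_ball_norm[OF Dom_cont_ext(1)[OF assms]] hk_sq_eq_ball_norm[OF Dom_cont_ext(2)[OF assms]]
  by (simp add: sum_nonneg)

lemma sobolev_norm_triangle:
  assumes f: "smooth_cl R f" and g: "smooth_cl R g"
  shows "sobolev_norm k R (\<lambda>x. f x + g x) \<le> sobolev_norm k R f + sobolev_norm k R g"
proof -
  have "sobolev_norm k R (\<lambda>x. f x + g x) \<le> L2_set (\<lambda>al. ball_norm R (dpart al f) + ball_norm R (dpart al g)) {al. length al \<le> k}"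
    unfolding sobolev_norm_def
  proof (rule L2_set_mono)
    fix al
    have "ball_norm R (dpart al (\<lambda>x. f x + g x)) = ball_norm R (\<lambda>x. dpart al f x + dpart al g x)"
      by (rule ball_norm_cong) (rule dpart_add_ball[OF f g])
    also have "\<dots> \<le> ball_norm R (dpart al f) + ball_norm R (dpart al g)"
      by (intro ball_norm_triangle smooth_cl_cont_ext f g)
    finally show "ball_norm R (dpart al (\<lambda>x. f x + g x)) \<le> ball_norm R (dpart al f) + ball_norm R (dpart al g)" .
    show "0 \<le> ball_norm R (dpart al (\<lambda>x. f x + g x))" by (intro ball_norm_nonneg smooth_cl_cont_ext smooth_cl_add f g)
  qed
  also have "\<dots> \<le> sobolev_norm k R f + sobolev_norm k R g" unfolding sobolev_norm_def by (rule L2_set_triangle_ineq)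
  finally show ?thesis .
qed

lemma Nrm_padd:
  assumes "u \<in> Dom R" "v \<in> Dom R" shows "Nrm k R (padd u v) \<le> Nrm k R u + Nrm k R v"
proof -
  let ?a = "sobolev_norm k R (fst u)" and ?b = "sobolev_norm (k - 1) R (snd u)"
    and ?c = "sobolev_norm k R (fst v)" and ?d = "sobolev_norm (k - 1) R (snd v)"
  have "Nrm k R (padd u v) = sqrt ((sobolev_norm k R (fst (padd u v)))\<^sup>2 + (sobolev_norm (k - 1) R (snd (padd u v)))\<^sup>2)"
    by (rule Nrm_eq_w[OF Dom_padd[OF assms]])
  also have "\<dots> \<le> sqrt ((?a + ?c)\<^sup>2 + (?b + ?d)\<^sup>2)"
    using assms by (intro real_sqrt_le_mono add_mono power_mono sobolev_norm_nonneg)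
      (auto simp: padd_def Dom_def intro: sobolev_norm_triangle)
  also have "\<dots> \<le> sqrt (?a\<^sup>2 + ?b\<^sup>2) + sqrt (?c\<^sup>2 + ?d\<^sup>2)" by (rule real_sqrt_sum_squares_triangle_ineq)
  finally show ?thesis by (simp add: Nrm_eq_w assms)
qed

lemma sobolev_norm_cmult: assumes "smooth_cl R f" shows "sobolev_norm k R (\<lambda>x. c * f x) = \<bar>c\<bar> * sobolev_norm k R f"
proof -
  have "ball_norm R (dpart al (\<lambda>x. c * f x)) = \<bar>c\<bar> * ball_norm R (dpart al f)" for al
    by (rule trans[OF ball_norm_cong[OF dpart_cmult_ball[OF assms]] ball_norm_cmult])
  then show ?thesis unfolding sobolev_norm_def by (simp add: L2_set_right_distrib)
qed

lemma Nrm_pscale: assumes "u \<in> Dom R" shows "Nrm k R (pscale c u) = \<bar>c\<bar> * Nrm k R u"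
proof -
  have "Nrm k R (pscale c u) = sqrt (c\<^sup>2 * ((sobolev_norm k R (fst u))\<^sup>2 + (sobolev_norm (k - 1) R (snd u))\<^sup>2))"
    unfolding Nrm_eq_w[OF Dom_pscale[OF assms]] using assms
    by (simp add: pscale_def Dom_def sobolev_norm_cmult power_mult_distrib distrib_left)
  then show ?thesis by (simp add: Nrm_eq_w[OF assms] real_sqrt_mult)
qed

lemma Nrm_nonneg: "u \<in> Dom R \<Longrightarrow> Nrm k R u \<ge> 0"
  by (simp add: Nrm_eq_w)

lemma dpart_zero: "dpart al (\<lambda>x. 0) = (\<lambda>x. 0)"
  using dpart_cmult[OF rp_intros(1)[of 0], of al 0] by simp

section \<open>Inner products and mean value bounds for pairs\<close>

definition sobolev_inner :: "nat \<Rightarrow> real \<Rightarrow> ('n::finite) rfun \<Rightarrow> 'n rfun \<Rightarrow> real" where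
  "sobolev_inner k R f g = (\<Sum>al | length al \<le> k. ball_inner R (dpart al f) (dpart al g))"

lemma sobolev_inner_self: assumes "rp f" shows "sobolev_inner k R f f = (sobolev_norm k R f)\<^sup>2"
  unfolding sobolev_inner_def sobolev_norm_def L2_set_def
  by (simp add: sum_nonneg ball_inner_self cont_ext_rp rp_dpart assms)

lemma sobolev_inner_le: assumes "rp f" "rp g" shows "sobolev_inner k R f g \<le> sobolev_norm k R f * sobolev_norm k R g"
proof -
  have "sobolev_inner k R f g \<le> (\<Sum>al | length al \<le> k. \<bar>ball_norm R (dpart al f)\<bar> * \<bar>ball_norm R (dpart al g)\<bar>)"
    unfolding sobolev_inner_def
  proof (rule sum_mono)
    fix al :: "'a list"
    have "ball_inner R (dpart al f) (dpart al g) \<le> ball_norm R (dpart al f) * ball_norm R (dpart al g)"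
      by (intro abs_le_D1[OF ball_inner_le_ball_norm] cont_ext_rp rp_dpart assms)
    also have "\<dots> = \<bar>ball_norm R (dpart al f)\<bar> * \<bar>ball_norm R (dpart al g)\<bar>"
      by (simp add: ball_norm_nonneg cont_ext_rp rp_dpart assms)
    finally show "ball_inner R (dpart al f) (dpart al g) \<le> \<bar>ball_norm R (dpart al f)\<bar> * \<bar>ball_norm R (dpart al g)\<bar>" .
  qed
  also have "\<dots> \<le> sobolev_norm k R f * sobolev_norm k R g" unfolding sobolev_norm_def by (rule L2_set_mult_ineq)
  finally show ?thesis .
qed

lemma sobolev_inner_deriv:
  assumes v: "poly_curve v v'" and g: "rp g"
  shows "((\<lambda>t. sobolev_inner k R (v t) g) has_real_derivative sobolev_inner k R (v' t) g) (at t)"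
  unfolding sobolev_inner_def
proof (rule DERIV_sum)
  fix al :: "'a list"
  show "((\<lambda>t. ball_inner R (dpart al (v t)) (dpart al g)) has_real_derivative ball_inner R (dpart al (v' t)) (dpart al g)) (at t)"
    unfolding ball_inner_def
    by (rule poly_curve_integral, rule poly_curve_cong[OF poly_curve_mult_rp[OF rp_dpart[OF g] poly_curve_dpart[OF v]]]) (auto simp: mult_ac)
qed

text \<open>The analogue of \<open>ball_norm_mean_value\<close> for pairs: the curve is paired with
  its endpoint in the inner product of the product space. It is used wherever one would estimate an
  integral of curves of pairs.\<close>

lemma Nrm_mean_value:
  assumes v: "poly_curve v1 v1'" "poly_curve v2 v2'" "\<And>x. v1 0 x = 0" "\<And>x. v2 0 x = 0"
    and c: "\<And>r. 0 \<le> r \<Longrightarrow> r \<le> h \<Longrightarrow> Nrm k R (v1' r, v2' r) \<le> c" and h: "0 \<le> h"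
  shows "Nrm k R (v1 h, v2 h) \<le> h * c"
proof -
  note rpv = poly_curve_rp[OF v(1)] poly_curve_rp[OF v(2)] poly_curve_rp'[OF v(1)] poly_curve_rp'[OF v(2)]
  have D: "(v1 t, v2 t) \<in> Dom R" "(v1' t, v2' t) \<in> Dom R" for t by (auto intro!: Dom_rp rpv)
  define b where "b = (\<lambda>r. sobolev_inner k R (v1 r) (v1 h) + sobolev_inner (k - 1) R (v2 r) (v2 h))"
  define b' where "b' = (\<lambda>r. sobolev_inner k R (v1' r) (v1 h) + sobolev_inner (k - 1) R (v2' r) (v2 h))"
  have z: "sobolev_inner m R (\<lambda>x. 0) g = 0" for m and g :: "'a rfun"
    unfolding sobolev_inner_def ball_inner_def by (simp add: dpart_zero)
  have v0: "v1 0 = (\<lambda>x. 0)" "v2 0 = (\<lambda>x. 0)" using v by auto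
  show ?thesis
  proof (rule norm_mean_value[of b b'])
    show "(b has_real_derivative b' r) (at r)" for r
      unfolding b_def b'_def by (intro DERIV_add sobolev_inner_deriv v rpv)
    show "b 0 = 0" unfolding b_def v0 by (simp add: z)
    show "b h = (Nrm k R (v1 h, v2 h))\<^sup>2" unfolding b_def by (simp add: sobolev_inner_self rpv Nrm_eq_w D)
    show n0: "0 \<le> Nrm k R (v1 h, v2 h)" by (rule Nrm_nonneg[OF D(1)])
    show "0 \<le> c" using c[of 0] h Nrm_nonneg[OF D(2)[of 0], of k] by simp
    fix r assume r: "0 \<le> r" "r \<le> h"
    let ?a = "sobolev_norm k R (v1' r)" and ?b = "sobolev_norm (k - 1) R (v2' r)"
      and ?c = "sobolev_norm k R (v1 h)" and ?d = "sobolev_norm (k - 1) R (v2 h)"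
    have "b' r \<le> ?a * ?c + ?b * ?d" unfolding b'_def by (intro add_mono sobolev_inner_le rpv)
    also have "\<dots> \<le> sqrt (?a\<^sup>2 + ?b\<^sup>2) * sqrt (?c\<^sup>2 + ?d\<^sup>2)"
    proof -
      \<comment> \<open>Lagrange's identity, that is, the Cauchy-Schwarz inequality in the plane
        with its defect.\<close>
      have "(?a * ?c + ?b * ?d)\<^sup>2 + (?a * ?d - ?b * ?c)\<^sup>2 = (?a\<^sup>2 + ?b\<^sup>2) * (?c\<^sup>2 + ?d\<^sup>2)"
        by (simp add: power2_eq_square algebra_simps)
      then have "(?a * ?c + ?b * ?d)\<^sup>2 \<le> (?a\<^sup>2 + ?b\<^sup>2) * (?c\<^sup>2 + ?d\<^sup>2)"
        using zero_le_power2[of "?a * ?d - ?b * ?c"] by linarith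
      then show ?thesis unfolding real_sqrt_mult[symmetric] by (rule real_le_rsqrt)
    qed
    also have "\<dots> = Nrm k R (v1' r, v2' r) * Nrm k R (v1 h, v2 h)" by (simp add: Nrm_eq_w D)
    also have "\<dots> \<le> c * Nrm k R (v1 h, v2 h)" by (intro mult_right_mono c r n0)
    finally show "b' r \<le> c * Nrm k R (v1 h, v2 h)" .
  qed (use h in auto)
qed

lemma Nrm_poly_curve_tendsto:
  assumes v: "poly_curve v1 v1'" "poly_curve v2 v2'" "\<And>x. v1 0 x = 0" "\<And>x. v2 0 x = 0"
  shows "((\<lambda>t. Nrm k R (v1 t, v2 t)) \<longlongrightarrow> 0) (at_right 0)"
proof -
  have d: "\<exists>D. ((\<lambda>t. hk_sq m R (v t)) has_real_derivative D) (at 0)" if "poly_curve v v'" for m v and v' :: "real \<Rightarrow> 'a rfun"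
    unfolding hk_sq_def power2_eq_square
    by (rule exI, rule DERIV_sum, rule poly_curve_integral, rule poly_curve_mult; rule poly_curve_dpart[OF that])
  have c: "isCont (\<lambda>t. hk_sq m R (v t)) 0" if "poly_curve v v'" for m v and v' :: "real \<Rightarrow> 'a rfun"
    using d[OF that] DERIV_isCont by blast
  have z: "hk_sq m R (\<lambda>x :: real ^ 'a. 0) = 0" for m
    by (simp add: hk_sq_def dpart_zero)
  have v0: "v1 0 = (\<lambda>x. 0)" "v2 0 = (\<lambda>x. 0)" using v by auto
  have "isCont (\<lambda>t. Nrm k R (v1 t, v2 t)) 0"
    unfolding Nrm_def using c[OF v(1), of k] c[OF v(2), of "k - 1"] by (auto intro!: continuous_intros)
  then have "((\<lambda>t. Nrm k R (v1 t, v2 t)) \<longlongrightarrow> Nrm k R (v1 0, v2 0)) (at 0)" by (simp add: isCont_def)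
  then show ?thesis unfolding v0 by (simp add: Nrm_def z filterlim_at_split)
qed

section \<open>The operator on smooth pairs\<close>

lemma Lop_eq: "Lop p u = (L1 (s_p p) (fst u) (snd u), L2 (s_p p) (fst u) (snd u))"
  by (simp add: Lop_def L1_def L2_def)

lemma smooth_cl_L1: assumes "smooth_cl R f" "smooth_cl R g" shows "smooth_cl R (L1 s f g)"
proof -
  have "smooth_cl R (\<lambda>x. - s * f x + (-1) * (\<Sum>i\<in>UNIV. x $ i * pd i f x) + g x)"
    by (intro smooth_cl_add smooth_cl_cmult smooth_cl_sum smooth_cl_coord_mult smooth_cl_pd assms) auto
  then show ?thesis by (simp add: L1_def)
qed

lemma smooth_cl_L2: assumes "smooth_cl R f" "smooth_cl R g" shows "smooth_cl R (L2 s f g)"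
proof -
  have "smooth_cl R (\<lambda>x. (\<Sum>i\<in>UNIV. pd i (pd i f) x) + (- (s + 1)) * g x + (-1) * (\<Sum>i\<in>UNIV. x $ i * pd i g x))"
    by (intro smooth_cl_add smooth_cl_cmult smooth_cl_sum smooth_cl_coord_mult smooth_cl_pd assms) auto
  then show ?thesis by (simp add: L2_def algebra_simps)
qed

lemma Lop_Dom: "u \<in> Dom R \<Longrightarrow> Lop p u \<in> Dom R"
  by (auto simp: Dom_def Lop_eq intro: smooth_cl_L1 smooth_cl_L2)

section \<open>Uniform bounds on derivatives of smooth functions\<close>

definition small :: "real \<Rightarrow> nat \<Rightarrow> real \<Rightarrow> ('n::finite) rfun \<Rightarrow> bool" where
  "small R m \<delta> f \<longleftrightarrow> smooth_cl R f \<and> (\<forall>al. length al \<le> m \<longrightarrow> (\<forall>x\<in>ball 0 R. \<bar>dpart al f x\<bar> \<le> \<delta>))"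

lemma small_mono: "small R n \<delta> f \<Longrightarrow> m \<le> n \<Longrightarrow> small R m \<delta> f"
  by (auto simp: small_def)

lemma small_local: "small R m \<delta> f \<Longrightarrow> smooth_cl R g \<Longrightarrow> (\<And>x. x \<in> ball 0 R \<Longrightarrow> f x = g x) \<Longrightarrow> small R m \<delta> g"
  using dpart_local[of R f g] by (simp add: small_def)

lemma smallD: "small R m \<delta> f \<Longrightarrow> length al \<le> m \<Longrightarrow> x \<in> ball 0 R \<Longrightarrow> \<bar>dpart al f x\<bar> \<le> \<delta>"
  unfolding small_def by blast

lemma small_smooth: "small R m \<delta> f \<Longrightarrow> smooth_cl R f"
  unfolding small_def by blast

lemma small_nonneg: "small R m \<delta> f \<Longrightarrow> R > 0 \<Longrightarrow> \<delta> \<ge> 0"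
  using smallD[of R m \<delta> f "[]" 0] by auto

lemma small_add:
  assumes "small R m \<delta> f" "small R m \<epsilon> g" shows "small R m (\<delta> + \<epsilon>) (\<lambda>x. f x + g x)"
  unfolding small_def
proof (intro conjI allI impI ballI)
  fix al :: "'a list" and x :: "real ^ 'a" assume *: "length al \<le> m" "x \<in> ball 0 R"
  show "\<bar>dpart al (\<lambda>x. f x + g x) x\<bar> \<le> \<delta> + \<epsilon>"
    unfolding dpart_add_ball[OF small_smooth[OF assms(1)] small_smooth[OF assms(2)] *(2)]
    using abs_triangle_ineq[of "dpart al f x" "dpart al g x"] smallD[OF assms(1) *] smallD[OF assms(2) *]
    by linarith
qed (intro smooth_cl_add small_smooth[OF assms(1)] small_smooth[OF assms(2)])

lemma small_cmult: assumes "small R m \<delta> f" shows "small R m (\<bar>c\<bar> * \<delta>) (\<lambda>x. c * f x)"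
  unfolding small_def
proof (intro conjI allI impI ballI)
  fix al :: "'a list" and x :: "real ^ 'a" assume *: "length al \<le> m" "x \<in> ball 0 R"
  show "\<bar>dpart al (\<lambda>x. c * f x) x\<bar> \<le> \<bar>c\<bar> * \<delta>"
    unfolding dpart_cmult_ball[OF small_smooth[OF assms] *(2)] abs_mult
    by (intro mult_left_mono smallD[OF assms *]) auto
qed (intro smooth_cl_cmult small_smooth[OF assms])

lemma small_pd: assumes "small R (Suc m) \<delta> f" shows "small R m \<delta> (pd i f)"
  unfolding small_def
proof (intro conjI allI impI ballI)
  fix al :: "'a list" and x :: "real ^ 'a" assume *: "length al \<le> m" "x \<in> ball 0 R"
  have "dpart al (pd i f) = dpart (al @ [i]) f" by (simp add: dpart_append)
  then show "\<bar>dpart al (pd i f) x\<bar> \<le> \<delta>" using smallD[OF assms _ *(2), of "al @ [i]"] *(1) by simp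
qed (intro smooth_cl_pd small_smooth[OF assms])

lemma small_sum:
  assumes "finite A" "\<And>a. a \<in> A \<Longrightarrow> small R m \<delta> (f a)"
  shows "small R m (real (card A) * \<delta>) (\<lambda>x. \<Sum>a\<in>A. f a x)"
  using assms
proof (induction A)
  case empty
  show ?case by (simp add: small_def smooth_cl_rp rp_intros(1) dpart_zero)
next
  case (insert a A)
  then have "small R m (\<delta> + real (card A) * \<delta>) (\<lambda>x. f a x + (\<Sum>a\<in>A. f a x))"
    by (intro small_add) auto
  then show ?case using insert.hyps by (simp add: distrib_right)
qed

text \<open>The undifferentiated coordinate contributes the factor R, and each of at most m
  derivatives may fall on the coordinate and add one more \<delta>.\<close>

lemma small_coord_mult:
  assumes R: "R > 0"
  shows "small R m \<delta> f \<Longrightarrow> small R m ((R + real m) * \<delta>) (\<lambda>x. x $ j * f x)"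
proof (induction m arbitrary: f)
  case 0
  have "\<bar>x $ j * f x\<bar> \<le> R * \<delta>" if "x \<in> ball 0 R" for x
  proof -
    have "\<bar>x $ j\<bar> \<le> R" using component_le_norm_cart[of x j] that by simp
    moreover have "\<bar>f x\<bar> \<le> \<delta>" using 0 that by (auto simp: small_def)
    ultimately show ?thesis unfolding abs_mult using R by (intro mult_mono) auto
  qed
  then show ?case using 0 by (auto simp: small_def intro: smooth_cl_coord_mult)
next
  case (Suc m)
  have f: "smooth_cl R f" using Suc.prems by (simp add: small_def)
  have f0: "small R m \<delta> f" by (rule small_mono[OF Suc.prems]) simp
  have d0: "\<delta> \<ge> 0" by (rule small_nonneg[OF f0 R])
  have "\<bar>dpart al (\<lambda>x. x $ j * f x) x\<bar> \<le> (R + real (Suc m)) * \<delta>" if al: "length al \<le> Suc m" and x: "x \<in> ball 0 R" for al x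
  \<comment> \<open>The last letter of the word is the derivative taken first. Applying the Leibniz
    rule there leaves a word of length at most \<open>m\<close> for the induction
    hypothesis.\<close>
  proof (cases al rule: rev_cases)
    case Nil
    have "\<bar>x $ j * f x\<bar> \<le> (R + real m) * \<delta>" using smallD[OF Suc.IH[OF f0], of "[]"] x by simp
    also have "\<dots> \<le> (R + real (Suc m)) * \<delta>" using d0 by (intro mult_right_mono) auto
    finally show ?thesis using Nil by simp
  next
    case (snoc be i)
    let ?\<delta> = "if i = j then 1 else 0 :: real"
    let ?h = "\<lambda>x. ?\<delta> * f x + x $ j * pd i f x"
    have "pd i (\<lambda>x. x $ j * f x) y = ?h y" if "y \<in> ball 0 R" for y
    proof -
      have "has_pd i (\<lambda>x. x $ j) ?\<delta> y"
        using rp_has_pd[OF rp_coord, of i j y] by (simp add: pd_coord)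
      from has_pd_mult[OF this smooth_cl_pd_nil[OF f that, of i]] show ?thesis by (rule has_pd_imp)
    qed
    then have "dpart al (\<lambda>x. x $ j * f x) x = dpart be ?h x"
      unfolding snoc dpart_append using dpart_local[OF _ x, of "pd i (\<lambda>x. x $ j * f x)" ?h be] by simp
    moreover have "small R m (\<bar>?\<delta>\<bar> * \<delta> + (R + real m) * \<delta>) ?h"
      by (intro small_add small_cmult f0 Suc.IH small_pd Suc.prems)
    ultimately have "\<bar>dpart al (\<lambda>x. x $ j * f x) x\<bar> \<le> \<bar>?\<delta>\<bar> * \<delta> + (R + real m) * \<delta>"
      using al snoc x smallD[of R m _ ?h be x] by simp
    also have "\<dots> \<le> (R + real (Suc m)) * \<delta>" using d0 by (auto simp: algebra_simps)
    finally show ?thesis .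
  qed
  then show ?case using f by (auto simp: small_def intro: smooth_cl_coord_mult)
qed

text \<open>The two lost derivatives go to the Laplacian. A single constant dominates the
  coefficients of both components.\<close>

lemma small_L:
  fixes f g :: "('n::finite) rfun" and s :: real
  assumes R: "R > 0" and f: "small R (m + 2) \<delta> f" and g: "small R (m + 2) \<delta> g"
  defines "C \<equiv> \<bar>s\<bar> + \<bar>s + 1\<bar> + real CARD('n) * (R + real m) + real CARD('n) + 1"
  shows "small R m (C * \<delta>) (L1 s f g)" "small R m (C * \<delta>) (L2 s f g)"
proof -
  have d0: "\<delta> \<ge> 0" by (rule small_nonneg[OF f R])
  have fs: "small R m \<delta> f" "small R (Suc m) \<delta> f" "small R (Suc (Suc m)) \<delta> f"
    "small R m \<delta> g" "small R (Suc m) \<delta> g"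
    by (rule small_mono[OF f] small_mono[OF g]; simp)+
  have n0: "0 \<le> \<bar>s\<bar> * \<delta>" "0 \<le> \<bar>s + 1\<bar> * \<delta>" "0 \<le> real CARD('n) * \<delta>" "\<bar>- (s + 1)\<bar> = \<bar>s + 1\<bar>"
    using d0 by simp_all
  have weak: "small R m (C * \<delta>) h" if "small R m c h" "c \<le> C * \<delta>" for c and h :: "'n rfun"
    using small_smooth[OF that(1)] order_trans[OF smallD[OF that(1)] that(2)] unfolding small_def by blast
  have "small R m (\<bar>- s\<bar> * \<delta> + \<bar>-1\<bar> * (real CARD('n) * ((R + real m) * \<delta>)) + \<delta>)
     (\<lambda>x. - s * f x + (-1) * (\<Sum>i\<in>UNIV. x $ i * pd i f x) + g x)"
    by (intro small_add small_cmult small_sum small_coord_mult small_pd fs R) auto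
  then have "small R m (C * \<delta>) (\<lambda>x. - s * f x + (-1) * (\<Sum>i\<in>UNIV. x $ i * pd i f x) + g x)"
    by (rule weak) (use n0 in \<open>simp add: C_def distrib_right mult.assoc\<close>)
  then show "small R m (C * \<delta>) (L1 s f g)" by (simp add: L1_def)
  have "small R m (real CARD('n) * \<delta> + \<bar>- (s + 1)\<bar> * \<delta> + \<bar>-1\<bar> * (real CARD('n) * ((R + real m) * \<delta>)))
     (\<lambda>x. (\<Sum>i\<in>UNIV. pd i (pd i f) x) + (- (s + 1)) * g x + (-1) * (\<Sum>i\<in>UNIV. x $ i * pd i g x))"
    by (intro small_add small_cmult small_sum small_coord_mult small_pd fs R) auto
  then have "small R m (C * \<delta>) (\<lambda>x. (\<Sum>i\<in>UNIV. pd i (pd i f) x) + (- (s + 1)) * g x + (-1) * (\<Sum>i\<in>UNIV. x $ i * pd i g x))"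
    by (rule weak) (use n0 d0 in \<open>simp add: C_def distrib_right mult.assoc del: minus_add_distrib\<close>)
  then show "small R m (C * \<delta>) (L2 s f g)" by (simp add: L2_def algebra_simps)
qed

lemma ball_norm_le_sup:
  fixes f :: "('n::finite) rfun"
  assumes "cont_ext R f" "\<And>x. x \<in> ball 0 R \<Longrightarrow> \<bar>f x\<bar> \<le> \<delta>" "\<delta> \<ge> 0"
  shows "ball_norm R f \<le> \<delta> * ball_norm R (\<lambda>x :: real ^ 'n. 1)"
proof -
  have "integral (ball 0 R) (\<lambda>x. (f x)\<^sup>2) \<le> integral (ball 0 R) (\<lambda>x :: real ^ 'n. (\<delta> * 1)\<^sup>2)"
  proof (rule integral_le)
    show "(\<lambda>x. (f x)\<^sup>2) integrable_on ball 0 R" by (intro cont_ext_integrable cont_ext_power2 assms)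
    show "(\<lambda>x :: real ^ 'n. (\<delta> * 1)\<^sup>2) integrable_on ball 0 R" by (intro rp_integrable rp_intros)
    show "(f x)\<^sup>2 \<le> (\<delta> * 1)\<^sup>2" if "x \<in> ball 0 R" for x
      using power_mono[OF assms(2)[OF that], of 2] by simp
  qed
  then have "ball_norm R f \<le> ball_norm R (\<lambda>x :: real ^ 'n. \<delta> * 1)" unfolding ball_norm_def by (rule real_sqrt_le_mono)
  also have "\<dots> = \<bar>\<delta>\<bar> * ball_norm R (\<lambda>x :: real ^ 'n. 1)" by (rule ball_norm_cmult)
  finally show ?thesis using assms(3) by simp
qed

lemma Nrm_le_small:
  fixes u :: "('n::finite) rpair"
  assumes "small R k \<delta> (fst u)" "small R k \<delta> (snd u)" "\<delta> \<ge> 0"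
  shows "Nrm k R u \<le> sqrt (2 * real (card {al :: 'n list. length al \<le> k})) * (\<delta> * ball_norm R (\<lambda>x :: real ^ 'n. 1))"
proof (rule Nrm_le)
  have s: "smooth_cl R (fst u)" "smooth_cl R (snd u)" using assms by (auto simp: small_def)
  show c: "cont_ext R (dpart al (fst u))" "cont_ext R (dpart al (snd u))" for al by (intro smooth_cl_cont_ext s)+
  show "0 \<le> \<delta> * ball_norm R (\<lambda>x :: real ^ 'n. 1)"
    by (intro mult_nonneg_nonneg assms(3) ball_norm_nonneg cont_ext_rp rp_intros(1))
  show "ball_norm R (dpart al (fst u)) \<le> \<delta> * ball_norm R (\<lambda>x :: real ^ 'n. 1)" if "length al \<le> k" for al
    by (rule ball_norm_le_sup[OF c(1)]) (use assms that in \<open>auto simp: small_def\<close>)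
  show "ball_norm R (dpart al (snd u)) \<le> \<delta> * ball_norm R (\<lambda>x :: real ^ 'n. 1)" if "length al \<le> k - 1" for al
    by (rule ball_norm_le_sup[OF c(2)]) (use assms that in \<open>auto simp: small_def\<close>)
qed

section \<open>Density of polynomials\<close>

lemma has_pd_open:
  assumes "has_pd i f a x" "open S" "x \<in> S" "\<And>y. y \<in> S \<Longrightarrow> f y = g y"
  shows "has_pd i g a x"
  unfolding has_pd_def
proof (rule has_field_derivative_transform_within_open[OF assms(1)[unfolded has_pd_def]])
  show "open ((\<lambda>t. x + t *\<^sub>R axis i 1) -` S)"
    by (intro open_vimage continuous_intros assms)
qed (use assms in auto)

lemma open_norm_gt: "open {x :: 'a::real_normed_vector. norm x > \<sigma>}"
  by (intro open_Collect_less continuous_intros)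

definition smooth_on_ball :: "real \<Rightarrow> ('n::finite) rfun \<Rightarrow> bool" where
  "smooth_on_ball \<rho> h \<longleftrightarrow> (\<forall>al. continuous_on (ball 0 \<rho>) (dpart al h) \<and>
    (\<forall>i. \<forall>x\<in>ball 0 \<rho>. has_pd i (dpart al h) (dpart (i # al) h x) x))"

lemma smooth_on_ball_pd: "smooth_on_ball \<rho> h \<Longrightarrow> smooth_on_ball \<rho> (pd i h)"
proof -
  assume h: "smooth_on_ball \<rho> h"
  have "dpart al (pd i h) = dpart (al @ [i]) h" for al by (simp add: dpart_append)
  with h show ?thesis unfolding smooth_on_ball_def by simp
qed

definition cut :: "real \<Rightarrow> ('n::finite) rfun \<Rightarrow> 'n rfun \<Rightarrow> 'n rfun" where
  "cut \<rho> h \<theta> = (\<lambda>x. if x \<in> ball 0 \<rho> then h x * \<theta> x else 0)"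

text \<open>Because \<sigma> < \<rho>, two open sets cover the space: on the ball the product rule
  applies, and where \<open>norm x > \<sigma>\<close> the function vanishes identically. The
  derivative is a sum of two functions of the same shape, so \<open>h\<close> and
  \<open>\<theta>\<close> vary in the induction.\<close>

lemma Ck_cut:
  assumes \<sigma>: "\<sigma> < \<rho>"
  shows "smooth_on_ball \<rho> h \<Longrightarrow> Ck m \<theta> \<Longrightarrow> (\<And>x. norm x > \<sigma> \<Longrightarrow> \<theta> x = 0) \<Longrightarrow> Ck m (cut \<rho> h \<theta>)"
proof (induction m arbitrary: h \<theta>)
  case (0 h \<theta>)
  have h: "continuous_on (ball 0 \<rho>) h" using 0(1) unfolding smooth_on_ball_def by (metis dpart.simps(1))
  have "continuous_on (ball 0 \<rho> \<union> {x. norm x > \<sigma>}) (cut \<rho> h \<theta>)"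
  proof (rule continuous_on_open_Un)
    have "continuous_on (ball 0 \<rho>) (\<lambda>x. h x * \<theta> x)"
      using 0(2) by (intro continuous_on_mult h) (auto elim: continuous_on_subset)
    then show "continuous_on (ball 0 \<rho>) (cut \<rho> h \<theta>)"
      by (rule continuous_on_eq) (auto simp: cut_def)
    have "continuous_on {x :: real ^ 'a. norm x > \<sigma>} (\<lambda>x. 0)" by (rule continuous_on_const)
    then show "continuous_on {x. norm x > \<sigma>} (cut \<rho> h \<theta>)"
      by (rule continuous_on_eq) (use 0(3) in \<open>auto simp: cut_def\<close>)
  qed (auto intro: open_norm_gt)
  moreover have "ball 0 \<rho> \<union> {x. norm x > \<sigma>} = (UNIV :: (real ^ 'a) set)" using \<sigma> by auto
  ultimately show ?case by simp
next
  case (Suc m h \<theta>)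
  have \<theta>m: "Ck m \<theta>" by (rule Ck_Suc_imp[OF Suc.prems(2)])
  have \<theta>: "has_pd i \<theta> (pd i \<theta> x) x" "Ck m (pd i \<theta>)" for i x using Suc.prems(2) by auto
  have \<theta>0: "pd i \<theta> x = 0" if "norm x > \<sigma>" for i x
    by (rule has_pd_imp, rule has_pd_open[OF has_pd_const[of i 0] open_norm_gt]) (use that Suc.prems(3) in auto)
  have h: "has_pd i h (pd i h x) x" if "x \<in> ball 0 \<rho>" for i x
    using Suc.prems(1) that unfolding smooth_on_ball_def by (metis dpart.simps)
  show ?case
  proof (rule Ck_SucI[where g="\<lambda>i x. cut \<rho> (pd i h) \<theta> x + cut \<rho> h (pd i \<theta>) x"])
    show "continuous_on UNIV (cut \<rho> h \<theta>)"
      by (rule Ck_continuous[OF Suc.IH[OF Suc.prems(1) \<theta>m Suc.prems(3)]])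
    show "Ck m (\<lambda>x. cut \<rho> (pd i h) \<theta> x + cut \<rho> h (pd i \<theta>) x)" for i
      by (intro Ck_add Suc.IH smooth_on_ball_pd Suc.prems(1) \<theta>m \<theta> \<theta>0 Suc.prems(3))
    fix i and x :: "real ^ 'a"
    show "has_pd i (cut \<rho> h \<theta>) (cut \<rho> (pd i h) \<theta> x + cut \<rho> h (pd i \<theta>) x) x"
    proof (cases "x \<in> ball 0 \<rho>")
      case True
      have "has_pd i (cut \<rho> h \<theta>) (pd i h x * \<theta> x + h x * pd i \<theta> x) x"
        by (rule has_pd_open[OF has_pd_mult[OF h[OF True] \<theta>(1)] open_ball True]) (simp add: cut_def)
      then show ?thesis using True by (simp add: cut_def)
    next
      case False
      then have x: "norm x > \<sigma>" using \<sigma> by auto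
      have "has_pd i (cut \<rho> h \<theta>) 0 x"
        by (rule has_pd_open[OF has_pd_const[of i 0] open_norm_gt]) (use x Suc.prems(3) in \<open>auto simp: cut_def\<close>)
      then show ?thesis using False by (simp add: cut_def)
    qed
  qed
qed

text \<open>A quotient a / (a + b) of truncated powers: \<open>b\<close> vanishes on the inner ball,
  \<open>a\<close> outside the outer one, and R < \<sigma> keeps the denominator positive.\<close>

lemma cutoff_exists:
  assumes R: "0 < R" "R < \<sigma>"
  obtains \<theta> :: "('n::finite) rfun" where "Ck m \<theta>" "\<And>x. norm x < R \<Longrightarrow> \<theta> x = 1" "\<And>x. norm x > \<sigma> \<Longrightarrow> \<theta> x = 0"
proof
  define a where "a = (\<lambda>x :: real ^ 'n. (max 0 (\<sigma>\<^sup>2 - x \<bullet> x)) ^ Suc m)"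
  define b where "b = (\<lambda>x :: real ^ 'n. (max 0 (x \<bullet> x - R\<^sup>2)) ^ Suc m)"
  have R2: "R\<^sup>2 < \<sigma>\<^sup>2" using R by (intro power_strict_mono) auto
  have ab: "a x \<ge> 0" "b x \<ge> 0" for x by (simp_all add: a_def b_def)
  have nz: "a x + b x \<noteq> 0" for x
  proof -
    have "x \<bullet> x < \<sigma>\<^sup>2 \<or> x \<bullet> x > R\<^sup>2" using R2 by linarith
    then have "a x > 0 \<or> b x > 0" by (auto simp: a_def b_def simp del: power_Suc intro!: zero_less_power)
    then show ?thesis using ab[of x] by auto
  qed
  have "Ck m a" "Ck m b" unfolding a_def b_def
    by (intro Ck_max_power real_polynomial_function_diff rp_inner_self rp_intros(1))+
  then show "Ck m (\<lambda>x. a x * inverse (a x + b x))"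
    using nz by (intro Ck_mult Ck_inverse Ck_add)
  show "a x * inverse (a x + b x) = 1" if "norm x < R" for x
  proof -
    have "x \<bullet> x \<le> R\<^sup>2" using that R by (simp add: power2_norm_eq_inner[symmetric] power_mono)
    then have "b x = 0" by (simp add: b_def)
    then show ?thesis using nz[of x] by simp
  qed
  show "a x * inverse (a x + b x) = 0" if "norm x > \<sigma>" for x
  proof -
    have "\<sigma>\<^sup>2 \<le> x \<bullet> x" using that R by (simp add: power2_norm_eq_inner[symmetric] power_mono)
    then show ?thesis by (simp add: a_def)
  qed
qed

lemma Ck_dpart: "Ck m f \<Longrightarrow> length al + j \<le> m \<Longrightarrow> Ck j (dpart al f)"
proof (induction al arbitrary: j)
  case Nil
  then show ?case using Ck_mono by simp
next
  case (Cons i al)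
  then show ?case using Cons.IH[of "Suc j"] by simp
qed

lemma Ck_dpart_support:
  assumes "\<And>x. norm x > \<sigma> \<Longrightarrow> f x = 0"
  shows "norm x > \<sigma> \<Longrightarrow> dpart al f x = 0"
proof (induction al arbitrary: x)
  case (Cons i al)
  have "pd i (dpart al f) x = 0"
    by (rule has_pd_imp, rule has_pd_open[OF has_pd_const[of i 0] open_norm_gt]) (use Cons in auto)
  then show ?case by simp
qed (use assms in simp)

lemma dpart_integral_translate:
  fixes F :: "('n::finite) rfun"
  assumes F: "Ck m F" and P: "continuous_on UNIV P" and al: "length al \<le> m"
  shows "dpart al (\<lambda>x. integral (cbox a b) (\<lambda>y. F (x + y) * P y)) = (\<lambda>x. integral (cbox a b) (\<lambda>y. dpart al F (x + y) * P y))"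
  using al
proof (induction al)
  case (Cons i al)
  then have C: "Ck (Suc 0) (dpart al F)" by (intro Ck_dpart[OF F]) simp
  have "pd i (\<lambda>x. integral (cbox a b) (\<lambda>y. dpart al F (x + y) * P y)) =
     (\<lambda>x. integral (cbox a b) (\<lambda>y. pd i (dpart al F) (x + y) * P y))"
    by (rule ext, rule has_pd_imp, rule has_pd_integral_translate) (use C P in auto)
  then show ?case using Cons by simp
qed simp

text \<open>Expanding the kernel into products pulls the factors in x out of the integral, so a
  weight that is merely continuous still leaves a polynomial in x.\<close>

lemma separable_integral_weight:
  assumes "separable K" and F: "continuous_on UNIV F"
  shows "rp (\<lambda>x. integral (cbox a b) (\<lambda>z. F z * K x z))"
  using assms(1)
proof (induction rule: separable.induct)
  case (separable_term u v)
  have "(\<lambda>x. integral (cbox a b) (\<lambda>z. F z * (u x * v z))) = (\<lambda>x. u x * integral (cbox a b) (\<lambda>z. F z * v z))"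
  proof
    fix x
    have "F z * (u x * v z) = u x * (F z * v z)" for z by simp
    then show "integral (cbox a b) (\<lambda>z. F z * (u x * v z)) = u x * integral (cbox a b) (\<lambda>z. F z * v z)"
      by (simp only: integral_mult_right)
  qed
  then show ?case using separable_term by (simp add: rp_intros)
next
  case (separable_add K L)
  have i: "(\<lambda>z. F z * M x z) integrable_on cbox a b" if "separable M" for M x
    by (intro integrable_continuous continuous_on_mult continuous_on_subset[OF F]
        rp_continuous separable_rp'[OF that]) auto
  have "(\<lambda>x. integral (cbox a b) (\<lambda>z. F z * (K x z + L x z))) =
    (\<lambda>x. integral (cbox a b) (\<lambda>z. F z * K x z) + integral (cbox a b) (\<lambda>z. F z * L x z))"
    by (simp add: distrib_left integral_add i separable_add.hyps)
  then show ?case using separable_add.IH by (simp add: rp_intros)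
qed

text \<open>Convolving with a polynomial \<open>P\<close> produces a polynomial on the ball, and all derivatives may be put on
  \<open>F\<close>; hence it suffices that \<open>P\<close> is uniformly close to a merely continuous approximate identity.\<close>

lemma polynomial_approx_Ck:
  fixes F :: "('n::finite) rfun"
  assumes F: "Ck m F" and supp: "\<And>x. norm x > \<sigma> \<Longrightarrow> F x = 0" and R: "0 < R" "R < \<sigma>" and \<delta>: "\<delta> > 0"
  obtains q where "rp q" "\<And>al x. length al \<le> m \<Longrightarrow> x \<in> ball 0 R \<Longrightarrow> \<bar>dpart al q x - dpart al F x\<bar> \<le> \<delta>"
proof -
  define A where "A = {al :: 'n list. length al \<le> m}"
  have finA: "finite A" unfolding A_def by (rule finite_words)
  \<comment> \<open>Large enough that the support, of radius \<sigma>, stays in the cube when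
    translated by points of the ball. The ball of radius \<eta> \<le> 1 fits in as well.\<close>
  define C where "C = \<sigma> + R + 1"
  have cH: "continuous_on S (dpart al F)" if "al \<in> A" for al S
    using Ck_continuous[OF Ck_dpart[OF F, of al 0]] that continuous_on_subset unfolding A_def by auto
  have bounded: "\<exists>B\<ge>0. \<forall>x. \<bar>dpart al F x\<bar> \<le> B" if "al \<in> A" for al
  proof -
    have "compact (dpart al F ` cball 0 \<sigma>)" by (intro compact_continuous_image cH that) auto
    then obtain B where B: "\<forall>y\<in>dpart al F ` cball 0 \<sigma>. norm y \<le> B" using compact_imp_bounded bounded_iff by metis
    have "\<bar>dpart al F x\<bar> \<le> max B 0" for x
    proof (cases "norm x \<le> \<sigma>")
      case True
      then show ?thesis using B by (force simp: le_max_iff_disj)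
    next
      case False
      then show ?thesis using Ck_dpart_support[OF supp, where x=x and al=al] by simp
    qed
    then show ?thesis by (intro exI[of _ "max B 0"]) auto
  qed
  then obtain Bf where Bf: "\<And>al. al \<in> A \<Longrightarrow> Bf al \<ge> 0 \<and> (\<forall>x. \<bar>dpart al F x\<bar> \<le> Bf al)"
    using bchoice[of A "\<lambda>al B. B \<ge> 0 \<and> (\<forall>x. \<bar>dpart al F x\<bar> \<le> B)"] by blast
  define B where "B = (\<Sum>al\<in>A. Bf al)"
  have B0: "B \<ge> 0" unfolding B_def using Bf by (intro sum_nonneg) auto
  have B: "\<bar>dpart al F x\<bar> \<le> B" if "al \<in> A" for al x
  proof -
    have "Bf al \<le> B" unfolding B_def using Bf finA that by (intro member_le_sum) auto
    then show ?thesis using Bf[OF that] order_trans by blast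
  qed
  have "\<forall>al\<in>A. \<forall>\<^sub>F \<eta> in at_right (0::real). \<forall>x\<in>ball 0 R. \<forall>y. norm y \<le> \<eta> \<longrightarrow> \<bar>dpart al F (x + y) - dpart al F x\<bar> \<le> \<delta> / 2"
  proof
    fix al assume al: "al \<in> A"
    have "uniformly_continuous_on (cball 0 (R + 1)) (dpart al F)"
      by (intro compact_uniformly_continuous cH al) auto
    then obtain d where d: "d > 0" "\<And>x y. x \<in> cball 0 (R + 1) \<Longrightarrow> y \<in> cball 0 (R + 1) \<Longrightarrow> dist y x < d \<Longrightarrow>
        dist (dpart al F y) (dpart al F x) < \<delta> / 2"
      using \<delta> unfolding uniformly_continuous_on_def by (meson half_gt_zero)
    show "\<forall>\<^sub>F \<eta> in at_right (0::real). \<forall>x\<in>ball 0 R. \<forall>y. norm y \<le> \<eta> \<longrightarrow> \<bar>dpart al F (x + y) - dpart al F x\<bar> \<le> \<delta> / 2"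
      unfolding eventually_at_right_field
    proof (intro exI[of _ "min d 1"] conjI allI impI ballI)
      fix \<eta> :: real and x y :: "real ^ 'n" assume *: "0 < \<eta>" "\<eta> < min d 1" "x \<in> ball 0 R" "norm y \<le> \<eta>"
      have "norm (x + y) \<le> R + 1" using norm_triangle_ineq[of x y] * by auto
      then have "x + y \<in> cball 0 (R + 1)" by (simp only: mem_cball_0)
      then have "dist (dpart al F (x + y)) (dpart al F x) < \<delta> / 2"
        by (rule d(2)[rotated]) (use * in \<open>auto simp: dist_norm\<close>)
      then show "\<bar>dpart al F (x + y) - dpart al F x\<bar> \<le> \<delta> / 2" by (simp add: dist_real_def)
    qed (use d in auto)
  qed
  then have "\<forall>\<^sub>F \<eta> in at_right (0::real). \<forall>al\<in>A. \<forall>x\<in>ball 0 R. \<forall>y. norm y \<le> \<eta> \<longrightarrow> \<bar>dpart al F (x + y) - dpart al F x\<bar> \<le> \<delta> / 2"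
    using finA by (simp add: eventually_ball_finite_distrib)
  then obtain b where "b > 0" and b: "\<And>\<eta>. 0 < \<eta> \<Longrightarrow> \<eta> < b \<Longrightarrow> \<forall>al\<in>A. \<forall>x\<in>ball 0 R. \<forall>y. norm y \<le> \<eta> \<longrightarrow> \<bar>dpart al F (x + y) - dpart al F x\<bar> \<le> \<delta> / 2"
    unfolding eventually_at_right_field by blast
  define \<eta> where "\<eta> = min (b / 2) 1"
  have \<eta>: "0 < \<eta>" "\<eta> \<le> 1" "\<eta> < b" using \<open>b > 0\<close> by (auto simp: \<eta>_def)
  have osc: "\<bar>dpart al F (x + y) - dpart al F x\<bar> \<le> \<delta> / 2" if "al \<in> A" "x \<in> ball 0 R" "norm y \<le> \<eta>" for al x y
    using b[OF \<eta>(1,3)] that by blast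
  define \<phi>0 where "\<phi>0 = (\<lambda>y :: real ^ 'n. max 0 (\<eta> - norm y))"
  define I where "I = integral (cube C) \<phi>0"
  have c\<phi>0: "continuous_on S \<phi>0" for S unfolding \<phi>0_def by (intro continuous_intros)
  have ib: "f integrable_on (cube C :: (real ^ 'n) set)" if "continuous_on UNIV f" for f :: "'n rfun"
    unfolding cube_def by (rule integrable_continuous[OF continuous_on_subset[OF that]]) auto
  \<comment> \<open>On the ball of half the radius the tent function is at least \<eta> / 2.\<close>
  have I: "I > 0"
  proof -
    have "integral (ball (0 :: real ^ 'n) (\<eta> / 2)) (\<lambda>y. \<eta> / 2) \<le> integral (cube C) \<phi>0"
    proof -
      have sub: "ball (0 :: real ^ 'n) (\<eta> / 2) \<subseteq> cube C"
        using cball_subset_cube[of "\<eta> / 2" C] ball_subset_cball[of "0 :: real ^ 'n" "\<eta> / 2"] \<eta> R by (auto simp: C_def)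
      have "integral (ball (0 :: real ^ 'n) (\<eta> / 2)) (\<lambda>y. \<eta> / 2) \<le> integral (ball 0 (\<eta> / 2)) \<phi>0"
      proof (intro integral_le integrable_on_ball continuous_intros c\<phi>0)
        fix y :: "real ^ 'n" assume "y \<in> ball 0 (\<eta> / 2)"
        then have "\<eta> / 2 \<le> \<eta> - norm y" by simp
        also have "\<dots> \<le> \<phi>0 y" unfolding \<phi>0_def by (rule max.cobounded2)
        finally show "\<eta> / 2 \<le> \<phi>0 y" .
      qed
      also have "\<dots> \<le> integral (cube C) \<phi>0"
        by (intro integral_subset_le sub integrable_on_ball c\<phi>0 ib) (auto simp: \<phi>0_def)
      finally show ?thesis .
    qed
    moreover have "integral (ball (0 :: real ^ 'n) (\<eta> / 2)) (\<lambda>y. \<eta> / 2) = integral (ball (0 :: real ^ 'n) (\<eta> / 2)) (\<lambda>y. 1) * (\<eta> / 2)"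
      using integral_mult_left[of "ball (0 :: real ^ 'n) (\<eta> / 2)" "\<lambda>y. 1" "\<eta> / 2"] by simp
    moreover have "integral (ball (0 :: real ^ 'n) (\<eta> / 2)) (\<lambda>y. 1 :: real) > 0"
      by (rule poincare(1)[OF rp_intros(1)[of 0]]) (use \<eta> in simp)
    ultimately show ?thesis using \<eta> unfolding I_def by (smt (verit) mult_pos_pos half_gt_zero)
  qed
  define \<phi> where "\<phi> = (\<lambda>y. \<phi>0 y / I)"
  have c\<phi>: "continuous_on S \<phi>" for S unfolding \<phi>_def using I by (intro continuous_intros c\<phi>0) auto
  have \<phi>pos: "\<phi> y \<ge> 0" for y using I by (simp add: \<phi>_def \<phi>0_def)
  have \<phi>0': "\<phi> y = 0" if "norm y > \<eta>" for y using that by (simp add: \<phi>_def \<phi>0_def)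
  have \<phi>1: "integral (cube C) \<phi> = 1" unfolding \<phi>_def using I by (simp add: I_def)
  define vol where "vol = integral (cube C) (\<lambda>x :: real ^ 'n. 1 :: real)"
  have vol0: "vol \<ge> 0" unfolding vol_def by (intro integral_nonneg ib continuous_intros) auto
  \<comment> \<open>Chosen so that \<open>B * \<epsilon> * vol \<le> \<delta> / 2\<close>; the added
    1 avoids division by zero.\<close>
  define \<epsilon> where "\<epsilon> = \<delta> / (2 * (B * vol + 1))"
  have Bv: "B * vol \<ge> 0" using B0 vol0 by simp
  have \<epsilon>: "\<epsilon> > 0" using \<delta> Bv by (simp add: \<epsilon>_def)
  have "compact (cube C :: (real ^ 'n) set)" by (simp add: cube_def compact_cbox)
  then obtain P where P: "rp P" "\<And>y. y \<in> cube C \<Longrightarrow> \<bar>\<phi> y - P y\<bar> < \<epsilon>"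
    using Stone_Weierstrass_real_polynomial_function[OF _ c\<phi> \<epsilon>] by blast
  have cP: "continuous_on S P" for S by (rule rp_continuous[OF P(1)])
  \<comment> \<open>Two forms of one convolution, equal on the ball by substitution:
    \<open>q\<close> shows that it is a polynomial, \<open>G\<close> lets all derivatives fall on
    \<open>F\<close>.\<close>
  define q where "q = (\<lambda>x. integral (cube C) (\<lambda>z. F z * P (z - x)))"
  define G where "G = (\<lambda>x. integral (cube C) (\<lambda>y. F (x + y) * P y))"
  have "separable (\<lambda>x z. P ((-1) *\<^sub>R x + 1 *\<^sub>R z))" by (rule separable_affine[OF P(1)])
  then have "separable (\<lambda>x z. P (z - x))" by (simp add: algebra_simps)
  from separable_integral_weight[OF this Ck_continuous[OF F]] have rpq: "rp q" unfolding q_def cube_def by simp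
  have Gq: "G x = q x" if "x \<in> ball 0 R" for x
    unfolding G_def q_def
    by (rule integral_translate[OF Ck_continuous[OF F] supp cP]) (use that in \<open>auto simp: C_def\<close>)
  have "\<bar>dpart al q x - dpart al F x\<bar> \<le> \<delta>" if al: "length al \<le> m" and x: "x \<in> ball 0 R" for al x
  proof -
    have alA: "al \<in> A" using al by (simp add: A_def)
    let ?H = "dpart al F"
    have cHx: "continuous_on UNIV (\<lambda>y. ?H (x + y))"
      by (intro continuous_on_compose2[OF cH[OF alA, of UNIV]] continuous_intros) auto
    have "dpart al q x = dpart al G x" using dpart_local[OF _ x, of G q al] Gq by auto
    also have "\<dots> = integral (cube C) (\<lambda>y. ?H (x + y) * P y)"
      unfolding G_def cube_def using dpart_integral_translate[OF F cP al] by metis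
    finally have e1: "dpart al q x = integral (cube C) (\<lambda>y. ?H (x + y) * P y)" .
    have e2: "?H x = integral (cube C) (\<lambda>y. ?H x * \<phi> y)" using \<phi>1 by simp
    have "dpart al q x - ?H x = integral (cube C) (\<lambda>y. ?H (x + y) * P y - ?H x * \<phi> y)"
      unfolding e1 by (subst e2, rule integral_diff[symmetric])
        (intro ib continuous_intros cHx cP c\<phi>)+
    also have "norm \<dots> \<le> integral (cube C) (\<lambda>y. B * \<epsilon> + \<delta> / 2 * \<phi> y)"
    proof (rule integral_norm_bound_integral)
      show "(\<lambda>y. ?H (x + y) * P y - ?H x * \<phi> y) integrable_on cube C"
        by (intro ib continuous_intros cHx cP c\<phi>)
      show "(\<lambda>y. B * \<epsilon> + \<delta> / 2 * \<phi> y) integrable_on cube C"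
        by (intro ib continuous_intros c\<phi>)
      fix y :: "real ^ 'n" assume y: "y \<in> cube C"
      \<comment> \<open>The first part is the uniform error of the kernel, weighted by the bound of
        the derivative. The second is the oscillation within distance \<eta>, integrated against
        total mass one.\<close>
      have "?H (x + y) * P y - ?H x * \<phi> y = ?H (x + y) * (P y - \<phi> y) + (?H (x + y) - ?H x) * \<phi> y"
        by (simp add: algebra_simps)
      moreover have "\<bar>?H (x + y) * (P y - \<phi> y)\<bar> \<le> B * \<epsilon>"
        unfolding abs_mult using P(2)[OF y] B[OF alA] B0 by (intro mult_mono) (auto simp: abs_minus_commute)
      moreover have "\<bar>(?H (x + y) - ?H x) * \<phi> y\<bar> \<le> \<delta> / 2 * \<phi> y"
      proof (cases "norm y \<le> \<eta>")
        case True
        have "\<bar>\<phi> y\<bar> = \<phi> y" using \<phi>pos[of y] by simp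
        then show ?thesis unfolding abs_mult using mult_right_mono[OF osc[OF alA x True] \<phi>pos[of y]] by simp
      next
        case False
        then show ?thesis using \<phi>0'[of y] by simp
      qed
      ultimately show "norm (?H (x + y) * P y - ?H x * \<phi> y) \<le> B * \<epsilon> + \<delta> / 2 * \<phi> y"
        unfolding real_norm_def by linarith
    qed
    also have "\<dots> = B * \<epsilon> * vol + \<delta> / 2"
    proof -
      have "integral (cube C) (\<lambda>y :: real ^ 'n. B * \<epsilon>) = B * \<epsilon> * vol"
        using integral_mult_right[of "cube C :: (real ^ 'n) set" "B * \<epsilon>" "\<lambda>x. 1"] unfolding vol_def by simp
      then show ?thesis using \<phi>1 by (subst integral_add) (auto intro!: ib continuous_intros c\<phi>)
    qed
    also have "B * \<epsilon> * vol \<le> \<delta> / 2"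
    proof -
      have "B * \<epsilon> * vol = \<delta> / 2 * (B * vol / (B * vol + 1))" by (simp add: \<epsilon>_def)
      also have "\<dots> \<le> \<delta> / 2 * 1" using \<delta> Bv by (intro mult_left_mono) (auto simp: divide_le_eq)
      finally show ?thesis by simp
    qed
    finally show ?thesis by simp
  qed
  then show ?thesis using that[OF rpq] by blast
qed

section \<open>Dilations and density of polynomials\<close>

lemma has_pd_scale:
  assumes "has_pd i f a (r *\<^sub>R x)" shows "has_pd i (\<lambda>x. f (r *\<^sub>R x)) (r * a) x"
proof -
  have "((\<lambda>s. f (r *\<^sub>R x + s *\<^sub>R axis i 1)) has_real_derivative a) (at (r * 0))"
    using assms unfolding has_pd_def by simp
  moreover have "((\<lambda>t. r * t) has_real_derivative r) (at 0)" by (auto intro!: derivative_eq_intros)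
  ultimately have "((\<lambda>t. f (r *\<^sub>R x + (r * t) *\<^sub>R axis i 1)) has_real_derivative a * r) (at 0)"
    by (rule DERIV_chain2)
  then show ?thesis unfolding has_pd_def by (simp add: scaleR_add_right mult.commute)
qed

lemma dpart_scale:
  assumes f: "smooth_cl R f" and r: "0 < r" and x: "x \<in> ball 0 (R / r)"
  shows "dpart al (\<lambda>x. f (r *\<^sub>R x)) x = r ^ length al * dpart al f (r *\<^sub>R x)"
  using x
proof (induction al arbitrary: x)
  case (Cons i al)
  have rx: "r *\<^sub>R x \<in> ball 0 R" using Cons.prems r by (simp add: field_simps)
  have "has_pd i (\<lambda>x. dpart al f (r *\<^sub>R x)) (r * pd i (dpart al f) (r *\<^sub>R x)) x"
    by (rule has_pd_scale[OF smooth_cl_has_pd[OF f rx]])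
  from has_pd_cmult[OF this, of "r ^ length al"]
  have "pd i (\<lambda>x. r ^ length al * dpart al f (r *\<^sub>R x)) x = r ^ length al * (r * pd i (dpart al f) (r *\<^sub>R x))"
    by (rule has_pd_imp)
  moreover have "pd i (dpart al (\<lambda>x. f (r *\<^sub>R x))) x = pd i (\<lambda>x. r ^ length al * dpart al f (r *\<^sub>R x)) x"
    by (rule pd_local[OF Cons.prems Cons.IH])
  ultimately show ?case by simp
qed simp

lemma smooth_on_ball_scale:
  assumes f: "smooth_cl R f" and r: "0 < r"
  shows "smooth_on_ball (R / r) (\<lambda>x. f (r *\<^sub>R x))"
  unfolding smooth_on_ball_def
proof (intro allI conjI ballI)
  fix al
  obtain g where g: "continuous_on (cball 0 R) g" "\<And>x. x \<in> ball 0 R \<Longrightarrow> g x = dpart al f x"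
    using smooth_cl_cont_ext[OF f, of al] unfolding cont_ext_def by blast
  have in_ball: "r *\<^sub>R x \<in> ball 0 R" if "x \<in> ball 0 (R / r)" for x :: "real ^ 'a"
    using that r by (simp add: field_simps)
  have "continuous_on (ball 0 (R / r)) (\<lambda>x. r ^ length al * g (r *\<^sub>R x))"
  proof (intro continuous_intros continuous_on_compose2[OF g(1)])
    show "(*\<^sub>R) r ` ball 0 (R / r) \<subseteq> cball (0 :: real ^ 'a) R"
    proof
      fix y :: "real ^ 'a" assume "y \<in> (*\<^sub>R) r ` ball 0 (R / r)"
      then obtain x where "x \<in> ball 0 (R / r)" "y = r *\<^sub>R x" by blast
      then show "y \<in> cball 0 R" using in_ball[of x] by (simp add: less_imp_le)
    qed
  qed
  then show "continuous_on (ball 0 (R / r)) (dpart al (\<lambda>x. f (r *\<^sub>R x)))"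
    by (rule continuous_on_eq) (use g(2) in_ball dpart_scale[OF f r] in auto)
  fix i and x :: "real ^ 'a" assume x: "x \<in> ball 0 (R / r)"
  have "has_pd i (\<lambda>x. dpart al f (r *\<^sub>R x)) (r * pd i (dpart al f) (r *\<^sub>R x)) x"
    by (rule has_pd_scale[OF smooth_cl_has_pd[OF f in_ball[OF x]]])
  from has_pd_cmult[OF this, of "r ^ length al"]
  have "has_pd i (\<lambda>x. r ^ length al * dpart al f (r *\<^sub>R x)) (dpart (i # al) (\<lambda>x. f (r *\<^sub>R x)) x) x"
    using dpart_scale[OF f r x, of "i # al"] by (simp add: mult_ac)
  then show "has_pd i (dpart al (\<lambda>x. f (r *\<^sub>R x))) (dpart (i # al) (\<lambda>x. f (r *\<^sub>R x)) x) x"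
    by (rule has_pd_local[OF _ x]) (rule dpart_scale[OF f r, symmetric])
qed

text \<open>The continuous extension to the closed ball is uniformly continuous, which controls the
  passage from x to r x, and bounded, which controls the factor
  \<open>r ^ length al\<close>.\<close>

lemma scale_approx:
  assumes f: "smooth_cl R f" and R: "R > 0" and \<delta>: "\<delta> > 0"
  shows "\<forall>\<^sub>F r in at_left (1::real). \<forall>x\<in>ball 0 R. \<bar>r ^ length al * dpart al f (r *\<^sub>R x) - dpart al f x\<bar> \<le> \<delta>"
proof -
  obtain g where g: "continuous_on (cball 0 R) g" "\<And>x. x \<in> ball 0 R \<Longrightarrow> g x = dpart al f x"
    using smooth_cl_cont_ext[OF f, of al] unfolding cont_ext_def by blast
  have "compact (g ` cball 0 R)" by (intro compact_continuous_image g) auto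
  then obtain B where B: "\<forall>y\<in>g ` cball 0 R. norm y \<le> B" using compact_imp_bounded bounded_iff by metis
  have B0: "B \<ge> 0" using order_trans[OF norm_ge_zero bspec[OF B, of "g 0"]] R by simp
  have "uniformly_continuous_on (cball 0 R) g" by (intro compact_uniformly_continuous g) auto
  then obtain d where d: "d > 0" "\<And>x y. x \<in> cball 0 R \<Longrightarrow> y \<in> cball 0 R \<Longrightarrow> dist y x < d \<Longrightarrow> dist (g y) (g x) < \<delta> / 2"
    using \<delta> unfolding uniformly_continuous_on_def by (meson half_gt_zero)
  have "((\<lambda>r::real. \<bar>r ^ length al - 1\<bar> * B) \<longlongrightarrow> \<bar>1 ^ length al - 1\<bar> * B) (at_left 1)"
    by (intro tendsto_intros)
  then have "((\<lambda>r::real. \<bar>r ^ length al - 1\<bar> * B) \<longlongrightarrow> 0) (at_left 1)" by simp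
  then have e1: "\<forall>\<^sub>F r in at_left (1::real). \<bar>r ^ length al - 1\<bar> * B < \<delta> / 2"
    by (rule order_tendstoD) (use \<delta> in simp)
  have e2: "\<forall>\<^sub>F r in at_left (1::real). max 0 (1 - d / R) < r"
    by (rule eventually_at_leftI[of "max 0 (1 - d / R)"]) (use d R in auto)
  have e3: "\<forall>\<^sub>F r in at_left (1::real). r < 1"
    by (rule eventually_at_leftI[of 0]) auto
  from e1 e2 e3 show ?thesis
  proof eventually_elim
    case (elim r)
    have r: "0 < r" "r < 1" and rd: "(1 - r) * R < d" using elim R by (auto simp: field_simps)
    show ?case
    proof
      fix x :: "real ^ 'a" assume x: "x \<in> ball 0 R"
      have nx: "norm x < R" using x by simp
      have "r * norm x \<le> norm x" using r by (simp add: mult_left_le_one_le)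
      then have rx: "r *\<^sub>R x \<in> ball 0 R" using nx r by simp
      have "dist (r *\<^sub>R x) x = (1 - r) * norm x"
      proof -
        have "r *\<^sub>R x - x = (r - 1) *\<^sub>R x" by (simp add: scaleR_diff_left)
        then show ?thesis using r by (simp add: dist_norm)
      qed
      also have "\<dots> \<le> (1 - r) * R" using nx r by (intro mult_left_mono) auto
      finally have "dist (r *\<^sub>R x) x < d" using rd by simp
      then have "dist (g (r *\<^sub>R x)) (g x) < \<delta> / 2" using x rx by (intro d(2)) auto
      then have 1: "\<bar>g (r *\<^sub>R x) - g x\<bar> < \<delta> / 2" by (simp add: dist_real_def)
      have "\<bar>(r ^ length al - 1) * g (r *\<^sub>R x)\<bar> \<le> \<bar>r ^ length al - 1\<bar> * B"
        unfolding abs_mult using B rx by (intro mult_left_mono) auto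
      then have "\<bar>(r ^ length al - 1) * g (r *\<^sub>R x)\<bar> < \<delta> / 2" using elim by linarith
      moreover have "(r ^ length al - 1) * g (r *\<^sub>R x) + (g (r *\<^sub>R x) - g x) = r ^ length al * g (r *\<^sub>R x) - g x"
        by (simp add: left_diff_distrib)
      ultimately have "\<bar>r ^ length al * g (r *\<^sub>R x) - g x\<bar> \<le> \<delta>"
        using 1 by linarith
      then show "\<bar>r ^ length al * dpart al f (r *\<^sub>R x) - dpart al f x\<bar> \<le> \<delta>"
        using g(2) x rx by simp
    qed
  qed
qed

text \<open>Smoothness is given only up to the boundary. Dilating by r < 1 yields a function smooth
  on the larger ball of radius R / r, which leaves room for a cutoff beyond R; the compactly
  supported result can then be convolved. Half of \<delta> pays for the dilation, half for the
  polynomial.\<close>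

theorem polynomial_dense:
  fixes f :: "('n::finite) rfun"
  assumes f: "smooth_cl R f" and R: "R > 0" and \<delta>: "\<delta> > 0"
  obtains q where "rp q" "small R m \<delta> (\<lambda>x. q x + (-1) * f x)"
proof -
  have "\<forall>al\<in>{al :: 'n list. length al \<le> m}. \<forall>\<^sub>F r in at_left (1::real).
      \<forall>x\<in>ball 0 R. \<bar>r ^ length al * dpart al f (r *\<^sub>R x) - dpart al f x\<bar> \<le> \<delta> / 2"
    using scale_approx[OF f R, of "\<delta> / 2"] \<delta> by auto
  then have "\<forall>\<^sub>F r in at_left (1::real). \<forall>al\<in>{al :: 'n list. length al \<le> m}.
      \<forall>x\<in>ball 0 R. \<bar>r ^ length al * dpart al f (r *\<^sub>R x) - dpart al f x\<bar> \<le> \<delta> / 2"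
    by (simp only: eventually_ball_finite_distrib[OF finite_words])
  moreover have "\<forall>\<^sub>F r in at_left (1::real). 0 < r \<and> r < 1"
    by (rule eventually_at_leftI[of 0]) auto
  ultimately have "\<forall>\<^sub>F r in at_left (1::real). (0 < r \<and> r < 1) \<and> (\<forall>al\<in>{al :: 'n list. length al \<le> m}.
      \<forall>x\<in>ball 0 R. \<bar>r ^ length al * dpart al f (r *\<^sub>R x) - dpart al f x\<bar> \<le> \<delta> / 2)"
    by eventually_elim auto
  from eventually_happens[OF this]
  obtain r where "(0 < r \<and> r < 1) \<and> (\<forall>al\<in>{al :: 'n list. length al \<le> m}.
      \<forall>x\<in>ball 0 R. \<bar>r ^ length al * dpart al f (r *\<^sub>R x) - dpart al f x\<bar> \<le> \<delta> / 2)"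
    by (auto simp: trivial_limit_at_left_real)
  then have r: "0 < r" "r < 1" and approx: "\<And>al x. length al \<le> m \<Longrightarrow> x \<in> ball 0 R \<Longrightarrow>
      \<bar>r ^ length al * dpart al f (r *\<^sub>R x) - dpart al f x\<bar> \<le> \<delta> / 2"
    by (simp_all del: mem_ball)
  let ?h = "\<lambda>x. f (r *\<^sub>R x)"
  define \<rho> where "\<rho> = R / r"
  define \<sigma> where "\<sigma> = (R + \<rho>) / 2"
  have "R < \<rho>" using r R by (simp add: \<rho>_def field_simps)
  then have \<sigma>: "R < \<sigma>" "\<sigma> < \<rho>" by (auto simp: \<sigma>_def)
  obtain \<theta> :: "'n rfun" where \<theta>: "Ck m \<theta>" "\<And>x. norm x < R \<Longrightarrow> \<theta> x = 1" "\<And>x. norm x > \<sigma> \<Longrightarrow> \<theta> x = 0"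
    using cutoff_exists[OF R \<sigma>(1)] by blast
  define F where "F = cut \<rho> ?h \<theta>"
  have CF: "Ck m F" unfolding F_def \<rho>_def
    by (rule Ck_cut[OF \<sigma>(2)[unfolded \<rho>_def] smooth_on_ball_scale[OF f r(1)] \<theta>(1,3)])
  have F0: "F x = 0" if "norm x > \<sigma>" for x using \<theta>(3)[OF that] by (simp add: F_def cut_def)
  have Fh: "F x = ?h x" if "x \<in> ball 0 R" for x
    using that \<theta>(2)[of x] \<open>R < \<rho>\<close> by (simp add: F_def cut_def)
  have "\<delta> / 2 > 0" using \<delta> by simp
  from polynomial_approx_Ck[OF CF F0 R \<sigma>(1) this]
  obtain q where q: "rp q" "\<And>al x. length al \<le> m \<Longrightarrow> x \<in> ball 0 R \<Longrightarrow> \<bar>dpart al q x - dpart al F x\<bar> \<le> \<delta> / 2" by blast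
  have "small R m \<delta> (\<lambda>x. q x + (-1) * f x)"
    unfolding small_def
  proof (intro conjI allI impI ballI)
    show "smooth_cl R (\<lambda>x. q x + (-1) * f x)" by (intro smooth_cl_add smooth_cl_rp q smooth_cl_cmult f)
    fix al :: "'n list" and x :: "real ^ 'n" assume al: "length al \<le> m" and x: "x \<in> ball 0 R"
    have "x \<in> ball 0 (R / r)" using x \<open>R < \<rho>\<close> by (simp add: \<rho>_def)
    then have "dpart al F x = r ^ length al * dpart al f (r *\<^sub>R x)"
      using dpart_local[OF Fh x, where al=al] dpart_scale[OF f r(1)] by simp
    then have "\<bar>dpart al q x - dpart al f x\<bar> \<le> \<delta>"
      using q(2)[OF al x] approx[OF al x] by linarith
    moreover have "dpart al (\<lambda>x. q x + (-1) * f x) x = dpart al q x + (-1) * dpart al f x"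
      using dpart_add_ball[OF smooth_cl_rp[OF q(1)] smooth_cl_cmult[OF f, of "-1"] x, of al]
        dpart_cmult_ball[OF f x, of al "-1"] by simp
    ultimately show "\<bar>dpart al (\<lambda>x. q x + (-1) * f x) x\<bar> \<le> \<delta>" by simp
  qed
  with q(1) show ?thesis by (rule that)
qed

section \<open>Semigroups defined on a dense invariant core\<close>

text \<open>Since \<open>N\<close> is only a seminorm, the laws of the flow say that
  \<open>N\<close> of a difference vanishes. \<open>T_deriv\<close> and \<open>T_average\<close>
  encode T h p - p as the integral of T r (L p) and as \<open>L\<close> of an integral, avoiding
  vector-valued integration: one bounds the deviation from h q, the other asks for an element that
  behaves like the mean of T r p over [0, h]. \<open>K1\<close> bounds the flow on the unit
  interval, and \<open>dense\<close> is density in the graph norm.\<close>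

locale core_flow =
  fixes D P :: "('n::finite) rpair set" and N :: "'n rpair \<Rightarrow> real" and L :: "'n rpair \<Rightarrow> 'n rpair"
    and T :: "real \<Rightarrow> 'n rpair \<Rightarrow> 'n rpair" and K :: "real \<Rightarrow> real" and K1 :: real
  assumes D_padd: "u \<in> D \<Longrightarrow> v \<in> D \<Longrightarrow> padd u v \<in> D"
    and D_pscale: "u \<in> D \<Longrightarrow> pscale c u \<in> D"
    and N_padd: "u \<in> D \<Longrightarrow> v \<in> D \<Longrightarrow> N (padd u v) \<le> N u + N v"
    and N_pscale: "u \<in> D \<Longrightarrow> N (pscale c u) = \<bar>c\<bar> * N u"
    and N_nonneg: "u \<in> D \<Longrightarrow> 0 \<le> N u"
    and P_D: "P \<subseteq> D" and P_padd: "u \<in> P \<Longrightarrow> v \<in> P \<Longrightarrow> padd u v \<in> P"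
    and P_pscale: "u \<in> P \<Longrightarrow> pscale c u \<in> P"
    and L_D: "u \<in> D \<Longrightarrow> L u \<in> D" and L_P: "u \<in> P \<Longrightarrow> L u \<in> P"
    and T_P: "0 \<le> t \<Longrightarrow> p \<in> P \<Longrightarrow> T t p \<in> P"
    and T_bound: "0 \<le> t \<Longrightarrow> p \<in> P \<Longrightarrow> N (T t p) \<le> K t * N p"
    and K: "0 \<le> t \<Longrightarrow> 0 \<le> K t" "0 \<le> t \<Longrightarrow> t \<le> 1 \<Longrightarrow> K t \<le> K1"
    and T_add: "0 \<le> t \<Longrightarrow> p \<in> P \<Longrightarrow> q \<in> P \<Longrightarrow> N (psub (T t (padd p q)) (padd (T t p) (T t q))) = 0"
    and T_scale: "0 \<le> t \<Longrightarrow> p \<in> P \<Longrightarrow> N (psub (T t (pscale c p)) (pscale c (T t p))) = 0"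
    and T_0: "p \<in> P \<Longrightarrow> N (psub (T 0 p) p) = 0"
    and T_semi: "0 \<le> t \<Longrightarrow> 0 \<le> s \<Longrightarrow> p \<in> P \<Longrightarrow> N (psub (T (t + s) p) (T t (T s p))) = 0"
    and T_cont: "p \<in> P \<Longrightarrow> ((\<lambda>t. N (psub (T t p) p)) \<longlongrightarrow> 0) (at_right 0)"
    and T_deriv: "p \<in> P \<Longrightarrow> q \<in> P \<Longrightarrow> 0 \<le> h \<Longrightarrow> (\<And>r. 0 \<le> r \<Longrightarrow> r \<le> h \<Longrightarrow> N (psub (T r (L p)) q) \<le> c) \<Longrightarrow>
      N (psub (psub (T h p) p) (pscale h q)) \<le> h * c"
    and T_average: "p \<in> P \<Longrightarrow> 0 < h \<Longrightarrow> \<exists>m\<in>P. N (psub (L m) (pscale (1 / h) (psub (T h p) p))) = 0 \<and>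
      (\<forall>c. (\<forall>r. 0 \<le> r \<and> r \<le> h \<longrightarrow> N (psub (T r p) p) \<le> c) \<longrightarrow> N (psub m p) \<le> c)"
    and dense: "u \<in> D \<Longrightarrow> 0 < e \<Longrightarrow> \<exists>p\<in>P. N (psub p u) < e \<and> N (psub (L p) (L u)) < e"
begin

abbreviation d :: "'n rpair \<Rightarrow> 'n rpair \<Rightarrow> real" where "d u v \<equiv> N (psub u v)"

lemma PD: "p \<in> P \<Longrightarrow> p \<in> D" using P_D by blast

lemma D_psub: "u \<in> D \<Longrightarrow> v \<in> D \<Longrightarrow> psub u v \<in> D"
  unfolding psub_def by (intro D_padd D_pscale)

lemma P_psub: "u \<in> P \<Longrightarrow> v \<in> P \<Longrightarrow> psub u v \<in> P"
  unfolding psub_def by (intro P_padd P_pscale)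

lemma d_nonneg: "u \<in> D \<Longrightarrow> v \<in> D \<Longrightarrow> 0 \<le> d u v"
  by (intro N_nonneg D_psub)

lemma d_triangle: assumes "u \<in> D" "v \<in> D" "w \<in> D" shows "d u w \<le> d u v + d v w"
proof -
  have "psub u w = padd (psub u v) (psub v w)" by (simp add: psub_def padd_def pscale_def)
  then show ?thesis using N_padd[OF D_psub[OF assms(1,2)] D_psub[OF assms(2,3)]] by simp
qed

lemma d_comm: assumes "u \<in> D" "v \<in> D" shows "d u v = d v u"
proof -
  have "psub u v = pscale (-1) (psub v u)" by (simp add: psub_def padd_def pscale_def)
  then show ?thesis using N_pscale[OF D_psub[OF assms(2,1)], of "-1"] by simp
qed

lemma N_le_d: assumes "u \<in> D" "v \<in> D" shows "N u \<le> N v + d u v"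
proof -
  have "u = padd v (psub u v)" by (simp add: psub_def padd_def pscale_def)
  then show ?thesis using N_padd[OF assms(2) D_psub[OF assms]] by simp
qed

lemma d_padd:
  assumes "u \<in> D" "v \<in> D" "u' \<in> D" "v' \<in> D" shows "d (padd u v) (padd u' v') \<le> d u u' + d v v'"
proof -
  have "psub (padd u v) (padd u' v') = padd (psub u u') (psub v v')"
    by (simp add: psub_def padd_def pscale_def algebra_simps)
  then show ?thesis using N_padd[OF D_psub[OF assms(1,3)] D_psub[OF assms(2,4)]] by simp
qed

lemma d_pscale: assumes "u \<in> D" "v \<in> D" shows "d (pscale c u) (pscale c v) = \<bar>c\<bar> * d u v"
proof -
  have "psub (pscale c u) (pscale c v) = pscale c (psub u v)"
    by (simp add: psub_def padd_def pscale_def algebra_simps)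
  then show ?thesis using N_pscale[OF D_psub[OF assms]] by simp
qed

lemma d_psub:
  assumes "u \<in> D" "v \<in> D" "u' \<in> D" "v' \<in> D" shows "d (psub u v) (psub u' v') \<le> d u u' + d v v'"
proof -
  have "d (psub u v) (psub u' v') \<le> d u u' + d (pscale (-1) v) (pscale (-1) v')"
    unfolding psub_def[of u v] psub_def[of u' v'] by (intro d_padd D_pscale assms)
  then show ?thesis using d_pscale[OF assms(2,4), of "-1"] by simp
qed

text \<open>The flow is additive only up to \<open>N\<close>, so the bound goes through p = q + (p -
  q), which is an exact identity of functions.\<close>

lemma T_lipschitz: assumes t: "0 \<le> t" and p: "p \<in> P" and q: "q \<in> P" shows "d (T t p) (T t q) \<le> K t * d p q"
proof -
  let ?r = "psub p q"
  have r: "?r \<in> P" by (rule P_psub[OF p q])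
  note TD = T_P[OF t p, THEN PD] T_P[OF t q, THEN PD] T_P[OF t r, THEN PD]
  have "p = padd q ?r" by (simp add: psub_def padd_def pscale_def)
  then have z: "d (T t p) (padd (T t q) (T t ?r)) = 0" using T_add[OF t q r] by simp
  have "psub (padd (T t q) (T t ?r)) (T t q) = T t ?r" by (simp add: psub_def padd_def pscale_def)
  then have "d (T t p) (T t q) \<le> 0 + N (T t ?r)"
    using d_triangle[OF TD(1) D_padd[OF TD(2,3)] TD(2)] z by simp
  then show ?thesis using T_bound[OF t r] by simp
qed

subsection \<open>The completion\<close>

abbreviation X :: "(nat \<Rightarrow> 'n rpair) set" where "X \<equiv> compl D N"

abbreviation cd :: "(nat \<Rightarrow> 'n rpair) \<Rightarrow> (nat \<Rightarrow> 'n rpair) \<Rightarrow> real" where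
  "cd U V \<equiv> cnorm N (csub U V)"

lemma X_D: "U \<in> X \<Longrightarrow> U n \<in> D" by (simp add: compl_def)

lemma XI: assumes "\<And>n. U n \<in> D" "\<And>e. 0 < e \<Longrightarrow> \<exists>M. \<forall>m\<ge>M. \<forall>n\<ge>M. d (U m) (U n) < e" shows "U \<in> X"
  using assms by (simp add: compl_def)

lemma X_Cauchy: "U \<in> X \<Longrightarrow> 0 < e \<Longrightarrow> \<exists>M. \<forall>m\<ge>M. \<forall>n\<ge>M. d (U m) (U n) < e"
  by (simp add: compl_def)

lemma X_near:
  assumes U: "U \<in> X" and V: "\<And>n. V n \<in> D" and lim: "(\<lambda>n. d (V n) (U n)) \<longlonglongrightarrow> 0"
  shows "V \<in> X"
proof (rule XI[OF V])
  fix e :: real assume e: "0 < e"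
  obtain M where M: "\<And>m n. m \<ge> M \<Longrightarrow> n \<ge> M \<Longrightarrow> d (U m) (U n) < e / 3"
    using X_Cauchy[OF U, of "e / 3"] e by auto
  obtain M' where M': "\<And>n. n \<ge> M' \<Longrightarrow> d (V n) (U n) < e / 3"
    using order_tendstoD(2)[OF lim, of "e / 3"] e unfolding eventually_sequentially by auto
  have "d (V m) (V n) < e" if "m \<ge> max M M'" "n \<ge> max M M'" for m n
  proof -
    note D = V[of m] V[of n] X_D[OF U, of m] X_D[OF U, of n]
    have "d (V m) (V n) \<le> d (V m) (U m) + d (U m) (V n)" by (rule d_triangle[OF D(1,3,2)])
    also have "d (U m) (V n) \<le> d (U m) (U n) + d (U n) (V n)" by (rule d_triangle[OF D(3,4,2)])
    also have "d (U n) (V n) = d (V n) (U n)" by (rule d_comm[OF D(4,2)])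
    finally show ?thesis using M[of m n] M'[of m] M'[of n] that by simp
  qed
  then show "\<exists>M. \<forall>m\<ge>M. \<forall>n\<ge>M. d (V m) (V n) < e" by blast
qed

lemma X_csub: assumes "U \<in> X" "V \<in> X" shows "csub U V \<in> X"
proof (rule XI)
  show "csub U V n \<in> D" for n unfolding csub_def by (intro D_psub X_D assms)
  fix e :: real assume e: "0 < e"
  obtain M where M: "\<And>m n. m \<ge> M \<Longrightarrow> n \<ge> M \<Longrightarrow> d (U m) (U n) < e / 2"
    using X_Cauchy[OF assms(1), of "e / 2"] e by auto
  obtain M' where M': "\<And>m n. m \<ge> M' \<Longrightarrow> n \<ge> M' \<Longrightarrow> d (V m) (V n) < e / 2"
    using X_Cauchy[OF assms(2), of "e / 2"] e by auto
  have "d (csub U V m) (csub U V n) < e" if "m \<ge> max M M'" "n \<ge> max M M'" for m n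
    unfolding csub_def
    using d_psub[OF X_D[OF assms(1)] X_D[OF assms(2)] X_D[OF assms(1)] X_D[OF assms(2)], of m m n n]
      M[of m n] M'[of m n] that by simp
  then show "\<exists>M. \<forall>m\<ge>M. \<forall>n\<ge>M. d (csub U V m) (csub U V n) < e" by blast
qed

lemma X_cscale: assumes "U \<in> X" shows "cscale c U \<in> X"
proof (rule XI)
  show "cscale c U n \<in> D" for n unfolding cscale_def by (intro D_pscale X_D assms)
  fix e :: real assume e: "0 < e"
  define e' where "e' = e / (\<bar>c\<bar> + 1)"
  have e': "0 < e'" using e by (simp add: e'_def)
  obtain M where M: "\<And>m n. m \<ge> M \<Longrightarrow> n \<ge> M \<Longrightarrow> d (U m) (U n) < e'"
    using X_Cauchy[OF assms e'] by auto
  have "d (cscale c U m) (cscale c U n) < e" if "m \<ge> M" "n \<ge> M" for m n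
  proof -
    have "\<bar>c\<bar> * d (U m) (U n) \<le> \<bar>c\<bar> * e'" using M[OF that] by (intro mult_left_mono) auto
    also have "\<dots> < (\<bar>c\<bar> + 1) * e'" using e' by (intro mult_strict_right_mono) auto
    also have "\<dots> = e" by (simp add: e'_def)
    finally show ?thesis unfolding cscale_def d_pscale[OF X_D[OF assms] X_D[OF assms]] .
  qed
  then show "\<exists>M. \<forall>m\<ge>M. \<forall>n\<ge>M. d (cscale c U m) (cscale c U n) < e" by blast
qed

lemma cadd_eq: "cadd U V = csub U (cscale (-1) V)"
  by (rule ext) (simp add: cadd_def csub_def cscale_def psub_def pscale_def padd_def)

lemma X_cadd: "U \<in> X \<Longrightarrow> V \<in> X \<Longrightarrow> cadd U V \<in> X"
  unfolding cadd_eq by (intro X_csub X_cscale)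

lemma d_self: "u \<in> D \<Longrightarrow> d u u = 0"
proof -
  assume u: "u \<in> D"
  have "psub u u = pscale 0 u" by (simp add: psub_def padd_def pscale_def)
  then show ?thesis using N_pscale[OF u, of 0] by simp
qed

lemma X_cemb: "u \<in> D \<Longrightarrow> cemb u \<in> X"
  by (rule XI) (simp_all add: cemb_def d_self)

lemma cnorm_lim: assumes U: "U \<in> X" shows "(\<lambda>n. N (U n)) \<longlonglongrightarrow> cnorm N U"
proof -
  have "Cauchy (\<lambda>n. N (U n))"
  proof (rule metric_CauchyI)
    fix e :: real assume "0 < e"
    then obtain M where M: "\<And>m n. m \<ge> M \<Longrightarrow> n \<ge> M \<Longrightarrow> d (U m) (U n) < e" using X_Cauchy[OF U] by blast
    have "dist (N (U m)) (N (U n)) < e" if "m \<ge> M" "n \<ge> M" for m n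
      using N_le_d[OF X_D[OF U, of m] X_D[OF U, of n]] N_le_d[OF X_D[OF U, of n] X_D[OF U, of m]]
        M[OF that] M[OF that(2,1)] unfolding dist_real_def by linarith
    then show "\<exists>M. \<forall>m\<ge>M. \<forall>n\<ge>M. dist (N (U m)) (N (U n)) < e" by blast
  qed
  then show ?thesis
    unfolding cnorm_def by (simp add: convergent_LIMSEQ_iff[symmetric] Cauchy_convergent)
qed

lemma cd_lim: assumes "U \<in> X" "V \<in> X" shows "(\<lambda>n. d (U n) (V n)) \<longlonglongrightarrow> cd U V"
  using cnorm_lim[OF X_csub[OF assms]] by (simp add: csub_def)

lemma cnorm_nonneg: "U \<in> X \<Longrightarrow> 0 \<le> cnorm N U"
  by (rule LIMSEQ_le_const[OF cnorm_lim]) (auto intro: N_nonneg X_D)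

lemma cd_nonneg: "U \<in> X \<Longrightarrow> V \<in> X \<Longrightarrow> 0 \<le> cd U V"
  by (intro cnorm_nonneg X_csub)

lemma cd_triangle: assumes "U \<in> X" "V \<in> X" "W \<in> X" shows "cd U W \<le> cd U V + cd V W"
  by (rule LIMSEQ_le[OF cd_lim[OF assms(1,3)] tendsto_add[OF cd_lim[OF assms(1,2)] cd_lim[OF assms(2,3)]]])
    (auto intro: d_triangle X_D assms)

lemma cd_comm: assumes "U \<in> X" "V \<in> X" shows "cd U V = cd V U"
proof -
  have "(\<lambda>n. d (U n) (V n)) = (\<lambda>n. d (V n) (U n))"
    by (rule ext) (intro d_comm X_D assms)
  then show ?thesis unfolding cnorm_def csub_def by simp
qed

lemma cd_cscale: assumes "U \<in> X" "V \<in> X" shows "cd (cscale c U) (cscale c V) = \<bar>c\<bar> * cd U V"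
proof (rule LIMSEQ_unique)
  show "(\<lambda>n. d (cscale c U n) (cscale c V n)) \<longlonglongrightarrow> cd (cscale c U) (cscale c V)"
    by (intro cd_lim X_cscale assms)
  have "(\<lambda>n. d (cscale c U n) (cscale c V n)) = (\<lambda>n. \<bar>c\<bar> * d (U n) (V n))"
    unfolding cscale_def by (rule ext) (intro d_pscale X_D assms)
  then show "(\<lambda>n. d (cscale c U n) (cscale c V n)) \<longlonglongrightarrow> \<bar>c\<bar> * cd U V"
    using tendsto_mult_left[OF cd_lim[OF assms]] by simp
qed

lemma cd_csub:
  assumes "U \<in> X" "V \<in> X" "U' \<in> X" "V' \<in> X"
  shows "cd (csub U V) (csub U' V') \<le> cd U U' + cd V V'"
proof (rule LIMSEQ_le[OF cd_lim[OF X_csub[OF assms(1,2)] X_csub[OF assms(3,4)]]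
      tendsto_add[OF cd_lim[OF assms(1,3)] cd_lim[OF assms(2,4)]]])
  show "\<exists>N'. \<forall>n\<ge>N'. d (csub U V n) (csub U' V' n) \<le> d (U n) (U' n) + d (V n) (V' n)"
    unfolding csub_def using d_psub X_D assms by auto
qed

lemma cd_cemb: "cd (cemb u) (cemb v) = d u v"
  by (simp add: cnorm_def csub_def cemb_def)

lemma cnorm_cemb: "cnorm N (cemb u) = N u"
  by (simp add: cnorm_def cemb_def)

lemma ceq_iff: assumes "U \<in> X" "V \<in> X" shows "ceq N U V \<longleftrightarrow> cd U V = 0"
  unfolding ceq_def using cd_lim[OF assms] LIMSEQ_unique by auto

text \<open>The n-th entry is replaced by a polynomial pair within 1 / (n + 1), so the new sequence
  represents the same element. Applying the flow to a selected representative makes \<open>S\<close>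
  well defined only up to \<open>ceq\<close>, as the notion of semigroup here permits.\<close>

definition appr :: "(nat \<Rightarrow> 'n rpair) \<Rightarrow> nat \<Rightarrow> 'n rpair" where
  "appr U n = (SOME p. p \<in> P \<and> d p (U n) < 1 / real (Suc n))"

definition S :: "real \<Rightarrow> (nat \<Rightarrow> 'n rpair) \<Rightarrow> nat \<Rightarrow> 'n rpair" where
  "S t U = (\<lambda>n. T t (appr U n))"

lemma appr: assumes "U \<in> X" shows "appr U n \<in> P" "d (appr U n) (U n) \<le> 1 / real (Suc n)"
proof -
  have "\<exists>p. p \<in> P \<and> d p (U n) < 1 / real (Suc n)"
    using dense[OF X_D[OF assms], of "1 / real (Suc n)" n] by auto
  from someI_ex[OF this] show "appr U n \<in> P" "d (appr U n) (U n) \<le> 1 / real (Suc n)"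
    unfolding appr_def by auto
qed

lemma inv_Suc_lim: "(\<lambda>n. c * (1 / real (Suc n))) \<longlonglongrightarrow> 0"
  using tendsto_mult_left[OF LIMSEQ_Suc[OF lim_1_over_n], of c] by simp

lemma appr_lim: assumes "U \<in> X" shows "(\<lambda>n. d (appr U n) (U n)) \<longlonglongrightarrow> 0"
proof (rule tendsto_sandwich[OF _ _ tendsto_const inv_Suc_lim[of 1]])
  show "\<forall>\<^sub>F n in sequentially. 0 \<le> d (appr U n) (U n)"
    by (intro always_eventually allI d_nonneg PD[OF appr(1)[OF assms]] X_D[OF assms])
  show "\<forall>\<^sub>F n in sequentially. d (appr U n) (U n) \<le> 1 * (1 / real (Suc n))"
    unfolding mult_1 by (intro always_eventually allI appr(2)[OF assms])
qed

lemma appr_X: assumes "U \<in> X" shows "appr U \<in> X"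
  by (rule X_near[OF assms PD[OF appr(1)[OF assms]] appr_lim[OF assms]])

lemma cd_appr: assumes "U \<in> X" shows "cd (appr U) U = 0"
  by (rule LIMSEQ_unique[OF cd_lim[OF appr_X[OF assms] assms] appr_lim[OF assms]])

lemma S_X: assumes t: "0 \<le> t" and U: "U \<in> X" shows "S t U \<in> X"
proof (rule XI)
  show "S t U n \<in> D" for n unfolding S_def by (intro PD T_P t appr U)
  fix e :: real assume e: "0 < e"
  define e' where "e' = e / (K t + 1)"
  have Kt: "0 \<le> K t" by (rule K(1)[OF t])
  have e': "0 < e'" using e Kt by (simp add: e'_def)
  obtain M where M: "\<And>m n. m \<ge> M \<Longrightarrow> n \<ge> M \<Longrightarrow> d (appr U m) (appr U n) < e'"
    using X_Cauchy[OF appr_X[OF U] e'] by auto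
  have "d (S t U m) (S t U n) < e" if "m \<ge> M" "n \<ge> M" for m n
  proof -
    have "d (S t U m) (S t U n) \<le> K t * d (appr U m) (appr U n)"
      unfolding S_def by (intro T_lipschitz t appr U)
    also have "\<dots> \<le> K t * e'" using M[OF that] Kt by (intro mult_left_mono) auto
    also have "\<dots> < (K t + 1) * e'" using e' by (intro mult_strict_right_mono) auto
    also have "\<dots> = e" using Kt by (simp add: e'_def)
    finally show ?thesis .
  qed
  then show "\<exists>M. \<forall>m\<ge>M. \<forall>n\<ge>M. d (S t U m) (S t U n) < e" by blast
qed

text \<open>\<open>S\<close> is compared with the flow of any Cauchy sequence of polynomials. It is
  used for constant sequences and for the approximants of another element.\<close>

lemma S_lipschitz_near:
  assumes t: "0 \<le> t" and U: "U \<in> X" and q: "\<And>n. Q n \<in> P" and Q: "Q \<in> X" and TQ: "(\<lambda>n. T t (Q n)) \<in> X"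
  shows "cd (S t U) (\<lambda>n. T t (Q n)) \<le> K t * cd U Q"
proof -
  have "cd (S t U) (\<lambda>n. T t (Q n)) \<le> K t * cd (appr U) Q"
  proof (rule LIMSEQ_le[OF cd_lim[OF S_X[OF t U] TQ] tendsto_mult_left[OF cd_lim[OF appr_X[OF U] Q]]])
    show "\<exists>N'. \<forall>n\<ge>N'. d (S t U n) (T t (Q n)) \<le> K t * d (appr U n) (Q n)"
      unfolding S_def using T_lipschitz[OF t appr(1)[OF U] q] by blast
  qed
  also have "\<dots> \<le> K t * cd U Q"
    using cd_triangle[OF appr_X[OF U] U Q] cd_appr[OF U] K(1)[OF t] by (intro mult_left_mono) auto
  finally show ?thesis .
qed

lemma S_lipschitz: assumes t: "0 \<le> t" and "U \<in> X" "V \<in> X" shows "cd (S t U) (S t V) \<le> K t * cd U V"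
proof -
  have "cd (S t U) (S t V) \<le> K t * cd U (appr V)"
    using S_lipschitz_near[OF t assms(2) appr(1)[OF assms(3)] appr_X[OF assms(3)]] S_X[OF t assms(3)]
    by (simp add: S_def)
  also have "\<dots> \<le> K t * cd U V"
    using cd_triangle[OF assms(2,3) appr_X[OF assms(3)]] cd_appr[OF assms(3)] K(1)[OF t]
      cd_comm[OF assms(3) appr_X[OF assms(3)]] by (intro mult_left_mono) auto
  finally show ?thesis .
qed

lemma S_cemb: assumes t: "0 \<le> t" and "U \<in> X" "q \<in> P" shows "cd (S t U) (cemb (T t q)) \<le> K t * cd U (cemb q)"
  using S_lipschitz_near[OF t assms(2), of "\<lambda>n. q"] X_cemb[OF PD[OF assms(3)]] X_cemb[OF PD[OF T_P[OF t assms(3)]]] assms(3)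
  by (simp add: cemb_def)

lemma approx_P: assumes U: "U \<in> X" and e: "0 < e" shows "\<exists>q\<in>P. cd (cemb q) U < e"
proof -
  obtain M where M: "\<And>m n. m \<ge> M \<Longrightarrow> n \<ge> M \<Longrightarrow> d (appr U m) (appr U n) < e / 2"
    using X_Cauchy[OF appr_X[OF U], of "e / 2"] e by auto
  let ?q = "appr U M"
  have q: "?q \<in> P" by (rule appr[OF U])
  have "cd (cemb ?q) (appr U) \<le> e / 2"
    by (rule LIMSEQ_le_const2[OF cd_lim[OF X_cemb[OF PD[OF q]] appr_X[OF U]]])
      (use M in \<open>auto simp: cemb_def intro!: exI[of _ M] less_imp_le\<close>)
  then have "cd (cemb ?q) U \<le> e / 2"
    using cd_triangle[OF X_cemb[OF PD[OF q]] appr_X[OF U] U] cd_appr[OF U] by simp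
  then show ?thesis using q e by (intro bexI[of _ ?q]) auto
qed

text \<open>Any bound valid on polynomials passes to the completion with the same constant, not only
  the one given by \<open>K\<close>. Thus a single semigroup can receive a separate growth bound for
  each exponent.\<close>

lemma S_cnorm_le:
  assumes t: "0 \<le> t" and c: "\<And>p. p \<in> P \<Longrightarrow> N (T t p) \<le> c * N p" and U: "U \<in> X"
  shows "cnorm N (S t U) \<le> c * cnorm N U"
proof -
  have "(\<lambda>n. N (appr U n)) \<longlonglongrightarrow> cnorm N U"
  proof -
    have "\<bar>cnorm N (appr U) - cnorm N U\<bar> \<le> 0"
    proof (rule LIMSEQ_le[OF tendsto_rabs[OF tendsto_diff[OF cnorm_lim[OF appr_X[OF U]] cnorm_lim[OF U]]] appr_lim[OF U]])
      show "\<exists>N'. \<forall>n\<ge>N'. \<bar>N (appr U n) - N (U n)\<bar> \<le> d (appr U n) (U n)"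
      proof (intro exI allI impI)
        fix n
        note D = PD[OF appr(1)[OF U, of n]] X_D[OF U, of n]
        show "\<bar>N (appr U n) - N (U n)\<bar> \<le> d (appr U n) (U n)"
          using N_le_d[OF D] N_le_d[OF D(2,1)] d_comm[OF D] by linarith
      qed
    qed
    then show ?thesis using cnorm_lim[OF appr_X[OF U]] by simp
  qed
  from LIMSEQ_le[OF cnorm_lim[OF S_X[OF t U]] tendsto_mult_left[OF this, of c]]
  show ?thesis unfolding S_def using c appr(1)[OF U] by blast
qed

lemma K1: "0 \<le> K1" using K(1)[of 0] K(2)[of 0] by simp

lemma T_small: assumes q: "q \<in> P" and e: "0 < e" shows "\<exists>\<delta>>0. \<forall>r. 0 \<le> r \<and> r < \<delta> \<longrightarrow> d (T r q) q < e"
proof -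
  obtain b where b: "b > 0" "\<And>r. 0 < r \<Longrightarrow> r < b \<Longrightarrow> d (T r q) q < e"
    using order_tendstoD(2)[OF T_cont[OF q] e] unfolding eventually_at_right_field by auto
  have "d (T r q) q < e" if "0 \<le> r" "r < b" for r
    using b(2)[of r] that T_0[OF q] e by (cases "r = 0") auto
  then show ?thesis using b(1) by blast
qed

lemma S_0: assumes U: "U \<in> X" shows "cd (S 0 U) U = 0"
proof -
  have "(\<lambda>n. d (S 0 U n) (U n)) \<longlonglongrightarrow> 0"
  proof (rule tendsto_sandwich[OF _ _ tendsto_const appr_lim[OF U]])
    show "\<forall>\<^sub>F n in sequentially. 0 \<le> d (S 0 U n) (U n)"
      by (intro always_eventually allI d_nonneg X_D S_X U) simp
    have "d (S 0 U n) (U n) \<le> d (appr U n) (U n)" for n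
      using d_triangle[OF X_D[OF S_X[OF order_refl U], of n] PD[OF appr(1)[OF U, of n]] X_D[OF U, of n]]
        T_0[OF appr(1)[OF U, of n]] by (simp add: S_def)
    then show "\<forall>\<^sub>F n in sequentially. d (S 0 U n) (U n) \<le> d (appr U n) (U n)" by simp
  qed
  from LIMSEQ_unique[OF cd_lim[OF S_X[OF order_refl U] U] this] show ?thesis .
qed

text \<open>A nearby polynomial is moved continuously by \<open>T_small\<close>, and on the unit
  interval the flow amplifies its distance from \<open>U\<close> by at most
  \<open>K1\<close>.\<close>

lemma S_small: assumes U: "U \<in> X" and e: "0 < e" shows "\<exists>\<delta>>0. \<forall>r. 0 \<le> r \<and> r < \<delta> \<longrightarrow> cd (S r U) U < e"
proof -
  define \<eta> where "\<eta> = e / (2 * (K1 + 1))"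
  have \<eta>: "0 < \<eta>" "(K1 + 1) * \<eta> = e / 2" using e K1 by (auto simp: \<eta>_def field_simps)
  obtain q where q: "q \<in> P" "cd (cemb q) U < \<eta>" using approx_P[OF U \<eta>(1)] by blast
  have qX: "cemb q \<in> X" by (rule X_cemb[OF PD[OF q(1)]])
  have e2: "0 < e / 2" using e by simp
  obtain \<delta> where \<delta>: "0 < \<delta>" "\<And>r. 0 \<le> r \<Longrightarrow> r < \<delta> \<Longrightarrow> d (T r q) q < e / 2" using T_small[OF q(1) e2] by blast
  have "cd (S r U) U < e" if r: "0 \<le> r" "r < min \<delta> 1" for r
  proof -
    have TX: "cemb (T r q) \<in> X" by (intro X_cemb PD T_P r q)
    have "cd (S r U) U \<le> cd (S r U) (cemb (T r q)) + cd (cemb (T r q)) U"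
      by (rule cd_triangle[OF S_X[OF r(1) U] TX U])
    also have "cd (cemb (T r q)) U \<le> d (T r q) q + cd (cemb q) U"
      using cd_triangle[OF TX qX U] by (simp add: cd_cemb)
    also have "cd (S r U) (cemb (T r q)) \<le> K1 * cd (cemb q) U"
    proof -
      have "cd (S r U) (cemb (T r q)) \<le> K r * cd (cemb q) U"
        using S_cemb[OF r(1) U q(1)] cd_comm[OF U qX] by simp
      also have "\<dots> \<le> K1 * cd (cemb q) U" using K(2)[of r] r by (intro mult_right_mono cd_nonneg qX U) auto
      finally show ?thesis .
    qed
    also have "K1 * cd (cemb q) U \<le> K1 * \<eta>" using q K1 by (intro mult_left_mono) auto
    finally have "cd (S r U) U \<le> K1 * \<eta> + (d (T r q) q + cd (cemb q) U)" by simp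
    moreover have "d (T r q) q < e / 2" using \<delta>(2) r by simp
    moreover have "K1 * \<eta> + \<eta> = e / 2" using \<eta>(2) by (simp add: distrib_right)
    ultimately show ?thesis using q(2) by linarith
  qed
  then show ?thesis using \<delta>(1) by (intro exI[of _ "min \<delta> 1"]) auto
qed

lemma C0_semigroup_S: "C0_semigroup D N S"
  unfolding C0_semigroup_def
proof (intro conjI allI impI ballI)
  fix t :: real and U assume t: "0 \<le> t" and U: "U \<in> X"
  show "S t U \<in> X" by (rule S_X[OF t U])
next
  fix t :: real and U V assume t: "0 \<le> t" and U: "U \<in> X" and V: "V \<in> X" and "ceq N U V"
  then have "cd U V = 0" using ceq_iff by blast
  then have "cd (S t U) (S t V) \<le> 0" using S_lipschitz[OF t U V] by simp
  then show "ceq N (S t U) (S t V)"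
    using ceq_iff[OF S_X[OF t U] S_X[OF t V]] cd_nonneg[OF S_X[OF t U] S_X[OF t V]] by simp
next
  fix t :: real and U V assume t: "0 \<le> t" and U: "U \<in> X" and V: "V \<in> X"
  let ?W = "cadd U V"
  have W: "?W \<in> X" by (rule X_cadd[OF U V])
  show "ceq N (S t ?W) (cadd (S t U) (S t V))"
    unfolding ceq_def
  \<comment> \<open>One error of size 1 / (n + 1) for each of the approximants of the sum and of its
    two terms.\<close>
  proof (rule tendsto_sandwich[OF _ _ tendsto_const inv_Suc_lim[of "K t * 3"]])
    show "\<forall>\<^sub>F n in sequentially. 0 \<le> d (S t ?W n) (cadd (S t U) (S t V) n)"
      by (intro always_eventually allI d_nonneg X_D S_X X_cadd t U V)
    have "d (S t ?W n) (cadd (S t U) (S t V) n) \<le> K t * 3 * (1 / real (Suc n))" for n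
    proof -
      let ?a = "appr ?W n" and ?b = "appr U n" and ?c = "appr V n"
      note P = appr(1)[OF W, of n] appr(1)[OF U, of n] appr(1)[OF V, of n]
      note bc = P_padd[OF P(2,3)]
      have "d (T t ?a) (padd (T t ?b) (T t ?c)) \<le> d (T t ?a) (T t (padd ?b ?c)) + d (T t (padd ?b ?c)) (padd (T t ?b) (T t ?c))"
        by (intro d_triangle D_padd PD T_P t P bc)
      also have "\<dots> \<le> K t * d ?a (padd ?b ?c)"
        using T_lipschitz[OF t P(1) bc] T_add[OF t P(2,3)] by simp
      also have "d ?a (padd ?b ?c) \<le> d ?a (?W n) + d (?W n) (padd ?b ?c)"
        by (intro d_triangle D_padd PD P X_D W)
      also have "d (?W n) (padd ?b ?c) \<le> d (U n) ?b + d (V n) ?c"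
        unfolding cadd_def by (intro d_padd PD P X_D U V)
      also have "d ?a (?W n) + (d (U n) ?b + d (V n) ?c) \<le> 3 * (1 / real (Suc n))"
        using appr(2)[OF W, of n] appr(2)[OF U, of n] appr(2)[OF V, of n]
          d_comm[OF X_D[OF U, of n] PD[OF P(2)]] d_comm[OF X_D[OF V, of n] PD[OF P(3)]] by linarith
      finally show ?thesis using K(1)[OF t] by (simp add: S_def cadd_def mult_left_mono)
    qed
    then show "\<forall>\<^sub>F n in sequentially. d (S t ?W n) (cadd (S t U) (S t V) n) \<le> K t * 3 * (1 / real (Suc n))" by simp
  qed
next
  fix t :: real and c U assume t: "0 \<le> t" and U: "U \<in> X"
  let ?W = "cscale c U"
  have W: "?W \<in> X" by (rule X_cscale[OF U])
  show "ceq N (S t ?W) (cscale c (S t U))"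
    unfolding ceq_def
  \<comment> \<open>One unit of error for the approximant of the multiple,
    \<open>\<bar>c\<bar>\<close> for the scaled approximant of \<open>U\<close>.\<close>
  proof (rule tendsto_sandwich[OF _ _ tendsto_const inv_Suc_lim[of "K t * (1 + \<bar>c\<bar>)"]])
    show "\<forall>\<^sub>F n in sequentially. 0 \<le> d (S t ?W n) (cscale c (S t U) n)"
      by (intro always_eventually allI d_nonneg X_D S_X X_cscale t U)
    have "d (S t ?W n) (cscale c (S t U) n) \<le> K t * (1 + \<bar>c\<bar>) * (1 / real (Suc n))" for n
    proof -
      let ?a = "appr ?W n" and ?b = "appr U n"
      note P = appr(1)[OF W, of n] appr(1)[OF U, of n]
      note cont_ext = P_pscale[OF P(2), of c]
      have "d (T t ?a) (pscale c (T t ?b)) \<le> d (T t ?a) (T t (pscale c ?b)) + d (T t (pscale c ?b)) (pscale c (T t ?b))"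
        by (intro d_triangle D_pscale PD T_P t P cont_ext)
      also have "\<dots> \<le> K t * d ?a (pscale c ?b)"
        using T_lipschitz[OF t P(1) cont_ext] T_scale[OF t P(2)] by simp
      also have "d ?a (pscale c ?b) \<le> d ?a (?W n) + d (?W n) (pscale c ?b)"
        by (intro d_triangle D_pscale PD P X_D W)
      also have "d (?W n) (pscale c ?b) = \<bar>c\<bar> * d ?b (U n)"
        unfolding cscale_def d_pscale[OF X_D[OF U] PD[OF P(2)]] using d_comm[OF X_D[OF U, of n] PD[OF P(2)]] by simp
      also have "d ?a (?W n) + \<bar>c\<bar> * d ?b (U n) \<le> (1 + \<bar>c\<bar>) * (1 / real (Suc n))"
        using appr(2)[OF W, of n] mult_left_mono[OF appr(2)[OF U, of n], of "\<bar>c\<bar>"] by (simp add: distrib_right add_divide_distrib)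
      finally show ?thesis using K(1)[OF t] by (simp add: S_def cscale_def mult_left_mono)
    qed
    then show "\<forall>\<^sub>F n in sequentially. d (S t ?W n) (cscale c (S t U) n) \<le> K t * (1 + \<bar>c\<bar>) * (1 / real (Suc n))" by simp
  qed
next
  fix t :: real assume t: "0 \<le> t"
  show "\<exists>C. \<forall>U\<in>X. cnorm N (S t U) \<le> C * cnorm N U"
    using S_cnorm_le[OF t T_bound[OF t]] by blast
next
  fix U assume U: "U \<in> X"
  show "ceq N (S 0 U) U" using ceq_iff[OF S_X[OF order_refl U] U] S_0[OF U] by simp
next
  fix t s :: real and U assume t: "0 \<le> t" and s: "0 \<le> s" and U: "U \<in> X"
  have ts: "0 \<le> t + s" using t s by simp
  note W = S_X[OF s U]
  show "ceq N (S (t + s) U) (S t (S s U))"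
    unfolding ceq_def
  proof (rule tendsto_sandwich[OF _ _ tendsto_const inv_Suc_lim[of "K t"]])
    show "\<forall>\<^sub>F n in sequentially. 0 \<le> d (S (t + s) U n) (S t (S s U) n)"
      by (intro always_eventually allI d_nonneg X_D S_X ts t s U)
    have "d (S (t + s) U n) (S t (S s U) n) \<le> K t * (1 / real (Suc n))" for n
    proof -
      let ?a = "appr U n" and ?b = "appr (S s U) n"
      note P = appr(1)[OF U, of n] appr(1)[OF W, of n]
      have "d (T (t + s) ?a) (T t ?b) \<le> d (T (t + s) ?a) (T t (T s ?a)) + d (T t (T s ?a)) (T t ?b)"
        by (intro d_triangle PD T_P ts t s P)
      also have "\<dots> \<le> K t * d (T s ?a) ?b"
        using T_semi[OF t s P(1)] T_lipschitz[OF t T_P[OF s P(1)] P(2)] by simp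
      also have "d (T s ?a) ?b = d ?b (T s ?a)"
        by (intro d_comm PD T_P s P)
      also have "T s ?a = S s U n" by (simp only: S_def[of s U])
      also have "K t * d ?b (S s U n) \<le> K t * (1 / real (Suc n))"
        by (intro mult_left_mono appr(2)[OF W] K(1)[OF t])
      finally show ?thesis unfolding S_def[of "t + s" U] S_def[of t "S s U"] .
    qed
    then show "\<forall>\<^sub>F n in sequentially. d (S (t + s) U n) (S t (S s U) n) \<le> K t * (1 / real (Suc n))" by simp
  qed
next
  fix U assume U: "U \<in> X"
  show "((\<lambda>t. cd (S t U) U) \<longlongrightarrow> 0) (at_right 0)"
  proof (rule tendstoI)
    fix e :: real assume "0 < e"
    then obtain \<delta> where \<delta>: "0 < \<delta>" "\<And>r. 0 \<le> r \<Longrightarrow> r < \<delta> \<Longrightarrow> cd (S r U) U < e" using S_small[OF U] by blast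
    show "\<forall>\<^sub>F t in at_right 0. dist (cd (S t U) U) 0 < e"
      unfolding eventually_at_right_field
    proof (intro exI[of _ \<delta>] conjI allI impI \<delta>(1))
      fix t assume "0 < t" "t < \<delta>"
      then show "dist (cd (S t U) U) 0 < e"
        using \<delta>(2)[of t] cd_nonneg[OF S_X[of t U] U] U by (simp add: dist_real_def)
    qed
  qed
qed

subsection \<open>The generator\<close>

text \<open>\<open>V\<close> is replaced by a fixed polynomial \<open>q\<close>, for which
  continuity in time is known. Then T r (L p) deviates from q by at most \<open>K1\<close> times the
  distance of L p from q plus the oscillation \<open>c\<close>; letting the approximants of
  \<open>U\<close> converge leaves only the distance of \<open>V\<close> from
  \<open>q\<close>.\<close>

lemma difference_quotient_bound:
  assumes UV: "U \<in> X" "V \<in> X" and f: "\<And>j. f j \<in> D"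
    and fU: "(\<lambda>j. cd (cemb (f j)) U) \<longlonglongrightarrow> 0" and LfV: "(\<lambda>j. cd (cemb (L (f j))) V) \<longlonglongrightarrow> 0"
    and q: "q \<in> P" and h: "0 \<le> h" "h \<le> 1" and c: "\<And>r. 0 \<le> r \<Longrightarrow> r \<le> h \<Longrightarrow> d (T r q) q \<le> c"
  shows "cd (csub (S h U) U) (cscale h (cemb q)) \<le> h * (K1 * cd V (cemb q) + c)"
proof -
  \<comment> \<open>Density in the graph norm replaces \<open>f\<close> by polynomials with the same
    two limits.\<close>
  have "\<forall>j. \<exists>p. p \<in> P \<and> d p (f j) < 1 / real (Suc j) \<and> d (L p) (L (f j)) < 1 / real (Suc j)"
    using dense[OF f] by (metis of_nat_0_less_iff zero_less_Suc zero_less_divide_1_iff)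
  then obtain p where p: "\<And>j. p j \<in> P" "\<And>j. d (p j) (f j) < 1 / real (Suc j)"
    "\<And>j. d (L (p j)) (L (f j)) < 1 / real (Suc j)" by metis
  define x where "x = (\<lambda>j. 1 * (1 / real (Suc j)) + cd (cemb (f j)) U)"
  define y where "y = (\<lambda>j. 1 * (1 / real (Suc j)) + cd (cemb (L (f j))) V)"
  have x0: "x \<longlonglongrightarrow> 0" unfolding x_def using tendsto_add[OF inv_Suc_lim[of 1] fU] by simp
  have y0: "y \<longlonglongrightarrow> 0" unfolding y_def using tendsto_add[OF inv_Suc_lim[of 1] LfV] by simp
  have qX: "cemb q \<in> X" by (intro X_cemb PD q)
  note SX = S_X[OF h(1) UV(1)]
  have le: "cd (csub (S h U) U) (cscale h (cemb q)) \<le> (K1 + 1) * x j + h * (K1 * (y j + cd V (cemb q)) + c)" for j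
  proof -
    note PX = X_cemb[OF PD[OF p(1)[of j]]] X_cemb[OF PD[OF L_P[OF p(1)[of j]]]]
      X_cemb[OF f[of j]] X_cemb[OF L_D[OF f[of j]]] X_cemb[OF PD[OF T_P[OF h(1) p(1)[of j]]]]
    have px: "cd (cemb (p j)) U \<le> x j"
      using cd_triangle[OF PX(1) PX(3) UV(1)] p(2)[of j] by (simp add: x_def cd_cemb)
    have py: "cd (cemb (L (p j))) V \<le> y j"
      using cd_triangle[OF PX(2) PX(4) UV(2)] p(3)[of j] by (simp add: y_def cd_cemb)
    have Lq: "d (L (p j)) q \<le> y j + cd V (cemb q)"
      using cd_triangle[OF PX(2) UV(2) qX] py by (simp add: cd_cemb)
    have "d (T r (L (p j))) q \<le> K1 * d (L (p j)) q + c" if r: "0 \<le> r" "r \<le> h" for r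
    proof -
      have "d (T r (L (p j))) q \<le> d (T r (L (p j))) (T r q) + d (T r q) q"
        by (intro d_triangle PD T_P L_P p q r)
      also have "d (T r (L (p j))) (T r q) \<le> K r * d (L (p j)) q" by (intro T_lipschitz r L_P p q)
      also have "K r * d (L (p j)) q \<le> K1 * d (L (p j)) q"
        using K(2)[of r] r h by (intro mult_right_mono d_nonneg PD L_P p q) auto
      finally show ?thesis using c[OF r] by linarith
    qed
    then have "d (psub (T h (p j)) (p j)) (pscale h q) \<le> h * (K1 * d (L (p j)) q + c)"
      by (rule T_deriv[OF p(1) q h(1)])
    also have "\<dots> \<le> h * (K1 * (y j + cd V (cemb q)) + c)"
      using Lq K1 h by (intro mult_left_mono add_right_mono) auto
    finally have 1: "cd (csub (cemb (T h (p j))) (cemb (p j))) (cscale h (cemb q)) \<le> h * (K1 * (y j + cd V (cemb q)) + c)"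
      by (simp add: cnorm_def csub_def cscale_def cemb_def)
    have "cd (S h U) (cemb (T h (p j))) \<le> K1 * x j"
    proof -
      have "cd (S h U) (cemb (T h (p j))) \<le> K h * cd (cemb (p j)) U"
        using S_cemb[OF h(1) UV(1) p(1)[of j]] cd_comm[OF UV(1) PX(1)] by simp
      also have "\<dots> \<le> K1 * x j"
        using K(2)[OF h] K1 px by (intro mult_mono cd_nonneg PX UV) auto
      finally show ?thesis .
    qed
    moreover have "cd U (cemb (p j)) \<le> x j" using px cd_comm[OF UV(1) PX(1)] by simp
    ultimately have 2: "cd (csub (S h U) U) (csub (cemb (T h (p j))) (cemb (p j))) \<le> (K1 + 1) * x j"
      using cd_csub[OF SX UV(1) PX(5) PX(1)] by (simp add: distrib_right)
    show ?thesis
      using cd_triangle[OF X_csub[OF SX UV(1)] X_csub[OF PX(5) PX(1)] X_cscale[OF qX, of h]] 1 2 by linarith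
  qed
  have "(\<lambda>j. (K1 + 1) * x j + h * (K1 * (y j + cd V (cemb q)) + c)) \<longlonglongrightarrow> (K1 + 1) * 0 + h * (K1 * (0 + cd V (cemb q)) + c)"
    by (intro tendsto_intros x0 y0)
  from LIMSEQ_le_const[OF this] le show ?thesis by auto
qed

lemma closure_imp_gen:
  assumes "closure_rel D N L U V" shows "gen_rel D N S U V"
proof -
  obtain f where UV: "U \<in> X" "V \<in> X" and f: "\<And>j. f j \<in> D"
    and fU: "(\<lambda>j. cd (cemb (f j)) U) \<longlonglongrightarrow> 0" and LfV: "(\<lambda>j. cd (cemb (L (f j))) V) \<longlonglongrightarrow> 0"
    using assms unfolding closure_rel_def by blast
  have "((\<lambda>h. cd (cscale (1 / h) (csub (S h U) U)) V) \<longlongrightarrow> 0) (at_right 0)"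
  proof (rule tendstoI)
    fix e :: real assume e: "0 < e"
    \<comment> \<open>\<open>K1 * \<eta>\<close> pays for replacing \<open>V\<close> by
      \<open>q\<close>, one \<eta> for the oscillation of T r q and one for the return to
      \<open>V\<close>; the third is spare.\<close>
    define \<eta> where "\<eta> = e / (K1 + 3)"
    have \<eta>: "0 < \<eta>" "(K1 + 3) * \<eta> = e" using e K1 by (auto simp: \<eta>_def field_simps)
    obtain q where q: "q \<in> P" "cd (cemb q) V < \<eta>" using approx_P[OF UV(2) \<eta>(1)] by blast
    have qX: "cemb q \<in> X" by (intro X_cemb PD q)
    obtain \<delta> where \<delta>: "0 < \<delta>" "\<And>r. 0 \<le> r \<Longrightarrow> r < \<delta> \<Longrightarrow> d (T r q) q < \<eta>" using T_small[OF q(1) \<eta>(1)] by blast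
    show "\<forall>\<^sub>F h in at_right 0. dist (cd (cscale (1 / h) (csub (S h U) U)) V) 0 < e"
      unfolding eventually_at_right_field
    proof (intro exI[of _ "min \<delta> 1"] conjI allI impI)
      fix h assume h: "0 < h" "h < min \<delta> 1"
      let ?W = "csub (S h U) U"
      have W: "?W \<in> X" using h by (intro X_csub S_X UV) auto
      have Wh: "cscale (1 / h) ?W \<in> X" by (rule X_cscale[OF W])
      have "cd ?W (cscale h (cemb q)) \<le> h * (K1 * cd V (cemb q) + \<eta>)"
        by (rule difference_quotient_bound[OF UV f fU LfV q(1)]) (use h \<delta> in \<open>auto intro: less_imp_le\<close>)
      also have "\<dots> \<le> h * (K1 * \<eta> + \<eta>)"
        using q(2) cd_comm[OF UV(2) qX] K1 h by (intro mult_left_mono add_right_mono) auto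
      finally have "1 / h * cd ?W (cscale h (cemb q)) \<le> 1 / h * (h * (K1 * \<eta> + \<eta>))"
        using h by (intro mult_left_mono) auto
      then have "1 / h * cd ?W (cscale h (cemb q)) \<le> K1 * \<eta> + \<eta>" using h by simp
      moreover have "cd (cscale (1 / h) ?W) (cscale (1 / h) (cscale h (cemb q))) = 1 / h * cd ?W (cscale h (cemb q))"
        using cd_cscale[OF W X_cscale[OF qX], of "1 / h"] h by simp
      moreover have "cscale (1 / h) (cscale h (cemb q)) = cemb q"
        using h by (simp add: cscale_def cemb_def pscale_def)
      ultimately have "cd (cscale (1 / h) ?W) (cemb q) \<le> K1 * \<eta> + \<eta>" by simp
      then have "cd (cscale (1 / h) ?W) V < K1 * \<eta> + \<eta> + \<eta>"
        using cd_triangle[OF Wh qX UV(2)] q(2) by linarith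
      also have "\<dots> \<le> e" using \<eta> by (simp add: distrib_right)
      finally show "dist (cd (cscale (1 / h) ?W) V) 0 < e"
        using cd_nonneg[OF Wh UV(2)] by (simp add: dist_real_def)
    qed (use \<delta> in auto)
  qed
  then show ?thesis unfolding gen_rel_def using UV by simp
qed

text \<open>The time average \<open>h\<^sup>-\<^sup>1 \<integral> T r p\<close> over \<open>[0, h]\<close> lies in the core and is mapped by \<open>L\<close> to the
  difference quotient; so the core is a core of the generator, without resolvents.\<close>

lemma gen_imp_closure:
  assumes "gen_rel D N S U V" shows "closure_rel D N L U V"
proof -
  have UV: "U \<in> X" "V \<in> X" and gen: "((\<lambda>h. cd (cscale (1 / h) (csub (S h U) U)) V) \<longlongrightarrow> 0) (at_right 0)"
    using assms unfolding gen_rel_def by auto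
  have step: "\<exists>m\<in>P. cd (cemb m) U < e \<and> cd (cemb (L m)) V < e" if e: "0 < e" for e
  proof -
    have e3: "0 < e / 3" using e by simp
    obtain b where b: "0 < b" "\<And>h. 0 < h \<Longrightarrow> h < b \<Longrightarrow> dist (cd (cscale (1 / h) (csub (S h U) U)) V) 0 < e / 3"
      using tendstoD[OF gen e3] unfolding eventually_at_right_field by auto
    obtain \<delta> where \<delta>: "0 < \<delta>" "\<And>r. 0 \<le> r \<Longrightarrow> r < \<delta> \<Longrightarrow> cd (S r U) U < e / 3" using S_small[OF UV(1) e3] by blast
    define h where "h = min (min b \<delta>) 1 / 2"
    have h: "0 < h" "h < b" "h < \<delta>" "h \<le> 1" using b(1) \<delta>(1) by (auto simp: h_def min_def)
    have quot: "cd (cscale (1 / h) (csub (S h U) U)) V < e / 3" using b(2)[OF h(1,2)] by (simp add: dist_real_def)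
    \<comment> \<open>The error of \<open>p\<close> gets divided by \<open>h\<close> in the
      difference quotient, so its tolerance must contain the factor \<open>h\<close>. It may, since
      \<open>h\<close> was fixed from \<open>U\<close> and \<open>V\<close> alone.\<close>
    define \<eta> where "\<eta> = e * h / 4 / (K1 + 2)"
    have \<eta>: "0 < \<eta>" using e h K1 by (simp add: \<eta>_def)
    have "K1 + 2 \<noteq> 0" using K1 by simp
    then have \<eta>1: "(K1 + 2) * \<eta> = e * h / 4"
      by (subst mult.commute) (rule iffD1[OF nonzero_eq_divide_eq \<eta>_def])
    have \<eta>2: "(K1 + 1) * \<eta> \<le> e * h / 4" using \<eta> \<eta>1 by (simp add: distrib_right)
    have eh: "e * h / 4 \<le> e / 4" using e h by (simp add: mult_left_le)
    obtain p where p: "p \<in> P" "cd (cemb p) U < \<eta>" using approx_P[OF UV(1) \<eta>] by blast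
    have pX: "cemb p \<in> X" by (intro X_cemb PD p)
    obtain m where m: "m \<in> P" "d (L m) (pscale (1 / h) (psub (T h p) p)) = 0"
      "\<And>c. (\<And>r. 0 \<le> r \<Longrightarrow> r \<le> h \<Longrightarrow> d (T r p) p \<le> c) \<Longrightarrow> d m p \<le> c"
      using T_average[OF p(1) h(1)] by blast
    have mX: "cemb m \<in> X" "cemb (L m) \<in> X" by (intro X_cemb PD m L_P)+
    have TS: "cd (S r U) (cemb (T r p)) \<le> K1 * \<eta>" if r: "0 \<le> r" "r \<le> h" for r
    proof -
      have "cd (S r U) (cemb (T r p)) \<le> K r * cd (cemb p) U"
        using S_cemb[OF r(1) UV(1) p(1)] cd_comm[OF UV(1) pX] by simp
      also have "\<dots> \<le> K1 * \<eta>"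
        using K(2)[of r] K1 p(2) r h by (intro mult_mono cd_nonneg pX UV) auto
      finally show ?thesis .
    qed
    have "d m p \<le> (K1 + 1) * \<eta> + e / 3"
    proof (rule m(3))
      fix r assume r: "0 \<le> r" "r \<le> h"
      have TX: "cemb (T r p) \<in> X" by (intro X_cemb PD T_P r p)
      have "d (T r p) p = cd (cemb (T r p)) (cemb p)" by (simp add: cd_cemb)
      also have "\<dots> \<le> cd (cemb (T r p)) (S r U) + cd (S r U) (cemb p)"
        by (rule cd_triangle[OF TX S_X[OF r(1) UV(1)] pX])
      also have "cd (S r U) (cemb p) \<le> cd (S r U) U + cd U (cemb p)"
        by (rule cd_triangle[OF S_X[OF r(1) UV(1)] UV(1) pX])
      finally show "d (T r p) p \<le> (K1 + 1) * \<eta> + e / 3"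
        using TS[OF r] cd_comm[OF TX S_X[OF r(1) UV(1)]] cd_comm[OF UV(1) pX] p(2) \<delta>(2)[of r] r h
        by (simp add: distrib_right)
    qed
    then have "cd (cemb m) U < (K1 + 1) * \<eta> + e / 3 + \<eta>"
      using cd_triangle[OF mX(1) pX UV(1)] p(2) by (simp add: cd_cemb)
    also have "\<dots> = (K1 + 2) * \<eta> + e / 3" by (simp add: distrib_right)
    also have "\<dots> \<le> e / 4 + e / 3" using \<eta>1 eh by linarith
    finally have 1: "cd (cemb m) U < e" using e by simp
    let ?W = "csub (S h U) U" and ?Y = "csub (cemb (T h p)) (cemb p)"
    have TX: "cemb (T h p) \<in> X" using h by (intro X_cemb PD T_P p) auto
    have h0: "0 \<le> h" using h by simp
    note WX = X_csub[OF S_X[OF h0 UV(1)] UV(1)] X_csub[OF TX pX]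
    have "cd ?Y ?W \<le> K1 * \<eta> + \<eta>"
      using cd_csub[OF TX pX S_X[OF h0 UV(1)] UV(1)] TS[of h] h p(2) cd_comm[OF TX S_X[OF h0 UV(1)]] by simp
    then have "1 / h * cd ?Y ?W \<le> 1 / h * (e * h / 4)"
      using \<eta>2 h by (intro mult_left_mono) (auto simp: distrib_right)
    then have "1 / h * cd ?Y ?W \<le> e / 4" using h by simp
    moreover have "cd (cscale (1 / h) ?Y) (cscale (1 / h) ?W) = 1 / h * cd ?Y ?W"
      using cd_cscale[OF WX(2,1), of "1 / h"] h by simp
    moreover have "cd (cemb (L m)) (cscale (1 / h) ?Y) = 0"
      using m(2) by (simp add: cnorm_def csub_def cscale_def cemb_def)
    ultimately have "cd (cemb (L m)) V < e / 4 + e / 3"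
      using cd_triangle[OF mX(2) X_cscale[OF WX(2), of "1 / h"] UV(2)]
        cd_triangle[OF X_cscale[OF WX(2), of "1 / h"] X_cscale[OF WX(1), of "1 / h"] UV(2)] quot by linarith
    then have "cd (cemb (L m)) V < e" using e by simp
    with 1 m(1) show ?thesis by blast
  qed
  have "\<forall>j. \<exists>m. m \<in> P \<and> cd (cemb m) U < 1 / real (Suc j) \<and> cd (cemb (L m)) V < 1 / real (Suc j)"
  proof
    fix j :: nat
    have "0 < 1 / real (Suc j)" by simp
    from step[OF this] show "\<exists>m. m \<in> P \<and> cd (cemb m) U < 1 / real (Suc j) \<and> cd (cemb (L m)) V < 1 / real (Suc j)"
      by blast
  qed
  then obtain f where f: "\<And>j. f j \<in> P" "\<And>j. cd (cemb (f j)) U < 1 / real (Suc j)"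
    "\<And>j. cd (cemb (L (f j))) V < 1 / real (Suc j)" by metis
  have fD: "f j \<in> D" for j by (rule PD[OF f(1)])
  have lim: "a \<longlonglongrightarrow> 0" if "\<And>j. 0 \<le> a j" "\<And>j. a j < 1 / real (Suc j)" for a :: "nat \<Rightarrow> real"
  proof (rule tendsto_sandwich[OF _ _ tendsto_const inv_Suc_lim[of 1]])
    show "\<forall>\<^sub>F j in sequentially. 0 \<le> a j" by (intro always_eventually allI that)
    show "\<forall>\<^sub>F j in sequentially. a j \<le> 1 * (1 / real (Suc j))"
      unfolding mult_1 by (intro always_eventually allI less_imp_le that)
  qed
  have "(\<lambda>j. cd (cemb (f j)) U) \<longlonglongrightarrow> 0"
    by (rule lim) (intro cd_nonneg X_cemb fD UV f(2))+
  moreover have "(\<lambda>j. cd (cemb (L (f j))) V) \<longlonglongrightarrow> 0"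
    by (rule lim) (intro cd_nonneg X_cemb L_D fD UV f(3))+
  ultimately show ?thesis unfolding closure_rel_def using UV fD by blast
qed

lemma generates_S: "generates D N L S"
  unfolding generates_def using C0_semigroup_S closure_imp_gen gen_imp_closure by blast

text \<open>A null sequence whose images tend to G puts (0, G) into the closure relation, hence into
  the generator. The semigroup fixes 0 up to the seminorm, so all difference quotients at 0 vanish
  and G has norm zero.\<close>

lemma closable: "closable_op D N L"
  unfolding closable_op_def
proof (intro allI impI, elim conjE)
  fix f G assume f: "\<forall>j. f j \<in> D" and G: "G \<in> X" and f0: "(\<lambda>j. cnorm N (cemb (f j))) \<longlonglongrightarrow> 0"
    and LG: "(\<lambda>j. cd (cemb (L (f j))) G) \<longlonglongrightarrow> 0"
  \<comment> \<open>The zero pair, written as a multiple of an element of \<open>D\<close> so that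
    \<open>D_pscale\<close> shows membership.\<close>
  define z where "z = pscale 0 (f 0)"
  have z: "z \<in> D" unfolding z_def using f by (intro D_pscale) auto
  have zX: "cemb z \<in> X" by (rule X_cemb[OF z])
  have subz: "psub u z = u" for u by (simp add: z_def psub_def padd_def pscale_def)
  have Nz: "N z = 0" unfolding z_def using N_pscale[of "f 0" 0] f by simp
  have "closure_rel D N L (cemb z) G"
    unfolding closure_rel_def using f f0 LG G zX by (auto simp: cd_cemb subz cnorm_cemb intro!: exI[of _ f])
  then have "((\<lambda>h. cd (cscale (1 / h) (csub (S h (cemb z)) (cemb z))) G) \<longlongrightarrow> 0) (at_right 0)"
    using closure_imp_gen unfolding gen_rel_def by blast
  moreover have "\<forall>\<^sub>F h in at_right 0. cnorm N G \<le> cd (cscale (1 / h) (csub (S h (cemb z)) (cemb z))) G"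
    unfolding eventually_at_right_field
  proof (intro exI[of _ 1] conjI allI impI)
    fix h :: real assume h: "0 < h"
    then have h0: "0 \<le> h" by simp
    have "cnorm N (S h (cemb z)) \<le> K h * cnorm N (cemb z)" by (rule S_cnorm_le[OF h0 T_bound[OF h0] zX])
    then have S0: "cnorm N (S h (cemb z)) = 0"
      using cnorm_nonneg[OF S_X[OF h0 zX]] by (simp add: cnorm_cemb Nz)
    let ?W = "csub (S h (cemb z)) (cemb z)"
    have cz: "csub Y (cemb z) = Y" for Y by (simp add: csub_def cemb_def subz)
    have sz: "cscale c (cemb z) = cemb z" for c by (simp add: cscale_def cemb_def z_def pscale_def)
    have W: "?W \<in> X" by (intro X_csub S_X zX h0)
    have W': "cscale (1 / h) ?W \<in> X" by (rule X_cscale[OF W])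
    have "cd (cscale (1 / h) ?W) (cemb z) = \<bar>1 / h\<bar> * cd ?W (cemb z)"
      using cd_cscale[OF W zX, of "1 / h"] by (simp only: sz)
    then have "cd (cscale (1 / h) ?W) (cemb z) = 0" by (simp add: cz S0)
    moreover have "cd G (cemb z) \<le> cd G (cscale (1 / h) ?W) + cd (cscale (1 / h) ?W) (cemb z)"
      by (rule cd_triangle[OF G W' zX])
    ultimately show "cnorm N G \<le> cd (cscale (1 / h) ?W) G"
      using cd_comm[OF G W'] by (simp add: cz)
  qed simp
  ultimately have "cnorm N G \<le> 0"
    by (intro tendsto_lowerbound) (auto simp: trivial_limit_at_right_real)
  then show "cnorm N G = 0" using cnorm_nonneg[OF G] by simp
qed

end

section \<open>The wave flow on polynomials\<close>

lemma Nrm_psub_self: "u \<in> Dom R \<Longrightarrow> Nrm k R (psub u u) = 0"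
proof -
  assume u: "u \<in> Dom R"
  have "psub u u = pscale 0 u" by (simp add: psub_def padd_def pscale_def)
  then show ?thesis using Nrm_pscale[OF u, of k 0] by simp
qed

lemma Nrm_zero: "Nrm k R (\<lambda>x. 0, \<lambda>x. 0) = 0"
  by (simp add: Nrm_def hk_sq_def dpart_zero)

lemma psub_eq: "psub u v = (\<lambda>x. fst u x - fst v x, \<lambda>x. snd u x - snd v x)"
  by (simp add: psub_def padd_def pscale_def)

definition poly_pairs :: "('n::finite) rpair set" where
  "poly_pairs = {u. rp (fst u) \<and> rp (snd u)}"

lemma poly_pairs_Dom: "u \<in> poly_pairs \<Longrightarrow> u \<in> Dom R"
  by (simp add: poly_pairs_def Dom_rp)

lemma poly_curve_L1:
  assumes v: "poly_curve v1 v1'" "poly_curve v2 v2'"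
  shows "poly_curve (\<lambda>t. L1 s (v1 t) (v2 t)) (\<lambda>t. L1 s (v1' t) (v2' t))"
  unfolding L1_def
  by (intro poly_curve_add poly_curve_diff poly_curve_cmult poly_curve_sum poly_curve_mult_rp poly_curve_pd v rp_coord finite)

lemma poly_curve_L2:
  assumes v: "poly_curve v1 v1'" "poly_curve v2 v2'"
  shows "poly_curve (\<lambda>t. L2 s (v1 t) (v2 t)) (\<lambda>t. L2 s (v1' t) (v2' t))"
  unfolding L2_def
  by (intro poly_curve_diff poly_curve_cmult poly_curve_sum poly_curve_mult_rp poly_curve_pd v rp_coord finite)

text \<open>The operator is independent of time and acts on the spatial factors of a polynomial
  curve, so it commutes with the time derivative.\<close>

lemma wave_sol_L:
  assumes "wave_sol s v1 v2"
  shows "wave_sol s (\<lambda>t. L1 s (v1 t) (v2 t)) (\<lambda>t. L2 s (v1 t) (v2 t))"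
proof -
  have p: "poly_curve v1 (\<lambda>t. L1 s (v1 t) (v2 t))" "poly_curve v2 (\<lambda>t. L2 s (v1 t) (v2 t))"
    using assms by (auto simp: wave_sol_def)
  show ?thesis unfolding wave_sol_def by (intro conjI poly_curve_L1[OF p] poly_curve_L2[OF p])
qed

text \<open>The difference solves the equation with zero data, and the growth bound with any
  admissible rate forces its seminorm to vanish.\<close>

lemma wave_sol_unique:
  fixes R s :: real
  assumes R: "R \<ge> 1" and k: "k \<ge> 1" and v: "wave_sol s v1 v2" and w: "wave_sol s w1 w2"
    and init: "v1 0 = w1 0" "v2 0 = w2 0" and t: "t \<ge> 0"
  shows "Nrm k R (psub (v1 t, v2 t) (w1 t, w2 t)) = 0"
proof -
  define \<omega> where "\<omega> = max (real CARD('a) / 2 - real k - s) (1 - s)"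
  have \<omega>: "real CARD('a) / 2 - real k - s \<le> \<omega>" "- s < \<omega>" by (auto simp: \<omega>_def)
  have sol: "wave_sol s (\<lambda>t x. v1 t x + (-1) * w1 t x) (\<lambda>t x. v2 t x + (-1) * w2 t x)" (is "wave_sol s ?z1 ?z2")
    by (intro wave_sol_add v wave_sol_cmult w)
  obtain M where "Nrm k R (?z1 t, ?z2 t) \<le> M * exp (\<omega> * t) * Nrm k R (?z1 0, ?z2 0)"
    using wave_sol_growth[where 'n='a, OF R k \<omega>] sol t by blast
  moreover have "(?z1 0, ?z2 0) = (\<lambda>x. 0, \<lambda>x. 0)" by (simp add: init)
  ultimately have "Nrm k R (?z1 t, ?z2 t) \<le> 0" by (simp only: Nrm_zero mult_zero_right)
  moreover have "(?z1 t, ?z2 t) \<in> Dom R"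
    by (rule Dom_rp; simp only: fst_conv snd_conv) (rule wave_sol_rp[OF sol])+
  ultimately have "Nrm k R (?z1 t, ?z2 t) = 0" using Nrm_nonneg by (metis order_antisym)
  then show ?thesis by (simp add: psub_eq)
qed

text \<open>A whole curve is selected for each datum, rather than a value for each time, so that the
  flow of a fixed datum is a polynomial curve that can be differentiated and integrated.\<close>

definition wave_solution :: "real \<Rightarrow> ('n::finite) rpair \<Rightarrow> (real \<Rightarrow> 'n rfun) \<times> (real \<Rightarrow> 'n rfun)" where
  "wave_solution s u = (SOME v. wave_sol s (fst v) (snd v) \<and> fst v 0 = fst u \<and> snd v 0 = snd u)"

definition wave_flow :: "real \<Rightarrow> real \<Rightarrow> ('n::finite) rpair \<Rightarrow> 'n rpair" where
  "wave_flow s t u = (fst (wave_solution s u) t, snd (wave_solution s u) t)"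

lemma wave_solution:
  assumes "u \<in> poly_pairs"
  shows "wave_sol s (fst (wave_solution s u)) (snd (wave_solution s u))" "fst (wave_solution s u) 0 = fst u" "snd (wave_solution s u) 0 = snd u"
proof -
  obtain v1 v2 where "wave_sol s v1 v2 \<and> v1 0 = fst u \<and> v2 0 = snd u"
    using wave_sol_exists[of "fst u" "snd u" s] assms by (auto simp: poly_pairs_def)
  then have "\<exists>v. wave_sol s (fst v) (snd v) \<and> fst v 0 = fst u \<and> snd v 0 = snd u"
    by (intro exI[of _ "(v1, v2)"]) simp
  from someI_ex[OF this]
  show "wave_sol s (fst (wave_solution s u)) (snd (wave_solution s u))" "fst (wave_solution s u) 0 = fst u" "snd (wave_solution s u) 0 = snd u"
    unfolding wave_solution_def by auto
qed

lemma wave_flow_poly_pairs: "u \<in> poly_pairs \<Longrightarrow> wave_flow s t u \<in> poly_pairs"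
  unfolding wave_flow_def by (simp add: poly_pairs_def[where 'n='a] wave_sol_rp[OF wave_solution(1)])

lemma wave_flow_unique:
  fixes R s :: real
  assumes "R \<ge> 1" "k \<ge> 1" "u \<in> poly_pairs" "wave_sol s w1 w2" "w1 0 = fst u" "w2 0 = snd u" "t \<ge> 0"
  shows "Nrm k R (psub (wave_flow s t u) (w1 t, w2 t)) = 0"
  unfolding wave_flow_def by (rule wave_sol_unique) (use assms wave_solution[OF assms(3)] in auto)

lemma poly_curve_id_mult: "rp w \<Longrightarrow> poly_curve (\<lambda>t x. t * w x) (\<lambda>t. w)"
  by (rule poly_curve_cong[OF poly_curve_term[of w "\<lambda>t. t" "\<lambda>t. 1"]]) auto

lemma L1_diff_ball:
  assumes "smooth_cl R f" "smooth_cl R f'" and x: "x \<in> ball 0 R"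
  shows "L1 s (\<lambda>x. f x + (-1) * f' x) (\<lambda>x. g x + (-1) * g' x) x = L1 s f g x + (-1) * L1 s f' g' x"
proof -
  have "pd i (\<lambda>x. f x + (-1) * f' x) x = pd i f x - pd i f' x" for i
    using dpart_add_ball[OF assms(1) smooth_cl_cmult[OF assms(2), of "-1"] x, of "[i]"]
      dpart_cmult_ball[OF assms(2) x, of "[i]" "-1"] by simp
  note pds = this
  show ?thesis unfolding L1_def pds by (simp add: algebra_simps sum_subtractf)
qed

lemma L2_diff_ball:
  assumes f: "smooth_cl R f" "smooth_cl R f'" and g: "smooth_cl R g" "smooth_cl R g'" and x: "x \<in> ball 0 R"
  shows "L2 s (\<lambda>x. f x + (-1) * f' x) (\<lambda>x. g x + (-1) * g' x) x = L2 s f g x + (-1) * L2 s f' g' x"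
proof -
  have "pd i (\<lambda>x. g x + (-1) * g' x) x = pd i g x - pd i g' x" for i
    using dpart_add_ball[OF g(1) smooth_cl_cmult[OF g(2), of "-1"] x, of "[i]"]
      dpart_cmult_ball[OF g(2) x, of "[i]" "-1"] by simp
  note 1 = this
  have 2: "pd i (pd i (\<lambda>x. f x + (-1) * f' x)) x = pd i (pd i f) x - pd i (pd i f') x" for i
    using dpart_add_ball[OF f(1) smooth_cl_cmult[OF f(2), of "-1"] x, of "[i, i]"]
      dpart_cmult_ball[OF f(2) x, of "[i, i]" "-1"] by simp
  show ?thesis unfolding L2_def 1 2 by (simp add: algebra_simps sum_subtractf)
qed

lemma poly_pairs_dense:
  fixes u :: "('n::finite) rpair"
  assumes u: "u \<in> Dom R" and R: "R > 0" and e: "e > 0"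
  shows "\<exists>q\<in>poly_pairs. Nrm k R (psub q u) < e \<and> Nrm k R (psub (Lop p q) (Lop p u)) < e"
proof -
  let ?s = "s_p p"
  define C where "C = \<bar>?s\<bar> + \<bar>?s + 1\<bar> + real CARD('n) * (R + real k) + real CARD('n) + 1"
  define c0 where "c0 = sqrt (2 * real (card {al :: 'n list. length al \<le> k})) * ball_norm R (\<lambda>x :: real ^ 'n. 1)"
  have C: "C \<ge> 1" using R by (simp add: C_def)
  have c0: "c0 \<ge> 0" unfolding c0_def by (intro mult_nonneg_nonneg ball_norm_nonneg cont_ext_rp rp_intros(1)) auto
  \<comment> \<open>\<open>c0\<close> converts uniform bounds into \<open>Nrm\<close>, and
    \<open>C \<ge> 1\<close> is the loss under \<open>L\<close>. Both errors are then at most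
    \<open>c0 * C * \<delta>\<close>, and the added 1 makes this strictly less than
    \<open>e\<close>.\<close>
  define \<delta> where "\<delta> = e / (c0 * C + 1)"
  have cC: "c0 * C \<ge> 0" using c0 C by simp
  have \<delta>: "\<delta> > 0" using e cC by (simp add: \<delta>_def)
  have \<delta>e: "c0 * C * \<delta> < e"
  proof -
    have "c0 * C * \<delta> < (c0 * C + 1) * \<delta>" using \<delta> by (intro mult_strict_right_mono) auto
    also have "\<dots> = e" using cC by (simp add: \<delta>_def)
    finally show ?thesis .
  qed
  have us: "smooth_cl R (fst u)" "smooth_cl R (snd u)" using u by (auto simp: Dom_def)
  obtain f where f: "rp f" "small R (k + 2) \<delta> (\<lambda>x. f x + (-1) * fst u x)"
    using polynomial_dense[OF us(1) R \<delta>] by blast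
  obtain g where g: "rp g" "small R (k + 2) \<delta> (\<lambda>x. g x + (-1) * snd u x)"
    using polynomial_dense[OF us(2) R \<delta>] by blast
  note fgs = smooth_cl_rp[OF f(1), of R] smooth_cl_rp[OF g(1), of R]
  have "Nrm k R (psub (f, g) u) \<le> sqrt (2 * real (card {al :: 'n list. length al \<le> k})) * (\<delta> * ball_norm R (\<lambda>x :: real ^ 'n. 1))"
    by (rule Nrm_le_small)
      (use f(2) g(2) \<delta> in \<open>auto simp: psub_def padd_def pscale_def elim: small_mono\<close>)
  also have "\<dots> = c0 * 1 * \<delta>" by (simp add: c0_def)
  also have "\<dots> \<le> c0 * C * \<delta>" using C c0 \<delta> by (intro mult_right_mono mult_left_mono) auto
  finally have 1: "Nrm k R (psub (f, g) u) < e" using \<delta>e by simp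
  have sL: "small R k (C * \<delta>) (\<lambda>x. L1 ?s f g x + (-1) * L1 ?s (fst u) (snd u) x)"
    by (rule small_local[OF small_L(1)[OF R f(2) g(2), of ?s, folded C_def] _ L1_diff_ball[OF fgs(1) us(1)]])
      (intro smooth_cl_add smooth_cl_cmult smooth_cl_L1 fgs us)
  have sL': "small R k (C * \<delta>) (\<lambda>x. L2 ?s f g x + (-1) * L2 ?s (fst u) (snd u) x)"
    by (rule small_local[OF small_L(2)[OF R f(2) g(2), of ?s, folded C_def] _ L2_diff_ball[OF fgs(1) us(1) fgs(2) us(2)]])
      (intro smooth_cl_add smooth_cl_cmult smooth_cl_L2 fgs us)
  have "Nrm k R (psub (Lop p (f, g)) (Lop p u)) \<le>
      sqrt (2 * real (card {al :: 'n list. length al \<le> k})) * ((C * \<delta>) * ball_norm R (\<lambda>x :: real ^ 'n. 1))"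
    by (rule Nrm_le_small)
      (use sL sL' \<delta> C in \<open>auto simp: psub_def padd_def pscale_def Lop_eq\<close>)
  also have "\<dots> = c0 * C * \<delta>" by (simp add: c0_def)
  finally have "Nrm k R (psub (Lop p (f, g)) (Lop p u)) < e" using \<delta>e by simp
  with 1 show ?thesis using f g by (intro bexI[of _ "(f, g)"]) (auto simp: poly_pairs_def)
qed

text \<open>Applying the operator along a solution gives a solution with data L u, so by uniqueness
  the time derivative of the flow of u agrees with the flow of L u. The mean value bound is applied
  to v r - u - r q.\<close>

lemma wave_flow_deriv:
  fixes R :: real
  assumes R: "R \<ge> 1" and k: "k \<ge> 1" and u: "u \<in> poly_pairs" and q: "q \<in> poly_pairs" and h: "0 \<le> h"
    and le: "\<And>r. 0 \<le> r \<Longrightarrow> r \<le> h \<Longrightarrow> Nrm k R (psub (wave_flow (s_p p) r (Lop p u)) q) \<le> c"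
  shows "Nrm k R (psub (psub (wave_flow (s_p p) h u) u) (pscale h q)) \<le> h * c"
proof -
  let ?s = "s_p p"
  obtain v1 v2 where v: "wave_solution ?s u = (v1, v2)" by (cases "wave_solution ?s u")
  have sol: "wave_sol ?s v1 v2" and init: "v1 0 = fst u" "v2 0 = snd u" using wave_solution[OF u, of ?s] v by auto
  have Tv: "wave_flow ?s r u = (v1 r, v2 r)" for r by (simp add: wave_flow_def v)
  note p = sol[unfolded wave_sol_def, THEN conjunct1] sol[unfolded wave_sol_def, THEN conjunct2]
  have LuP: "Lop p u \<in> poly_pairs" using u by (simp add: poly_pairs_def Lop_eq rp_L1 rp_L2)
  have qr: "rp (fst q)" "rp (snd q)" "rp (fst u)" "rp (snd u)" using q u by (auto simp: poly_pairs_def)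
  have "Nrm k R ((\<lambda>x. v1 h x - fst u x - h * fst q x), (\<lambda>x. v2 h x - snd u x - h * snd q x)) \<le> h * c"
  proof (rule Nrm_mean_value[where ?v1.0="\<lambda>r x. v1 r x - fst u x - r * fst q x" and ?v2.0="\<lambda>r x. v2 r x - snd u x - r * snd q x"])
    show "poly_curve (\<lambda>r x. v1 r x - fst u x - r * fst q x) (\<lambda>r x. L1 ?s (v1 r) (v2 r) x - fst q x)"
      by (rule poly_curve_cong[OF poly_curve_diff[OF poly_curve_diff[OF p(1) poly_curve_const[OF qr(3)]] poly_curve_id_mult[OF qr(1)]]]) auto
    show "poly_curve (\<lambda>r x. v2 r x - snd u x - r * snd q x) (\<lambda>r x. L2 ?s (v1 r) (v2 r) x - snd q x)"
      by (rule poly_curve_cong[OF poly_curve_diff[OF poly_curve_diff[OF p(2) poly_curve_const[OF qr(4)]] poly_curve_id_mult[OF qr(2)]]]) auto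
    fix r assume r: "0 \<le> r" "r \<le> h"
    let ?A = "(L1 ?s (v1 r) (v2 r), L2 ?s (v1 r) (v2 r))" and ?B = "wave_flow ?s r (Lop p u)"
    have B: "?B \<in> poly_pairs" by (rule wave_flow_poly_pairs[OF LuP])
    have A: "?A \<in> poly_pairs" using wave_sol_rp[OF sol, of r] by (simp add: poly_pairs_def rp_L1 rp_L2)
    have "Nrm k R (psub ?B ?A) = 0"
      by (rule wave_flow_unique[OF R k LuP wave_sol_L[OF sol] _ _ r(1)]) (simp_all add: init Lop_eq)
    moreover have "psub ?A ?B = pscale (-1) (psub ?B ?A)" by (simp add: psub_def padd_def pscale_def)
    moreover have BA: "psub ?B ?A \<in> Dom R" "psub ?A ?B \<in> Dom R" "psub ?B q \<in> Dom R"
      unfolding psub_def by (intro Dom_padd Dom_pscale poly_pairs_Dom A B q)+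
    ultimately have z: "Nrm k R (psub ?A ?B) = 0" using Nrm_pscale[OF BA(1), of k "-1"] by simp
    have "psub ?A q = padd (psub ?A ?B) (psub ?B q)" by (simp add: psub_def padd_def pscale_def)
    then have "Nrm k R (psub ?A q) \<le> 0 + Nrm k R (psub ?B q)" using Nrm_padd[OF BA(2,3), of k] z by simp
    also have "\<dots> \<le> c" using le[OF r] by simp
    finally show "Nrm k R (\<lambda>x. L1 ?s (v1 r) (v2 r) x - fst q x, \<lambda>x. L2 ?s (v1 r) (v2 r) x - snd q x) \<le> c"
      by (simp add: psub_eq)
  qed (use init h in auto)
  then show ?thesis by (simp add: psub_eq Tv pscale_def)
qed

text \<open>For the antiderivative V of the solution v with V = 0 at time 0, L V and v have the same
  time derivative, hence L V = v - u. Then V h / h is the average \<open>m\<close>, and the mean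
  value bound for V r - r u estimates its distance from u.\<close>

lemma wave_flow_average:
  fixes R :: real
  assumes u: "u \<in> poly_pairs" and h: "0 < h"
  shows "\<exists>m\<in>poly_pairs. Nrm k R (psub (Lop p m) (pscale (1 / h) (psub (wave_flow (s_p p) h u) u))) = 0 \<and>
      (\<forall>c. (\<forall>r. 0 \<le> r \<and> r \<le> h \<longrightarrow> Nrm k R (psub (wave_flow (s_p p) r u) u) \<le> c) \<longrightarrow> Nrm k R (psub m u) \<le> c)"
proof -
  let ?s = "s_p p"
  obtain v1 v2 where v: "wave_solution ?s u = (v1, v2)" by (cases "wave_solution ?s u")
  have sol: "wave_sol ?s v1 v2" and init: "v1 0 = fst u" "v2 0 = snd u" using wave_solution[OF u, of ?s] v by auto
  have Tv: "wave_flow ?s r u = (v1 r, v2 r)" for r by (simp add: wave_flow_def v)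
  note p = sol[unfolded wave_sol_def, THEN conjunct1] sol[unfolded wave_sol_def, THEN conjunct2]
  have ur: "rp (fst u)" "rp (snd u)" using u by (auto simp: poly_pairs_def)
  obtain V1 where V1: "poly_curve V1 v1" "\<And>x. V1 0 x = 0" using poly_curve_antideriv[OF p(1)] by blast
  obtain V2 where V2: "poly_curve V2 v2" "\<And>x. V2 0 x = 0" using poly_curve_antideriv[OF p(2)] by blast
  have V0: "V1 0 = (\<lambda>x. 0)" "V2 0 = (\<lambda>x. 0)" using V1(2) V2(2) by auto
  note rV = poly_curve_rp[OF V1(1)] poly_curve_rp[OF V2(1)]
  have LV1: "L1 ?s (V1 t) (V2 t) x = v1 t x - fst u x" for t x
  proof -
    have "\<forall>t. ((\<lambda>t. L1 ?s (V1 t) (V2 t) x - v1 t x) has_real_derivative 0) (at t)"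
      by (intro allI DERIV_cong[OF DERIV_diff[OF poly_curve_deriv[OF poly_curve_L1[OF V1(1) V2(1)]] poly_curve_deriv[OF p(1)]]]) simp
    from DERIV_isconst_all[OF this, of t 0] show ?thesis
      by (simp add: V0 init) (simp add: L1_def pd_const)
  qed
  have LV2: "L2 ?s (V1 t) (V2 t) x = v2 t x - snd u x" for t x
  proof -
    have "\<forall>t. ((\<lambda>t. L2 ?s (V1 t) (V2 t) x - v2 t x) has_real_derivative 0) (at t)"
      by (intro allI DERIV_cong[OF DERIV_diff[OF poly_curve_deriv[OF poly_curve_L2[OF V1(1) V2(1)]] poly_curve_deriv[OF p(2)]]]) simp
    from DERIV_isconst_all[OF this, of t 0] show ?thesis
      by (simp add: V0 init) (simp add: L2_def pd_const)
  qed
  define m where "m = ((\<lambda>x. 1 / h * V1 h x), (\<lambda>x. 1 / h * V2 h x))"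
  have mP: "m \<in> poly_pairs"
    unfolding m_def poly_pairs_def mem_Collect_eq fst_conv snd_conv by (intro conjI rp_intros rV)
  have "Lop p m = pscale (1 / h) (psub (wave_flow ?s h u) u)"
    unfolding Lop_eq m_def fst_conv snd_conv L1_cmult[OF rV(1)] L2_cmult[OF rV] LV1 LV2
    by (simp add: pscale_def psub_eq Tv)
  moreover have "Lop p m \<in> Dom R" by (rule Lop_Dom[OF poly_pairs_Dom[OF mP]])
  ultimately have 1: "Nrm k R (psub (Lop p m) (pscale (1 / h) (psub (wave_flow ?s h u) u))) = 0"
    using Nrm_psub_self by metis
  have 2: "Nrm k R (psub m u) \<le> c" if c: "\<And>r. 0 \<le> r \<Longrightarrow> r \<le> h \<Longrightarrow> Nrm k R (psub (wave_flow ?s r u) u) \<le> c" for c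
  proof -
    let ?W = "((\<lambda>x. V1 h x - h * fst u x), (\<lambda>x. V2 h x - h * snd u x))"
    have "Nrm k R ?W \<le> h * c"
    proof (rule Nrm_mean_value[where ?v1.0="\<lambda>r x. V1 r x - r * fst u x" and ?v2.0="\<lambda>r x. V2 r x - r * snd u x"])
      show "poly_curve (\<lambda>r x. V1 r x - r * fst u x) (\<lambda>r x. v1 r x - fst u x)"
        by (rule poly_curve_diff[OF V1(1) poly_curve_id_mult[OF ur(1)]])
      show "poly_curve (\<lambda>r x. V2 r x - r * snd u x) (\<lambda>r x. v2 r x - snd u x)"
        by (rule poly_curve_diff[OF V2(1) poly_curve_id_mult[OF ur(2)]])
      show "Nrm k R (\<lambda>x. v1 r x - fst u x, \<lambda>x. v2 r x - snd u x) \<le> c" if "0 \<le> r" "r \<le> h" for r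
        using c[OF that] by (simp add: psub_eq Tv)
    qed (use V1(2) V2(2) h in auto)
    moreover have "psub m u = pscale (1 / h) ?W"
      using h by (simp add: m_def psub_eq pscale_def field_simps)
    moreover have "?W \<in> Dom R"
      using ur rV by (intro Dom_rp) (auto intro!: rp_intros)
    ultimately have "Nrm k R (psub m u) \<le> 1 / h * (h * c)"
      using h Nrm_pscale[of ?W R k "1 / h"] mult_left_mono[of "Nrm k R ?W" "h * c" "1 / h"] by simp
    then show ?thesis using h by simp
  qed
  show ?thesis using mP 1 2 by blast
qed

theorem mainTheorem8:
  fixes p R :: real and k :: nat
  assumes "p > 1" and "R \<ge> 1" and "k \<ge> 1"
  shows "closable_op (Dom R :: ('n::finite) rpair set) (Nrm k R) (Lop p) \<and>
    (\<exists>S. generates (Dom R :: 'n rpair set) (Nrm k R) (Lop p) S \<and>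
      (\<forall>\<epsilon>. 0 < \<epsilon> \<and> \<epsilon> < 1/2 \<longrightarrow>
        (\<exists>M\<ge>1. \<forall>U\<in>compl (Dom R :: 'n rpair set) (Nrm k R). \<forall>\<tau>\<ge>0.
           cnorm (Nrm k R) (S \<tau> U)
             \<le> M * exp ((- s_p p + max (real CARD('n) / 2 - real k) \<epsilon>) * \<tau>)
                 * cnorm (Nrm k R) U)))"
proof -
  let ?s = "s_p p"
  note R = \<open>R \<ge> 1\<close> and k = \<open>k \<ge> 1\<close>
  have growth: "\<exists>M\<ge>1. \<forall>u\<in>poly_pairs :: 'n rpair set. \<forall>t\<ge>0. Nrm k R (wave_flow ?s t u) \<le> M * exp (\<omega> * t) * Nrm k R u"
    if \<omega>: "real CARD('n) / 2 - real k - ?s \<le> \<omega>" "- ?s < \<omega>" for \<omega>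
  proof -
    obtain M where M: "M \<ge> 1" "\<And>(v1 :: real \<Rightarrow> 'n rfun) v2 t. wave_sol ?s v1 v2 \<Longrightarrow> t \<ge> 0 \<Longrightarrow>
      Nrm k R (v1 t, v2 t) \<le> M * exp (\<omega> * t) * Nrm k R (v1 0, v2 0)"
      using wave_sol_growth[where 'n='n, OF R k \<omega>] by blast
    have "Nrm k R (wave_flow ?s t u) \<le> M * exp (\<omega> * t) * Nrm k R u" if "u \<in> poly_pairs" "t \<ge> 0" for u :: "'n rpair" and t
      using M(2)[OF wave_solution(1)[OF that(1)] that(2)] wave_solution(2,3)[OF that(1), of ?s] by (simp add: wave_flow_def)
    then show ?thesis using M(1) by blast
  qed
  \<comment> \<open>A rate that is admissible and nonnegative, so that \<open>M * exp w\<close>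
    bounds the flow on the unit interval. It serves to construct the semigroup; the rates of the
    theorem are treated afterwards.\<close>
  define w where "w = \<bar>real CARD('n) / 2 - real k - ?s\<bar> + \<bar>?s\<bar> + 1"
  have w: "real CARD('n) / 2 - real k - ?s \<le> w" "- ?s < w" "0 \<le> w" by (auto simp: w_def)
  obtain M where M: "M \<ge> 1" "\<And>(u :: 'n rpair) t. u \<in> poly_pairs \<Longrightarrow> t \<ge> 0 \<Longrightarrow> Nrm k R (wave_flow ?s t u) \<le> M * exp (w * t) * Nrm k R u"
    using growth[OF w(1,2)] by blast
  interpret core_flow "Dom R :: 'n rpair set" poly_pairs "Nrm k R" "Lop p" "wave_flow ?s" "\<lambda>t. M * exp (w * t)" "M * exp w"
  proof
    show "(poly_pairs :: 'n rpair set) \<subseteq> Dom R" using poly_pairs_Dom by blast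
    show "padd u v \<in> poly_pairs" if "u \<in> poly_pairs" "v \<in> poly_pairs" for u v :: "'n rpair"
      using that by (auto simp: poly_pairs_def padd_def intro: rp_intros)
    show "pscale c u \<in> poly_pairs" if "u \<in> poly_pairs" for c and u :: "'n rpair"
      using that by (auto simp: poly_pairs_def pscale_def intro: rp_intros)
    show "Lop p u \<in> poly_pairs" if "u \<in> poly_pairs" for u :: "'n rpair"
      using that by (simp add: poly_pairs_def Lop_eq rp_L1 rp_L2)
    show "M * exp (w * t) \<le> M * exp w" if "0 \<le> t" "t \<le> 1" for t
      using M(1) w(3) that by (simp add: mult_left_le)
    show "Nrm k R (psub (wave_flow ?s t (padd u v)) (padd (wave_flow ?s t u) (wave_flow ?s t v))) = 0"
      if "0 \<le> t" "u \<in> poly_pairs" "v \<in> poly_pairs" for t and u v :: "'n rpair"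
    proof -
      have "padd u v \<in> poly_pairs" using that by (auto simp: poly_pairs_def padd_def intro: rp_intros)
      from wave_flow_unique[OF R k this wave_sol_add[OF wave_solution(1)[OF that(2)] wave_solution(1)[OF that(3)]] _ _ that(1)]
      show ?thesis using wave_solution(2,3)[OF that(2), of ?s] wave_solution(2,3)[OF that(3), of ?s]
        by (simp add: padd_def wave_flow_def)
    qed
    show "Nrm k R (psub (wave_flow ?s t (pscale c u)) (pscale c (wave_flow ?s t u))) = 0"
      if "0 \<le> t" "u \<in> poly_pairs" for t c and u :: "'n rpair"
    proof -
      have "pscale c u \<in> poly_pairs" using that by (auto simp: poly_pairs_def pscale_def intro: rp_intros)
      from wave_flow_unique[OF R k this wave_sol_cmult[OF wave_solution(1)[OF that(2)]] _ _ that(1)]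
      show ?thesis using wave_solution(2,3)[OF that(2), of ?s] by (simp add: pscale_def wave_flow_def)
    qed
    show "Nrm k R (psub (wave_flow ?s 0 u) u) = 0" if "u \<in> poly_pairs" for u :: "'n rpair"
      using wave_solution(2,3)[OF that, of ?s] Nrm_psub_self[OF poly_pairs_Dom[OF that]] by (simp add: wave_flow_def)
    show "Nrm k R (psub (wave_flow ?s (t + r) u) (wave_flow ?s t (wave_flow ?s r u))) = 0"
      if t: "0 \<le> t" and r: "0 \<le> r" and u: "u \<in> poly_pairs" for t r and u :: "'n rpair"
      unfolding wave_flow_def[of ?s "t + r" u] wave_flow_def[of ?s t "wave_flow ?s r u"]
      by (rule wave_sol_unique[OF R k wave_sol_shift[OF wave_solution(1)[OF u], where r=r] wave_solution(1)[OF wave_flow_poly_pairs[OF u]] _ _ t])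
        (use wave_solution(2,3)[OF wave_flow_poly_pairs[OF u, of ?s r], of ?s] in \<open>simp_all add: wave_flow_def\<close>)
    show "((\<lambda>t. Nrm k R (psub (wave_flow ?s t u) u)) \<longlongrightarrow> 0) (at_right 0)" if u: "u \<in> poly_pairs" for u :: "'n rpair"
    proof -
      note p = wave_solution(1)[OF u, of ?s, unfolded wave_sol_def, THEN conjunct1] wave_solution(1)[OF u, of ?s, unfolded wave_sol_def, THEN conjunct2]
      have ur: "rp (fst u)" "rp (snd u)" using u by (auto simp: poly_pairs_def)
      show ?thesis
        unfolding psub_eq wave_flow_def fst_conv snd_conv
        by (rule Nrm_poly_curve_tendsto[OF poly_curve_diff[OF p(1) poly_curve_const[OF ur(1)]] poly_curve_diff[OF p(2) poly_curve_const[OF ur(2)]]])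
          (simp_all add: wave_solution(2,3)[OF u])
    qed
    show "Nrm k R (psub (psub (wave_flow ?s h u) u) (pscale h q)) \<le> h * c"
      if "u \<in> poly_pairs" "q \<in> poly_pairs" "0 \<le> h" "\<And>r. 0 \<le> r \<Longrightarrow> r \<le> h \<Longrightarrow> Nrm k R (psub (wave_flow ?s r (Lop p u)) q) \<le> c"
      for h c and u q :: "'n rpair" by (rule wave_flow_deriv[OF R k that])
    show "\<exists>m\<in>poly_pairs. Nrm k R (psub (Lop p m) (pscale (1 / h) (psub (wave_flow ?s h u) u))) = 0 \<and>
      (\<forall>c. (\<forall>r. 0 \<le> r \<and> r \<le> h \<longrightarrow> Nrm k R (psub (wave_flow ?s r u) u) \<le> c) \<longrightarrow> Nrm k R (psub m u) \<le> c)"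
      if "u \<in> poly_pairs" "0 < h" for h and u :: "'n rpair" by (rule wave_flow_average[OF that])
    show "\<exists>q\<in>poly_pairs. Nrm k R (psub q u) < e \<and> Nrm k R (psub (Lop p q) (Lop p u)) < e"
      if "u \<in> Dom R" "0 < e" for e and u :: "'n rpair"
      using that R by (intro poly_pairs_dense) auto
  qed (use M in \<open>auto intro: Dom_padd Dom_pscale Nrm_padd Nrm_pscale Nrm_nonneg Lop_Dom wave_flow_poly_pairs\<close>)
  \<comment> \<open>The semigroup is already fixed, and each \<epsilon> only brings its own constant
    on polynomials, which \<open>S_cnorm_le\<close> carries over. Positivity of \<epsilon> gives the
    strict inequality \<open>- ?s < ?\<omega>\<close>.\<close>
  have "\<exists>M\<ge>1. \<forall>U\<in>compl (Dom R :: 'n rpair set) (Nrm k R). \<forall>\<tau>\<ge>0.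
      cnorm (Nrm k R) (S \<tau> U) \<le> M * exp ((- ?s + max (real CARD('n) / 2 - real k) \<epsilon>) * \<tau>) * cnorm (Nrm k R) U"
    if \<epsilon>: "0 < \<epsilon>" for \<epsilon>
  proof -
    let ?\<omega> = "- ?s + max (real CARD('n) / 2 - real k) \<epsilon>"
    have "real CARD('n) / 2 - real k - ?s \<le> ?\<omega>" "- ?s < ?\<omega>" using \<epsilon> by auto
    from growth[OF this] obtain M' where M': "M' \<ge> 1"
      "\<And>(u :: 'n rpair) t. u \<in> poly_pairs \<Longrightarrow> t \<ge> 0 \<Longrightarrow> Nrm k R (wave_flow ?s t u) \<le> M' * exp (?\<omega> * t) * Nrm k R u" by blast
    have "cnorm (Nrm k R) (S \<tau> U) \<le> M' * exp (?\<omega> * \<tau>) * cnorm (Nrm k R) U"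
      if "U \<in> compl (Dom R :: 'n rpair set) (Nrm k R)" "\<tau> \<ge> 0" for U \<tau>
      by (rule S_cnorm_le[OF that(2) M'(2)[OF _ that(2)] that(1)])
    then show ?thesis using M'(1) by blast
  qed
  then show ?thesis using closable generates_S by blast
qed

end
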